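(* Let $a,\sigma_L,\sigma_M,\sigma_R>0$ and let $u_0^L$ be given initial data on $(-\infty,-a)$. Let $(u^L,u^M,u^R)$ be the solution (in the sense of the context) of $$u^L_t=\sigma_L^2u^L_{xx}\ (x<-a),\qquad u^M_t=\sigma_M^2u^M_{xx}\ (-a<x<a),\qquad u^R_t=\sigma_R^2u^R_{xx}\ (x>a),\qquad t>0,$$ with initial conditions $u^L(x,0)=u_0^L(x)$ for $x<-a$, $u^M(x,0)=0$ for $-a<x<a$, $u^R(x,0)=0$ for $x>a$; asymptotic conditions $\lim_{x\to-\infty}u^L(x,t)=0$ and $\lim_{x\to\infty}u^R(x,t)=0$; and continuity conditions $$u^L(-a,t)=u^M(-a,t),\quad u^M(a,t)=u^R(a,t),\quad \sigma_L^2u^L_x(-a,t)=\sigma_M^2u^M_x(-a,t),\quad \sigma_M^2u^M_x(a,t)=\sigma_R^2u_x^R(a,t).$$ Then for $t>0$: for $x<-a$, $$\begin{aligned}u^L(x,t)=\;&\frac1{2\pi}\int_{-\infty}^\infty e^{ikx-(\sigma_Lk)^2t}\hat u_0^L(k)\,dk\\&-\frac12\int_{\partial D_0^-}\frac{e^{ik(x+2a)-(\sigma_Lk)^2t}}{\Delta_L(k)}\Big((\sigma_L+\sigma_M)(\sigma_M-\sigma_R)+e^{4ika\sigma_L/\sigma_M}(\sigma_L-\sigma_M)(\sigma_M+\sigma_R)\Big)\hat u_0^L(-k)\,dk;\end{aligned}$$ for $-a<x<a$, $$\begin{aligned}u^M(x,t)=\;&-\sigma_M(\sigma_M-\sigma_R)\int_{\partial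 D_0^-}\frac{e^{ik(x+a+a\sigma_M/\sigma_L)-(\sigma_Mk)^2t}}{\Delta_L(k\sigma_M/\sigma_L)}\hat u_0^L\left(\frac{-k\sigma_M}{\sigma_L}\right)dk\\&+\sigma_M(\sigma_M+\sigma_R)\int_{\partial D_0^+}\frac{e^{ik(x+a-a\sigma_M/\sigma_L)-(\sigma_Mk)^2t}}{\Delta_R(k\sigma_M/\sigma_R)}\hat u_0^L\left(\frac{k\sigma_M}{\sigma_L}\right)dk;\end{aligned}$$ and for $x>a$, $$u^R(x,t)=2\sigma_M\sigma_R\int_{\partial D_0^+}\frac{e^{ik(x-a-a\sigma_R/\sigma_L+2a\sigma_R/\sigma_M)-(\sigma_Rk)^2t}}{\Delta_R(k)}\hat u_0^L\left(\frac{k\sigma_R}{\sigma_L}\right)dk.$$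
   Context: Notation: $\hat u_0^L(k)=\int_{-\infty}^{-a}e^{-ikx}u_0^L(x)\,dx$ for $\operatorname{Im}k\ge0$, and $$\Delta_L(k)=\pi\left((\sigma_L-\sigma_M)(\sigma_M-\sigma_R)+e^{4iak\sigma_L/\sigma_M}(\sigma_L+\sigma_M)(\sigma_M+\sigma_R)\right),$$ $$\Delta_R(k)=\pi\left((\sigma_L+\sigma_M)(\sigma_M+\sigma_R)+e^{4iak\sigma_R/\sigma_M}(\sigma_L-\sigma_M)(\sigma_M-\sigma_R)\right).$$ Contours: $D=\{k\in\mathbb{C}:\operatorname{Re}(k^2)<0\}=D^+\cup D^-$, where $D^\pm$ are the parts of $D$ in the upper/lower half-plane. $D_0^\pm$ is $D^\pm$ deformed so that its boundary avoids $k=0$: $D_0^\pm=\{k\in D^\pm:|k|>r\}$ for some fixed $r>0$. Boundaries are oriented with the region on the left: $\partial D_0^+$ runs from $\infty e^{3\pi i/4}$ to $\infty e^{i\pi/4}$, and $\partial D_0^-$ runs from $\infty e^{-i\pi/4}$ to $\infty e^{-3\pi i/4}$. Standing regularity and decay conventions: $u_0^L$ is integrable. A solution is a classical one: for $t>0$ each of $u^L,u^M,u^R$ is $C^1$ in $t$ and $C^2$ in $x$ in its open domain, $u$ and $u_x$ extend continuously to the finite endpoints of the $x$-domain, their values there are integrable in time on $(0,T)$ for every $T>0$, $t\mapsto u(\cdot,t)$ is continuous from $[0,\infty)$ into $L^1$ (so that the initial condition is attained), and $u,u_x\to0$ as $|x|\to\infty$ uniformly for $t$ in compact subsets of $(0,\infty)$.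 *)

theory Defs
  imports "HOL-Complex_Analysis.Complex_Analysis"
begin

definition half_line_ft :: "real \<Rightarrow> (real \<Rightarrow> complex) \<Rightarrow> complex \<Rightarrow> complex" where
  "half_line_ft a u0 k = (LINT x:{..<-a}|lebesgue. exp (- \<i> * k * of_real x) * u0 x)"

definition Delta_L :: "real \<Rightarrow> real \<Rightarrow> real \<Rightarrow> real \<Rightarrow> complex \<Rightarrow> complex" where
  "Delta_L a \<sigma>L \<sigma>M \<sigma>R k =
     of_real pi * (of_real ((\<sigma>L - \<sigma>M) * (\<sigma>M - \<sigma>R))
       + exp (4 * \<i> * of_real a * k * of_real (\<sigma>L / \<sigma>M)) * of_real ((\<sigma>L + \<sigma>M) * (\<sigma>M + \<sigma>R)))"

definition Delta_R :: "real \<Rightarrow> real \<Rightarrow> real \<Rightarrow> real \<Rightarrow> complex \<Rightarrow> complex" where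
  "Delta_R a \<sigma>L \<sigma>M \<sigma>R k =
     of_real pi * (of_real ((\<sigma>L + \<sigma>M) * (\<sigma>M + \<sigma>R))
       + exp (4 * \<i> * of_real a * k * of_real (\<sigma>R / \<sigma>M)) * of_real ((\<sigma>L - \<sigma>M) * (\<sigma>M - \<sigma>R)))"

definition D0_plus :: "real \<Rightarrow> complex set" where
  "D0_plus r = {k. Re (k\<^sup>2) < 0 \<and> Im k > 0 \<and> norm k > r}"

definition D0_minus :: "real \<Rightarrow> complex set" where
  "D0_minus r = {k. Re (k\<^sup>2) < 0 \<and> Im k < 0 \<and> norm k > r}"

text \<open>The boundaries of \<^term>\<open>D0_plus r\<close> and \<^term>\<open>D0_minus r\<close>, cut off at \<open>|k| = R\<close> and
  oriented with the region on the left.\<close>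

definition bdry_D0_plus :: "real \<Rightarrow> real \<Rightarrow> real \<Rightarrow> complex" where
  "bdry_D0_plus r R =
     linepath (of_real R * cis (3 * pi / 4)) (of_real r * cis (3 * pi / 4))
     +++ part_circlepath 0 r (3 * pi / 4) (pi / 4)
     +++ linepath (of_real r * cis (pi / 4)) (of_real R * cis (pi / 4))"

definition bdry_D0_minus :: "real \<Rightarrow> real \<Rightarrow> real \<Rightarrow> complex" where
  "bdry_D0_minus r R =
     linepath (of_real R * cis (- pi / 4)) (of_real r * cis (- pi / 4))
     +++ part_circlepath 0 r (- pi / 4) (- 3 * pi / 4)
     +++ linepath (of_real r * cis (- 3 * pi / 4)) (of_real R * cis (- 3 * pi / 4))"

text \<open>Integral over an unbounded contour, given by its truncations \<^term>\<open>\<gamma> R\<close>.\<close>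

definition has_improper_contour_integral ::
    "(complex \<Rightarrow> complex) \<Rightarrow> complex \<Rightarrow> (real \<Rightarrow> real \<Rightarrow> complex) \<Rightarrow> bool" where
  "has_improper_contour_integral f I \<gamma> \<longleftrightarrow>
     (\<forall>\<^sub>F R in at_top. f contour_integrable_on \<gamma> R) \<and>
     ((\<lambda>R. contour_integral (\<gamma> R) f) \<longlongrightarrow> I) at_top"

text \<open>\<open>classical_heat_solution \<sigma> J u ux\<close>: \<open>u\<close> (arguments: space, then time) solves
  \<open>u\<^sub>t = \<sigma>\<^sup>2 u\<^sub>x\<^sub>x\<close> on the open interval \<open>J\<close> for \<open>t > 0\<close>, with
  \<open>ux\<close> its space derivative.  At the finite endpoints of \<open>J\<close>, i.e. on \<^term>\<open>frontier J\<close>, the values of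
  \<open>u\<close> and \<open>ux\<close> are those of their continuous extensions.\<close>

definition classical_heat_solution ::
    "real \<Rightarrow> real set \<Rightarrow> (real \<Rightarrow> real \<Rightarrow> complex) \<Rightarrow> (real \<Rightarrow> real \<Rightarrow> complex) \<Rightarrow> bool" where
  "classical_heat_solution \<sigma> J u ux \<longleftrightarrow>
     (\<exists>ut uxx.
        (\<forall>x\<in>J. \<forall>t>0.
           ((\<lambda>s. u x s) has_vector_derivative ut x t) (at t) \<and>
           ((\<lambda>y. u y t) has_vector_derivative ux x t) (at x) \<and>
           ((\<lambda>y. ux y t) has_vector_derivative uxx x t) (at x) \<and>
           ut x t = of_real (\<sigma>\<^sup>2) * uxx x t) \<and>
        continuous_on (J \<times> {0<..}) (\<lambda>(x, t). ut x t) \<and>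
        continuous_on (J \<times> {0<..}) (\<lambda>(x, t). uxx x t)) \<and>
     continuous_on (closure J \<times> {0<..}) (\<lambda>(x, t). u x t) \<and>
     continuous_on (closure J \<times> {0<..}) (\<lambda>(x, t). ux x t) \<and>
     (\<forall>x\<in>frontier J. \<forall>T>0.
        u x absolutely_integrable_on {0<..<T} \<and> ux x absolutely_integrable_on {0<..<T}) \<and>
     (\<forall>t\<ge>0. (\<lambda>x. u x t) absolutely_integrable_on J) \<and>
     (\<forall>t0\<ge>0. ((\<lambda>t. LINT x:J|lebesgue. norm (u x t - u x t0)) \<longlongrightarrow> 0) (at t0 within {0..})) \<and>
     (\<forall>K. compact K \<and> K \<subseteq> {0<..} \<longrightarrow>
        uniform_limit K u (\<lambda>_. 0) (inf at_infinity (principal J)) \<and>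
        uniform_limit K ux (\<lambda>_. 0) (inf at_infinity (principal J)))"

lemma Re_power2_neg_iff: "Re (k\<^sup>2) < 0 \<longleftrightarrow> \<bar>Re k\<bar> < \<bar>Im k\<bar>"
  using abs_le_square_iff[of "Im k" "Re k"] by (simp add: Re_power2 not_le[symmetric])

lemma D0_plus_eq: "D0_plus r = {k. \<bar>Re k\<bar> < Im k \<and> norm k > r}"
  unfolding D0_plus_def Re_power2_neg_iff by auto

lemma D0_minus_eq: "D0_minus r = uminus ` D0_plus r"
proof -
  have "k \<in> D0_minus r \<longleftrightarrow> - k \<in> D0_plus r" for k
    by (simp add: D0_minus_def D0_plus_def)
  then show ?thesis
    unfolding set_eq_iff by (metis image_iff minus_minus)
qed

lemma frontier_D0_plus:
  assumes "r > 0"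
  shows "frontier (D0_plus r) = {k. \<bar>Re k\<bar> \<le> Im k \<and> norm k \<ge> r \<and> (\<bar>Re k\<bar> = Im k \<or> norm k = r)}"
proof -
  have "open {k. \<bar>Re k\<bar> < Im k \<and> norm k > r}"
    by (intro open_Collect_conj open_Collect_less continuous_intros)
  then have int: "interior (D0_plus r) = D0_plus r"
    by (simp add: D0_plus_eq interior_open)
  have "closed {k. \<bar>Re k\<bar> \<le> Im k \<and> norm k \<ge> r}"
    by (intro closed_Collect_conj closed_Collect_le continuous_intros)
  then have 1: "closure (D0_plus r) \<subseteq> {k. \<bar>Re k\<bar> \<le> Im k \<and> norm k \<ge> r}"
    by (intro closure_minimal) (auto simp: D0_plus_eq)
  have 2: "k \<in> closure (D0_plus r)" if k: "\<bar>Re k\<bar> \<le> Im k" "norm k \<ge> r" for k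
    unfolding closure_approachable
  proof (intro allI impI)
    fix e :: real assume e: "e > 0"
    define z where "z = k + of_real (e/2) * \<i>"
    have "(norm z)\<^sup>2 = (norm k)\<^sup>2 + e * Im k + (e/2)\<^sup>2"
      unfolding cmod_power2 z_def by (simp add: power2_eq_square algebra_simps)
    moreover have "e * Im k \<ge> 0" using e k by auto
    ultimately have "(norm z)\<^sup>2 > (norm k)\<^sup>2" using e by (smt (verit) half_gt_zero zero_less_power)
    then have "norm z > norm k" by (simp add: power2_less_imp_less)
    then have "z \<in> D0_plus r" using k e by (auto simp: D0_plus_eq z_def)
    moreover have "dist z k < e" using e by (simp add: z_def dist_norm norm_mult)
    ultimately show "\<exists>y\<in>D0_plus r. dist y k < e" by blast
  qed
  have "closure (D0_plus r) = {k. \<bar>Re k\<bar> \<le> Im k \<and> norm k \<ge> r}"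
    using 1 2 by blast
  then show ?thesis
    unfolding frontier_def int by (auto simp: D0_plus_eq)
qed

lemma frontier_D0_minus: "frontier (D0_minus r) = uminus ` frontier (D0_plus r)"
proof -
  have "closure (uminus ` D0_plus r) = uminus ` closure (D0_plus r)"
    by (intro closure_injective_linear_image[symmetric] linear_uminus) auto
  moreover have "interior (uminus ` D0_plus r) = uminus ` interior (D0_plus r)"
    by (rule interior_negations)
  ultimately show ?thesis
    by (simp add: D0_minus_eq frontier_def image_set_diff)
qed

lemma segment_ray:
  assumes "r \<le> R"
  shows "closed_segment (of_real r * c) (of_real R * c) = (\<lambda>s. of_real s * (c::complex)) ` {r..R}"
proof -
  have "closed_segment (r *\<^sub>R c) (R *\<^sub>R c) = (\<lambda>s. s *\<^sub>R c) ` closed_segment r R"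
    by (rule closed_segment_linear_image) (simp add: linear_iff scaleR_left_distrib)
  then show ?thesis
    using assms by (simp add: closed_segment_eq_real_ivl scaleR_conv_of_real)
qed

lemma sector_iff:
  assumes "-pi < x" "x \<le> pi"
  shows "\<bar>cos x\<bar> \<le> sin x \<longleftrightarrow> pi/4 \<le> x \<and> x \<le> 3*pi/4"
proof
  assume h: "\<bar>cos x\<bar> \<le> sin x"
  then have x0: "0 \<le> x"
    using assms sin_gt_zero[of "- x"] by (cases "x < 0") auto
  have s: "cos (pi/4) = sin (pi/4)" by (simp add: cos_45 sin_45)
  have A: "cos y > sin y" if "0 \<le> y" "y < pi/4" for y
  proof -
    have "cos y > cos (pi/4)" using that by (intro cos_monotone_0_pi) auto
    moreover have "sin (pi/4) > sin y" using that by (intro sin_monotone_2pi) auto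
    ultimately show ?thesis using s by simp
  qed
  show "pi/4 \<le> x \<and> x \<le> 3*pi/4"
    using A[of x] A[of "pi - x"] h x0 assms by (auto simp: not_le[symmetric]) (smt (verit))+
next
  assume h: "pi/4 \<le> x \<and> x \<le> 3*pi/4"
  have s: "cos (pi/4) = sin (pi/4)" by (simp add: cos_45 sin_45)
  have A: "cos y \<le> sin y" if "pi/4 \<le> y" "y \<le> 3*pi/4" for y
  proof -
    have "cos y \<le> cos (pi/4)" using that by (intro cos_monotone_0_pi_le) auto
    moreover have "sin (pi/4) \<le> sin y"
    proof (cases "y \<le> pi/2")
      case True then show ?thesis using that by (intro sin_monotone_2pi_le) auto
    next
      case False
      then have "sin (pi/4) \<le> sin (pi - y)" using that by (intro sin_monotone_2pi_le) auto
      then show ?thesis by simp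
    qed
    ultimately show ?thesis using s by simp
  qed
  show "\<bar>cos x\<bar> \<le> sin x" using A[of x] A[of "pi - x"] h by auto
qed

lemma cos_sin_135: "cos (3 * pi / 4) = - (sqrt 2 / 2)" "sin (3 * pi / 4) = sqrt 2 / 2"
  using cos_pi_minus[of "pi / 4"] sin_pi_minus[of "pi / 4"] by (simp_all add: cos_45 sin_45)

lemma path_image_bdry_D0_plus:
  assumes "0 < r" "r \<le> R"
  shows "path_image (bdry_D0_plus r R) = frontier (D0_plus r) \<inter> cball 0 R"
proof -
  define A where "A = (\<lambda>s. of_real s * cis (3 * pi / 4)) ` {r..R}"
  define B where "B = (\<lambda>s. of_real s * cis (pi / 4)) ` {r..R}"
  define C where "C = (\<lambda>x. of_real r * cis x) ` {pi / 4..3 * pi / 4}"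
  have A: "path_image (linepath (of_real R * cis (3 * pi / 4)) (of_real r * cis (3 * pi / 4))) = A"
    unfolding A_def path_image_linepath using segment_ray[OF assms(2)] closed_segment_commute by metis
  have B: "path_image (linepath (of_real r * cis (pi / 4)) (of_real R * cis (pi / 4))) = B"
    unfolding B_def path_image_linepath using segment_ray[OF assms(2)] by metis
  have C: "path_image (part_circlepath 0 r (3 * pi / 4) (pi / 4)) = C"
    unfolding C_def path_image_part_circlepath' by (simp add: closed_segment_eq_real_ivl)
  have "path_image (bdry_D0_plus r R) = A \<union> (C \<union> B)"
    unfolding bdry_D0_plus_def A[symmetric] B[symmetric] C[symmetric]
    by (simp add: path_image_join cis_conv_exp)
  moreover have "A \<union> (C \<union> B) = frontier (D0_plus r) \<inter> cball 0 R" (is "_ = ?F")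
  proof
    have "z \<in> ?F" if "z \<in> A" for z
      using that assms by (auto simp: A_def frontier_D0_plus norm_mult cos_sin_135 abs_mult)
    moreover have "z \<in> ?F" if "z \<in> B" for z
      using that assms by (auto simp: B_def frontier_D0_plus norm_mult cos_45 sin_45 abs_mult)
    moreover have "z \<in> ?F" if zC: "z \<in> C" for z
    proof -
      obtain x where x: "z = of_real r * cis x" "pi / 4 \<le> x" "x \<le> 3 * pi / 4"
        using zC unfolding C_def by (elim imageE) (simp only: atLeastAtMost_iff)
      moreover have "- pi < x" "x \<le> pi" using x pi_gt_zero by linarith+
      ultimately have "\<bar>cos x\<bar> \<le> sin x" using sector_iff by blast
      then show ?thesis
        using x assms by (auto simp: frontier_D0_plus norm_mult abs_mult)
    qed
    ultimately show "A \<union> (C \<union> B) \<subseteq> ?F" by blast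
  next
    show "?F \<subseteq> A \<union> (C \<union> B)"
    proof
      fix z assume z: "z \<in> ?F"
      then have z': "\<bar>Re z\<bar> \<le> Im z" "norm z \<ge> r" "\<bar>Re z\<bar> = Im z \<or> norm z = r" "norm z \<le> R"
        using assms by (auto simp: frontier_D0_plus)
      show "z \<in> A \<union> (C \<union> B)"
      proof (cases "norm z = r")
        case True
        define x where "x = Arg z"
        have x: "-pi < x" "x \<le> pi" using Arg_bounded[of z] by (auto simp: x_def)
        have zx: "z = of_real r * cis x"
          using rcis_cmod_Arg[of z] True by (simp add: rcis_def x_def)
        then have "r * \<bar>cos x\<bar> \<le> r * sin x"
          using z'(1) assms by (simp add: abs_mult)
        then have "\<bar>cos x\<bar> \<le> sin x" using assms by simp
        then show ?thesis using zx sector_iff[OF x] by (auto simp: C_def)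
      next
        case False
        then have eq: "\<bar>Re z\<bar> = Im z" using z' by blast
        have "(norm z)\<^sup>2 = 2 * (Im z)\<^sup>2"
          unfolding cmod_power2 using eq by (metis mult_2 power2_abs)
        moreover have "Im z \<ge> 0" using eq by linarith
        ultimately have n: "norm z = sqrt 2 * Im z"
          by (metis norm_ge_zero real_sqrt_abs abs_of_nonneg real_sqrt_mult)
        have h: "norm z * (sqrt 2 / 2) = Im z" using n by simp
        show ?thesis
        proof (cases "Re z \<ge> 0")
          case True
          have "z = of_real (norm z) * cis (pi / 4)"
            using eq n True by (simp add: complex_eq_iff cos_45 sin_45)
          moreover have "norm z \<in> {r..R}" using z' by simp
          ultimately have "z \<in> B" unfolding B_def by (rule image_eqI)
          then show ?thesis by blast
        next
          case neg: False
          have "z = of_real (norm z) * cis (3 * pi / 4)"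
            using eq h neg by (simp add: complex_eq_iff cos_sin_135 del: times_divide_eq_right)
          moreover have "norm z \<in> {r..R}" using z' by simp
          ultimately have "z \<in> A" unfolding A_def by (rule image_eqI)
          then show ?thesis by blast
        qed
      qed
    qed
  qed
  ultimately show ?thesis by simp
qed

lemma bdry_D0_minus_eq: "bdry_D0_minus r R s = - bdry_D0_plus r R s"
proof -
  have 1: "cis (- pi / 4) = - cis (3 * pi / 4)"
    by (simp add: complex_eq_iff cos_45 sin_45 cos_sin_135)
  have 2: "cis (- 3 * pi / 4) = - cis (pi / 4)"
    by (simp add: complex_eq_iff cos_45 sin_45 cos_sin_135)
  have 3: "part_circlepath 0 r (- pi / 4) (- 3 * pi / 4) x = - part_circlepath 0 r (3 * pi / 4) (pi / 4) x" for x
  proof -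
    have "linepath (- pi / 4) (- 3 * pi / 4) x = linepath (3 * pi / 4) (pi / 4) x - pi"
      by (simp add: linepath_def field_simps)
    then show ?thesis
      by (simp add: part_circlepath_def cis_conv_exp[symmetric] mult.commute[of _ \<i>] flip: cis_mult)
         (simp add: cis_conv_exp exp_diff mult.commute right_diff_distrib)
  qed
  show ?thesis
    unfolding bdry_D0_minus_def bdry_D0_plus_def joinpaths_def 1 2 3
    by (simp add: linepath_def algebra_simps)
qed

lemma path_image_bdry_D0_minus:
  assumes "0 < r" "r \<le> R"
  shows "path_image (bdry_D0_minus r R) = frontier (D0_minus r) \<inter> cball 0 R"
proof -
  have "path_image (bdry_D0_minus r R) = uminus ` path_image (bdry_D0_plus r R)"
    by (auto simp: path_image_def bdry_D0_minus_eq)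
  also have "\<dots> = uminus ` frontier (D0_plus r) \<inter> cball 0 R"
    unfolding path_image_bdry_D0_plus[OF assms] by (auto simp: image_iff)
  finally show ?thesis by (simp add: frontier_D0_minus)
qed

end

theory Submission
  imports Defs "HOL-Probability.Characteristic_Functions"
begin

text \<open>Fix a target point \<open>x\<close> in a layer with coefficient \<open>\<sigma>\<close> and let \<open>\<phi> k\<close> be the Green function of the
  three-layer operator with spectral parameter \<open>- (\<sigma> k)\<^sup>2\<close>, normalised so that its
  derivative jumps by \<open>2 \<i> k\<close> at \<open>x\<close>; it is \<open>exp (\<i> k |y - x|)\<close> plus reflected terms that decay
  exponentially in the upper half-plane. For real \<open>k\<close> put \<open>W k s = \<integral> u(y, s) \<phi> k y dy\<close>. Green's identity shows that
  the increments of \<open>exp ((\<sigma> k)\<^sup>2 s) W k s\<close> in \<open>s\<close> are \<open>k\<close> times an even function of \<open>k\<close>. So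
  \<open>\<integral> exp (- (\<sigma> k)\<^sup>2 (t - s)) W k s dk\<close> does not depend on \<open>s\<close> in \<open>(0, t)\<close>. As \<open>s\<close> tends to \<open>t\<close>, the incident part
  becomes a Gaussian approximate identity and the reflected part vanishes (shift the contour up), which gives \<open>2 \<pi> u(x, t)\<close>;
  as \<open>s\<close> tends to 0 one gets an integral of the initial data over the real line. Finally, the real line may be deformed into
  \<open>\<partial>D\<^sub>0\<^sup>+\<close>, and \<open>\<partial>D\<^sub>0\<^sup>-\<close> is its image under \<open>k \<mapsto> - k\<close>. Targets in the
  left layer reduce to the right layer by reflection.\<close>

section \<open>Functions decaying in the upper half-plane\<close>

text \<open>The values of the solution at the interfaces and at x are unknown. The Green function
  removes them: it obeys the same transmission conditions as the solution, so the interface fluxes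
  cancel, and it is continuous at x, so that only the jump of its derivative survives there. What
  remains is 2 i k times a time integral of u(x, s) whose weight involves k only through its square;
  it is odd in k and invisible to the Gaussian. The jump 2 i k also clears the pole at k = 0 of the
  Green function with unit jump. Internal reflections form a geometric series whose ratio has
  modulus at most |\<open>\<rho>L * \<rho>R\<close>| < 1 on the closed upper half-plane, so the
  denominators have no zeros there. For s -> t put \<beta> = \<sigma>^2 (t - s). A term of rate d
  contributes at most a multiple of exp(- d / sqrt \<beta>) / sqrt \<beta>, which vanishes in the
  limit although the prefactor blows up. For s -> 0 the data are attained only in L1; this suffices
  because the Green function is bounded uniformly in y and real k.\<close>

abbreviation gauss :: "real \<Rightarrow> complex \<Rightarrow> complex" where
  "gauss \<beta> k \<equiv> exp (- of_real \<beta> * k\<^sup>2)"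

abbreviation heat_increment :: "real \<Rightarrow> real \<Rightarrow> real \<Rightarrow> (real \<Rightarrow> complex) \<Rightarrow> complex" where
  "heat_increment \<omega> s1 s2 F \<equiv> exp (of_real (\<omega> * s2)) * F s2 - exp (of_real (\<omega> * s1)) * F s1"

section \<open>Gaussian integrals over the real line\<close>

lemma gaussian_integral:
  assumes "\<beta> > 0"
  shows "has_bochner_integral lborel (\<lambda>k::real. exp (- \<beta> * k\<^sup>2)) (sqrt (pi / \<beta>))"
proof -
  define \<sigma> where "\<sigma> = 1 / sqrt (2 * \<beta>)"
  have \<sigma>: "2 * \<sigma>\<^sup>2 = 1 / \<beta>" using assms by (simp add: \<sigma>_def power_divide)
  have eq: "exp (- \<beta> * k\<^sup>2) = sqrt (pi / \<beta>) * normal_density 0 \<sigma> k" for k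
  proof -
    have "2 * pi * \<sigma>\<^sup>2 = pi / \<beta>" using \<sigma> by (simp add: field_simps)
    moreover have "- (k - 0)\<^sup>2 / (2 * \<sigma>\<^sup>2) = - \<beta> * k\<^sup>2" by (simp add: \<sigma>)
    ultimately show ?thesis using assms by (simp add: normal_density_def)
  qed
  have "\<sigma> > 0" using assms by (simp add: \<sigma>_def)
  then have "has_bochner_integral lborel (normal_density 0 \<sigma>) 1"
    by (simp add: has_bochner_integral_iff)
  then have "has_bochner_integral lborel (\<lambda>k. sqrt (pi / \<beta>) * normal_density 0 \<sigma> k) (sqrt (pi / \<beta>) * 1)"
    by (rule has_bochner_integral_mult_right)
  then show ?thesis by (simp only: eq mult_1_right)
qed

lemma gaussian_fourier_std:
  "(LINT x|lborel. iexp (z * x) * of_real (std_normal_density x)) = of_real (exp (- z\<^sup>2 / 2))"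
proof -
  have "(LINT x|lborel. std_normal_density x *\<^sub>R iexp (z * x)) = of_real (exp (- z\<^sup>2 / 2))"
    using fun_cong[OF char_std_normal_distribution, of z]
    unfolding char_def by (subst (asm) integral_density) (auto simp: normal_density_nonneg)
  then show ?thesis by (simp add: scaleR_conv_of_real mult.commute)
qed

text \<open>The substitution k = c w with c = 1 / sqrt(2 \<beta>) turns \<beta> k^2 into w^2 / 2,
  and the integral becomes the characteristic function of the standard normal distribution at c
  z.\<close>

lemma gaussian_fourier:
  assumes "\<beta> > 0"
  shows "(LINT k|lborel. gauss \<beta> (of_real k) * exp (\<i> * of_real k * of_real z))
           = of_real (sqrt (pi / \<beta>) * exp (- z\<^sup>2 / (4 * \<beta>)))" (is "?L = _")
proof -
  define c where "c = 1 / sqrt (2 * \<beta>)"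
  have c: "c > 0" "c\<^sup>2 = 1 / (2 * \<beta>)" using assms by (simp_all add: c_def power_divide)
  have "?L = \<bar>c\<bar> *\<^sub>R (LINT k|lborel. exp (- of_real \<beta> * (of_real (0 + c * k))\<^sup>2)
               * exp (\<i> * of_real (0 + c * k) * of_real z))"
    using c by (intro lborel_integral_real_affine) auto
  also have "(\<lambda>k. exp (- of_real \<beta> * (of_real (0 + c * k))\<^sup>2) * exp (\<i> * of_real (0 + c * k) * of_real z))
     = (\<lambda>k. of_real (sqrt (2 * pi)) * (iexp (z * c * k) * of_real (std_normal_density k)))"
  proof
    fix k :: real
    have "- \<beta> * (0 + c * k)\<^sup>2 = - k\<^sup>2 / 2" using c assms by (simp add: power_mult_distrib)
    then have "- of_real \<beta> * (of_real (0 + c * k))\<^sup>2 = (of_real (- k\<^sup>2 / 2) :: complex)"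
      by (metis of_real_minus of_real_mult of_real_power)
    then have "exp (- of_real \<beta> * (of_real (0 + c * k))\<^sup>2) = exp (of_real (- k\<^sup>2 / 2) :: complex)"
      by (simp only:)
    also have "\<dots> = of_real (exp (- k\<^sup>2 / 2))" by (rule exp_of_real)
    also have "exp (- k\<^sup>2 / 2) = sqrt (2 * pi) * std_normal_density k"
      by (simp add: std_normal_density_def)
    finally show "exp (- of_real \<beta> * (of_real (0 + c * k))\<^sup>2) * exp (\<i> * of_real (0 + c * k) * of_real z)
       = of_real (sqrt (2 * pi)) * (iexp (z * c * k) * of_real (std_normal_density k))"
      by (simp add: mult_ac)
  qed
  also have "(LINT k|lborel. of_real (sqrt (2 * pi)) * (iexp (z * c * k) * of_real (std_normal_density k)))
     = (of_real (sqrt (2 * pi)) * of_real (exp (- (z * c)\<^sup>2 / 2)) :: complex)"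
    by (subst integral_mult_right_zero) (simp only: gaussian_fourier_std)
  also have "\<bar>c\<bar> *\<^sub>R \<dots> = of_real (c * sqrt (2 * pi) * exp (- (z * c)\<^sup>2 / 2))"
    using c by (simp add: scaleR_conv_of_real)
  also have "c * sqrt (2 * pi) = sqrt (pi / \<beta>)"
    using assms by (simp add: c_def real_sqrt_divide real_sqrt_mult)
  also have "- (z * c)\<^sup>2 / 2 = - z\<^sup>2 / (4 * \<beta>)"
    using c assms by (simp add: power_mult_distrib)
  finally show ?thesis .
qed

lemma integrable_gaussian_mult:
  fixes g :: "real \<Rightarrow> complex"
  assumes "\<beta> > 0" "g \<in> borel_measurable borel" "\<And>k. norm (g k) \<le> C"
  shows "integrable lborel (\<lambda>k. gauss \<beta> (of_real k) * g k)"
proof (rule Bochner_Integration.integrable_bound)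
  show "integrable lborel (\<lambda>k. exp (- \<beta> * k\<^sup>2) * C)"
    using gaussian_integral[OF assms(1)] by (auto simp: has_bochner_integral_iff)
  show "AE k in lborel. norm (gauss \<beta> (of_real k) * g k) \<le> norm (exp (- \<beta> * k\<^sup>2) * C)"
  proof (intro AE_I2)
    fix k :: real
    have "norm (g k) \<le> \<bar>C\<bar>" using assms(3)[of k] by linarith
    then show "norm (gauss \<beta> (of_real k) * g k) \<le> norm (exp (- \<beta> * k\<^sup>2) * C)"
      by (simp add: norm_mult abs_mult)
  qed
qed (use assms in measurable)

section \<open>Exponential decay on the closed upper half-plane and its calculus\<close>

definition uhp_decay :: "(complex \<Rightarrow> complex) \<Rightarrow> real \<Rightarrow> real \<Rightarrow> bool" where
  "uhp_decay f C d \<longleftrightarrow> continuous_on {k. 0 \<le> Im k} f \<and> f holomorphic_on {k. 0 < Im k} \<and>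
     (\<forall>k. 0 \<le> Im k \<longrightarrow> norm (f k) \<le> C * exp (- (d * Im k)))"

lemma uhp_decay_nonneg: "uhp_decay f C d \<Longrightarrow> 0 \<le> C"
  unfolding uhp_decay_def by (force dest: spec[of _ 0] intro: order_trans[OF norm_ge_zero[of "f 0"]])

lemma uhp_decayD:
  assumes "uhp_decay f C d"
  shows "continuous_on {k. 0 \<le> Im k} f" "f holomorphic_on {k. 0 < Im k}"
    "\<And>k. 0 \<le> Im k \<Longrightarrow> norm (f k) \<le> C * exp (- (d * Im k))"
  using assms by (auto simp: uhp_decay_def)

lemma uhp_decay_weaken:
  assumes "uhp_decay f C d" "C \<le> C'" "d' \<le> d"
  shows "uhp_decay f C' d'"
proof -
  have "norm (f k) \<le> C' * exp (- (d' * Im k))" if k: "0 \<le> Im k" for k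
  proof -
    have "norm (f k) \<le> C * exp (- (d * Im k))" using assms k by (auto simp: uhp_decay_def)
    also have "\<dots> \<le> C' * exp (- (d' * Im k))"
      using assms k uhp_decay_nonneg[OF assms(1)] by (intro mult_mono) (auto simp: mult_right_mono)
    finally show ?thesis .
  qed
  then show ?thesis using assms by (auto simp: uhp_decay_def)
qed

lemma uhp_decay_mult:
  assumes "uhp_decay f C d" "uhp_decay g C' d'"
  shows "uhp_decay (\<lambda>k. f k * g k) (C * C') (d + d')"
proof -
  have "norm (f k * g k) \<le> C * C' * exp (- ((d + d') * Im k))" if k: "0 \<le> Im k" for k
  proof -
    have "norm (f k * g k) \<le> (C * exp (- (d * Im k))) * (C' * exp (- (d' * Im k)))"
      unfolding norm_mult using assms k uhp_decay_nonneg[OF assms(1)]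
      by (intro mult_mono) (auto simp: uhp_decay_def)
    then show ?thesis by (simp add: algebra_simps exp_add[symmetric])
  qed
  then show ?thesis using assms by (auto simp: uhp_decay_def intro!: continuous_intros holomorphic_intros)
qed

lemma uhp_decay_add:
  assumes "uhp_decay f C d" "uhp_decay g C' d'"
  shows "uhp_decay (\<lambda>k. f k + g k) (C + C') (min d d')"
proof -
  have 1: "uhp_decay f C (min d d')" "uhp_decay g C' (min d d')"
    using assms by (auto intro: uhp_decay_weaken)
  have "norm (f k + g k) \<le> (C + C') * exp (- (min d d' * Im k))" if k: "0 \<le> Im k" for k
    using uhp_decayD(3)[OF 1(1) k] uhp_decayD(3)[OF 1(2) k] norm_triangle_ineq[of "f k" "g k"]
    by (simp add: distrib_right)
  then show ?thesis using assms by (auto simp: uhp_decay_def intro!: continuous_intros holomorphic_intros)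
qed

lemma uhp_decay_const: "uhp_decay (\<lambda>k. c) (norm c) 0"
  by (auto simp: uhp_decay_def intro!: continuous_intros holomorphic_intros)

lemma uhp_decay_exp: "uhp_decay (\<lambda>k. exp (\<i> * k * of_real z)) 1 z"
  by (auto simp: uhp_decay_def mult.commute intro!: continuous_intros holomorphic_intros)

lemma uhp_decay_scale:
  assumes "uhp_decay f C d" "q > 0"
  shows "uhp_decay (\<lambda>k. f (k * of_real q)) C (d * q)"
proof -
  have "continuous_on {k. 0 \<le> Im k} (\<lambda>k. f (k * of_real q))"
    using assms by (intro continuous_on_compose2[OF uhp_decayD(1)[OF assms(1)]] continuous_intros) auto
  moreover have "(f \<circ> (\<lambda>k. k * of_real q)) holomorphic_on {k. 0 < Im k}"
    using assms by (intro holomorphic_on_compose_gen[OF _ uhp_decayD(2)[OF assms(1)]] holomorphic_intros) auto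
  moreover have "norm (f (k * of_real q)) \<le> C * exp (- (d * q * Im k))" if "0 \<le> Im k" for k
    using uhp_decayD(3)[OF assms(1), of "k * of_real q"] that assms(2) by (simp add: mult_ac)
  ultimately show ?thesis by (auto simp: uhp_decay_def o_def)
qed

lemma norm_exp_neg_square: "norm (gauss \<beta> k) = exp (- \<beta> * ((Re k)\<^sup>2 - (Im k)\<^sup>2))"
  by (simp add: Re_power2)

section \<open>Contour deformation for a Gaussian times a decaying function\<close>

locale uhp_gauss =
  fixes f :: "complex \<Rightarrow> complex" and C d \<beta> :: real
  assumes f: "uhp_decay f C d" and d: "d > 0" and \<beta>: "\<beta> > 0"
begin

definition "E k = gauss \<beta> k * f k"

lemma cont_E: "continuous_on {k. 0 \<le> Im k} E"
  unfolding E_def using uhp_decayD(1)[OF f] by (intro continuous_intros) auto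

text \<open>On the real axis \<open>E\<close> is known only to be continuous, but the closed
  half-plane is convex and a primitive exists up to its boundary. With it every path integral below
  is a difference of two values of \<open>F\<close>, and moving a contour becomes a comparison of
  end points.\<close>

lemma E_primitive:
  obtains F where "\<And>k. 0 \<le> Im k \<Longrightarrow> (F has_field_derivative E k) (at k within {k. 0 \<le> Im k})"
proof -
  have c: "convex {k. 0 \<le> Im k}" by (rule convex_halfspace_Im_ge)
  have int: "interior {k. 0 \<le> Im k} = {k. 0 < Im k}"
    using interior_halfspace_ge[of "\<i>" 0] by (simp add: inner_complex_def)
  have o: "open {k. 0 < Im k}" by (simp add: open_halfspace_Im_gt)
  have "E holomorphic_on {k. 0 < Im k}"
    unfolding E_def using uhp_decayD(2)[OF f] by (intro holomorphic_intros) auto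
  then have fd: "E field_differentiable at x" if "x \<in> interior {k. 0 \<le> Im k} - {}" for x
    using that o unfolding int by (auto intro: holomorphic_on_imp_differentiable_at)
  show ?thesis
    using holomorphic_convex_primitive[OF c finite.emptyI cont_E fd] that by auto
qed

lemma norm_E:
  assumes "0 \<le> Im k"
  shows "norm (E k) \<le> exp (- \<beta> * ((Re k)\<^sup>2 - (Im k)\<^sup>2)) * (C * exp (- (d * Im k)))"
  unfolding E_def norm_mult norm_exp_neg_square
  using uhp_decayD(3)[OF f assms] by (intro mult_left_mono) auto

lemma C0: "0 \<le> C" using f by (rule uhp_decay_nonneg)

text \<open>Expanding the square of x + i c splits off the real Gaussian. The rest of the
  exponential has modulus exp(\<beta> c^2), so the cofactor is bounded in x.\<close>

lemma integrable_E: "integrable lborel (\<lambda>x::real. E (of_real x + \<i> * of_real c))" if "c \<ge> 0"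
proof -
  have "continuous_on UNIV (\<lambda>x::real. f (of_real x + \<i> * of_real c))"
    using that by (intro continuous_on_compose2[OF uhp_decayD(1)[OF f]] continuous_intros) auto
  then have m: "(\<lambda>x::real. f (of_real x + \<i> * of_real c)) \<in> borel_measurable borel"
    by (rule borel_measurable_continuous_onI)
  have "integrable lborel (\<lambda>x. gauss \<beta> (of_real x) *
      (exp (- of_real \<beta> * (2 * of_real x * \<i> * of_real c - (of_real c)\<^sup>2)) * f (of_real x + \<i> * of_real c)))"
  proof (rule integrable_gaussian_mult[OF \<beta>])
    show "(\<lambda>x. exp (- of_real \<beta> * (2 * of_real x * \<i> * of_real c - (of_real c)\<^sup>2)) * f (of_real x + \<i> * of_real c))
       \<in> borel_measurable borel" using m by measurable
    fix x :: real
    have "norm (exp (- of_real \<beta> * (2 * of_real x * \<i> * of_real c - (of_real c)\<^sup>2))) = exp (\<beta> * c\<^sup>2)"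
      by (simp flip: of_real_power)
    then show "norm (exp (- of_real \<beta> * (2 * of_real x * \<i> * of_real c - (of_real c)\<^sup>2)) * f (of_real x + \<i> * of_real c))
       \<le> exp (\<beta> * c\<^sup>2) * (C * exp (- (d * c)))"
      using uhp_decayD(3)[OF f, of "of_real x + \<i> * of_real c"] that by (simp add: norm_mult)
  qed
  also have "(\<lambda>x. gauss \<beta> (of_real x) *
      (exp (- of_real \<beta> * (2 * of_real x * \<i> * of_real c - (of_real c)\<^sup>2)) * f (of_real x + \<i> * of_real c)))
     = (\<lambda>x::real. E (of_real x + \<i> * of_real c))"
  proof
    fix x :: real
    have "- of_real \<beta> * (of_real x)\<^sup>2 + - of_real \<beta> * (2 * of_real x * \<i> * of_real c - (of_real c)\<^sup>2)
      = - of_real \<beta> * (of_real x + \<i> * of_real c)\<^sup>2"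
      by (simp add: power2_sum power_mult_distrib algebra_simps)
    then show "gauss \<beta> (of_real x) *
      (exp (- of_real \<beta> * (2 * of_real x * \<i> * of_real c - (of_real c)\<^sup>2)) * f (of_real x + \<i> * of_real c))
       = E (of_real x + \<i> * of_real c)"
      unfolding E_def mult.assoc[symmetric] exp_add[symmetric] by (simp only:)
  qed
  finally show ?thesis .
qed

lemma primitive_segment_bound:
  assumes F: "\<And>k. 0 \<le> Im k \<Longrightarrow> (F has_field_derivative E k) (at k within {k. 0 \<le> Im k})"
    and "0 \<le> p" "p \<le> q"
    and B: "\<And>y. p \<le> y \<Longrightarrow> y \<le> q \<Longrightarrow> norm (E (Complex X y)) \<le> B"
  shows "norm (F (Complex X q) - F (Complex X p)) \<le> B * (q - p)"
proof -
  let ?S = "{k. Re k = X \<and> p \<le> Im k \<and> Im k \<le> q}"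
  have conv: "convex ?S"
    using convex_Int[OF convex_hyperplane[of 1 X] convex_Int[OF convex_halfspace_Im_ge[of p] convex_halfspace_Im_le[of q]]]
    by (simp add: inner_complex_def Int_def)
  have "(F has_field_derivative E k) (at k within ?S)" if "k \<in> ?S" for k
    using that assms(2) by (intro has_field_derivative_subset[OF F]) auto
  moreover have "norm (E k) \<le> B" if "k \<in> ?S" for k
    using that B[of "Im k"] by (metis (mono_tags, lifting) complex.exhaust_sel mem_Collect_eq)
  ultimately have "norm (F (Complex X q) - F (Complex X p)) \<le> B * norm (Complex X q - Complex X p)"
    using assms(3) by (intro field_differentiable_bound[OF conv]) auto
  also have "Complex X q - Complex X p = \<i> * of_real (q - p)" by (simp add: complex_eq_iff)
  finally show ?thesis using assms(3) by (simp add: norm_mult del: of_real_diff)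
qed

text \<open>At bounded height the Gaussian alone wins: its modulus on the segment is at most
  exp(\<beta> c^2 - \<beta> X^2). The sign \<open>s\<close> covers both ends of the line.\<close>

lemma primitive_vertical_tendsto:
  assumes F: "\<And>k. 0 \<le> Im k \<Longrightarrow> (F has_field_derivative E k) (at k within {k. 0 \<le> Im k})"
    and "c \<ge> 0" "\<bar>s\<bar> = 1"
  shows "((\<lambda>X. F (Complex (s * X) c) - F (Complex (s * X) 0)) \<longlongrightarrow> 0) at_top"
proof (rule Lim_null_comparison)
  have "((\<lambda>X. exp (- \<beta> * X\<^sup>2)) \<longlongrightarrow> 0) at_top"
    using \<beta> by real_asymp
  then show "((\<lambda>X. exp (\<beta> * c\<^sup>2) * exp (- \<beta> * X\<^sup>2) * C * c) \<longlongrightarrow> 0) at_top"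
    by (intro tendsto_mult_left_zero tendsto_mult_right_zero)
  have "norm (F (Complex (s * X) c) - F (Complex (s * X) 0)) \<le> exp (\<beta> * c\<^sup>2) * exp (- \<beta> * X\<^sup>2) * C * (c - 0)" for X
  proof (rule primitive_segment_bound[OF F])
    fix y :: real assume y: "0 \<le> y" "y \<le> c"
    have "(s * X)\<^sup>2 = X\<^sup>2" using assms(3) by (auto simp: power2_eq_square abs_if split: if_splits)
    then have "norm (E (Complex (s * X) y)) \<le> exp (- \<beta> * (X\<^sup>2 - y\<^sup>2)) * (C * exp (- (d * y)))"
      using norm_E[of "Complex (s * X) y"] y by simp
    also have "\<dots> \<le> exp (- \<beta> * (X\<^sup>2 - c\<^sup>2)) * (C * 1)"
      using y \<beta> d C0 by (intro mult_mono) (auto intro: power_mono)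
    also have "\<dots> = exp (\<beta> * c\<^sup>2) * exp (- \<beta> * X\<^sup>2) * C" by (simp add: algebra_simps flip: exp_add)
    finally show "norm (E (Complex (s * X) y)) \<le> exp (\<beta> * c\<^sup>2) * exp (- \<beta> * X\<^sup>2) * C" .
  qed (use assms in auto)
  then show "\<forall>\<^sub>F X in at_top. norm (F (Complex (s * X) c) - F (Complex (s * X) 0)) \<le> exp (\<beta> * c\<^sup>2) * exp (- \<beta> * X\<^sup>2) * C * c"
    by simp
qed

text \<open>On the diagonals |Re k| = Im k the Gaussian has modulus 1 and cannot control the upper
  end of the segment. Hence the split at height X / 2: below it the difference of the squares of Re
  k and Im k is at least 3/4 X^2 and the Gaussian decays; above it exp(- d Im k) does, which is
  where \<open>d > 0\<close> enters.\<close>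

lemma primitive_diagonal_tendsto:
  assumes F: "\<And>k. 0 \<le> Im k \<Longrightarrow> (F has_field_derivative E k) (at k within {k. 0 \<le> Im k})"
    and "\<bar>s\<bar> = 1"
  shows "((\<lambda>X. F (Complex (s * X) X) - F (Complex (s * X) 0)) \<longlongrightarrow> 0) at_top"
proof (rule Lim_null_comparison)
  have "((\<lambda>X. exp (- \<beta> * (3 / 4 * X\<^sup>2)) * (X / 2)) \<longlongrightarrow> 0) at_top"
    "((\<lambda>X. exp (- (d * X / 2)) * (X / 2)) \<longlongrightarrow> 0) at_top"
    using \<beta> d by real_asymp+
  from tendsto_add[OF this[THEN tendsto_mult_left_zero, of C]]
  show "((\<lambda>X. exp (- \<beta> * (3 / 4 * X\<^sup>2)) * C * (X / 2) + exp (- (d * X / 2)) * C * (X / 2)) \<longlongrightarrow> 0) at_top"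
    by (simp add: mult_ac)
  have "norm (F (Complex (s * X) X) - F (Complex (s * X) 0))
      \<le> exp (- \<beta> * (3 / 4 * X\<^sup>2)) * C * (X / 2) + exp (- (d * X / 2)) * C * (X / 2)" if X: "X \<ge> 0" for X
  proof -
    have sX: "(s * X)\<^sup>2 = X\<^sup>2" using assms(2) by (auto simp: power2_eq_square abs_if split: if_splits)
    have "norm (F (Complex (s * X) (X / 2)) - F (Complex (s * X) 0)) \<le> exp (- \<beta> * (3 / 4 * X\<^sup>2)) * C * (X / 2 - 0)"
    proof (rule primitive_segment_bound[OF F])
      fix y :: real assume y: "0 \<le> y" "y \<le> X / 2"
      have "y\<^sup>2 \<le> (X / 2)\<^sup>2" using y by (intro power_mono) auto
      then have le: "3 / 4 * X\<^sup>2 \<le> X\<^sup>2 - y\<^sup>2" by (simp add: power_divide)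
      have "norm (E (Complex (s * X) y)) \<le> exp (- \<beta> * (X\<^sup>2 - y\<^sup>2)) * (C * exp (- (d * y)))"
        using norm_E[of "Complex (s * X) y"] y sX by simp
      also have "\<dots> \<le> exp (- \<beta> * (3 / 4 * X\<^sup>2)) * (C * 1)"
        using y \<beta> d C0 le by (intro mult_mono) auto
      finally show "norm (E (Complex (s * X) y)) \<le> exp (- \<beta> * (3 / 4 * X\<^sup>2)) * C" by simp
    qed (use X in auto)
    moreover have "norm (F (Complex (s * X) X) - F (Complex (s * X) (X / 2))) \<le> exp (- (d * X / 2)) * C * (X - X / 2)"
    proof (rule primitive_segment_bound[OF F])
      fix y :: real assume y: "X / 2 \<le> y" "y \<le> X"
      have "y\<^sup>2 \<le> X\<^sup>2" using y X by (intro power_mono) auto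
      then have "norm (E (Complex (s * X) y)) \<le> exp (- \<beta> * (X\<^sup>2 - y\<^sup>2)) * (C * exp (- (d * y)))"
        using norm_E[of "Complex (s * X) y"] y sX X by simp
      also have "\<dots> \<le> 1 * (C * exp (- (d * X / 2)))"
        using y \<beta> d C0 \<open>y\<^sup>2 \<le> X\<^sup>2\<close> by (intro mult_mono) auto
      finally show "norm (E (Complex (s * X) y)) \<le> exp (- (d * X / 2)) * C" by (simp add: mult.commute)
    qed (use X in auto)
    ultimately show ?thesis
      using norm_triangle_ineq[of "F (Complex (s * X) X) - F (Complex (s * X) (X / 2))"
        "F (Complex (s * X) (X / 2)) - F (Complex (s * X) 0)"] by simp
  qed
  then show "\<forall>\<^sub>F X in at_top. norm (F (Complex (s * X) X) - F (Complex (s * X) 0))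
      \<le> exp (- \<beta> * (3 / 4 * X\<^sup>2)) * C * (X / 2) + exp (- (d * X / 2)) * C * (X / 2)"
    by (intro eventually_mono[OF eventually_ge_at_top[of "0::real"]])
qed

lemma primitive_horizontal_tendsto:
  assumes F: "\<And>k. 0 \<le> Im k \<Longrightarrow> (F has_field_derivative E k) (at k within {k. 0 \<le> Im k})"
    and c: "c \<ge> 0"
  shows "((\<lambda>X. F (Complex X c) - F (Complex (- X) c)) \<longlongrightarrow> (LINT x|lborel. E (of_real x + \<i> * of_real c))) at_top"
proof -
  let ?g = "\<lambda>x::real. E (of_real x + \<i> * of_real c)"
  have eq: "complex_of_real x + \<i> * of_real c = Complex x c" for x by (simp add: complex_eq_iff)
  have "((\<lambda>X. integral {- X..X} ?g) \<longlongrightarrow> integral\<^sup>L lborel ?g) at_top"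
  proof -
    have "((\<lambda>X. LINT x:{- X..X}|lborel. ?g x) \<longlongrightarrow> integral\<^sup>L lborel ?g) at_top"
      unfolding set_lebesgue_integral_def
    proof (rule integral_dominated_convergence_at_top)
      show "integrable lborel (\<lambda>x. norm (?g x))" using integrable_E[OF c] by simp
      show "\<forall>\<^sub>F X in at_top. AE x in lborel. norm (indicat_real {- X..X} x *\<^sub>R ?g x) \<le> norm (?g x)"
        by (intro always_eventually allI AE_I2) (auto split: split_indicator)
      show "AE x in lborel. ((\<lambda>X. indicat_real {- X..X} x *\<^sub>R ?g x) \<longlongrightarrow> ?g x) at_top"
      proof (intro AE_I2)
        fix x :: real
        have "\<forall>\<^sub>F X in at_top. indicat_real {- X..X} x *\<^sub>R ?g x = ?g x"
          using eventually_ge_at_top[of "\<bar>x\<bar>"] by eventually_elim (auto split: split_indicator)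
        then show "((\<lambda>X. indicat_real {- X..X} x *\<^sub>R ?g x) \<longlongrightarrow> ?g x) at_top"
          by (rule tendsto_eventually)
      qed
    qed (use integrable_E[OF c] in \<open>auto dest!: borel_measurable_integrable\<close>)
    moreover have "(LINT x:{- X..X}|lborel. ?g x) = integral {- X..X} ?g" for X
      using integrable_E[OF c] by (intro set_borel_integral_eq_integral(2))
        (auto simp: set_integrable_def intro: integrable_mult_indicator)
    ultimately show ?thesis by simp
  qed
  moreover
  have "integral {- X..X} ?g = F (Complex X c) - F (Complex (- X) c)" if "X \<ge> 0" for X
  proof -
    have "(?g has_integral (F (of_real X + \<i> * of_real c) - F (of_real (- X) + \<i> * of_real c))) {- X..X}"
    proof (rule fundamental_theorem_of_calculus)
      fix x :: real
      have "((\<lambda>x::real. of_real x + \<i> * of_real c) has_vector_derivative 1) (at x within {- X..X})"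
        by (auto intro!: derivative_eq_intros)
      from field_vector_diff_chain_within[OF this has_field_derivative_subset[OF F]] c
      show "((\<lambda>x. F (of_real x + \<i> * of_real c)) has_vector_derivative E (of_real x + \<i> * of_real c)) (at x within {- X..X})"
        by (auto simp: o_def image_subset_iff)
    qed (use that in simp)
    then show ?thesis unfolding eq by (rule integral_unique)
  qed
  then have "\<forall>\<^sub>F X in at_top. integral {- X..X} ?g = F (Complex X c) - F (Complex (- X) c)"
    by (intro eventually_mono[OF eventually_ge_at_top[of "0::real"]])
  ultimately show ?thesis
    by (rule Lim_transform_eventually)
qed

text \<open>The values of \<open>F\<close> at the four corners of a rectangle replace Cauchy's
  theorem; the two vertical sides vanish in the limit.\<close>

lemma integral_shift:
  assumes c: "c \<ge> 0"
  shows "(LINT x|lborel. E (of_real x)) = (LINT x|lborel. E (of_real x + \<i> * of_real c))"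
proof -
  obtain F where F: "\<And>k. 0 \<le> Im k \<Longrightarrow> (F has_field_derivative E k) (at k within {k. 0 \<le> Im k})"
    using E_primitive by blast
  have 0: "((\<lambda>X. F (Complex X 0) - F (Complex (- X) 0)) \<longlongrightarrow> (LINT x|lborel. E (of_real x))) at_top"
    using primitive_horizontal_tendsto[OF F, of 0] by simp
  have "((\<lambda>X. (F (Complex X 0) - F (Complex (- X) 0)) + (F (Complex X c) - F (Complex X 0)) - (F (Complex (- X) c) - F (Complex (- X) 0)))
     \<longlongrightarrow> (LINT x|lborel. E (of_real x)) + 0 - 0) at_top"
    using primitive_vertical_tendsto[OF F c, of 1] primitive_vertical_tendsto[OF F c, of "-1"]
    by (intro tendsto_add tendsto_diff 0) auto
  then have "((\<lambda>X. F (Complex X c) - F (Complex (- X) c)) \<longlongrightarrow> (LINT x|lborel. E (of_real x))) at_top"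
    by simp
  from tendsto_unique[OF _ this primitive_horizontal_tendsto[OF F c]] show ?thesis by simp
qed

text \<open>Shift the contour up to height \<open>1 / sqrt \<beta>\<close>, where the Gaussian has grown only by the factor \<open>exp 1\<close>.\<close>

lemma norm_integral_le:
  "norm (LINT x|lborel. E (of_real x)) \<le> C * (exp (1 - d / sqrt \<beta>) * sqrt (pi / \<beta>))"
proof -
  define c where "c = 1 / sqrt \<beta>"
  have c: "c \<ge> 0" "\<beta> * c\<^sup>2 = 1" using \<beta> by (auto simp: c_def power_divide)
  note g = gaussian_integral[OF \<beta>, unfolded has_bochner_integral_iff]
  have "norm (LINT x|lborel. E (of_real x + \<i> * of_real c))
     \<le> (LINT x|lborel. exp (- \<beta> * x\<^sup>2) * (C * exp (1 - d / sqrt \<beta>)))"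
  proof (rule Bochner_Integration.integral_norm_bound_integral)
    fix x :: real
    have "norm (E (of_real x + \<i> * of_real c)) \<le> exp (- \<beta> * (x\<^sup>2 - c\<^sup>2)) * (C * exp (- (d * c)))"
      using norm_E[of "of_real x + \<i> * of_real c"] c by simp
    also have "- \<beta> * (x\<^sup>2 - c\<^sup>2) = - \<beta> * x\<^sup>2 + 1" using c by (simp add: algebra_simps)
    also have "exp (- \<beta> * x\<^sup>2 + 1) * (C * exp (- (d * c))) = exp (- \<beta> * x\<^sup>2) * (C * exp (1 - d / sqrt \<beta>))"
      by (simp add: c_def exp_add exp_diff exp_minus field_simps)
    finally show "norm (E (of_real x + \<i> * of_real c)) \<le> exp (- \<beta> * x\<^sup>2) * (C * exp (1 - d / sqrt \<beta>))" .
  qed (use integrable_E[OF c(1)] g in auto)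
  then show ?thesis using g integral_shift[OF c(1)] by (simp add: mult_ac)
qed

text \<open>The truncated contour runs from - X + i X to X + i X with X = R sqrt 2 / 2, and its
  integral is the difference of \<open>F\<close> at these points. Descending from them vertically to
  the real axis changes \<open>F\<close> by a null sequence, which leaves the integral over the real
  line.\<close>

lemma has_improper_contour_integral_E:
  assumes r: "r > 0"
  shows "has_improper_contour_integral E (LINT x|lborel. E (of_real x)) (bdry_D0_plus r)"
proof -
  obtain F where F: "\<And>k. 0 \<le> Im k \<Longrightarrow> (F has_field_derivative E k) (at k within {k. 0 \<le> Im k})"
    using E_primitive by blast
  have ci: "(E has_contour_integral (F (Complex (R * (sqrt 2 / 2)) (R * (sqrt 2 / 2))) - F (Complex (- (R * (sqrt 2 / 2))) (R * (sqrt 2 / 2))))) (bdry_D0_plus r R)"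
    if R: "R \<ge> r" for R
  proof -
    have "valid_path (bdry_D0_plus r R)"
      unfolding bdry_D0_plus_def by (intro valid_path_join valid_path_linepath valid_path_part_circlepath)
        (auto simp: cis_conv_exp)
    moreover have "path_image (bdry_D0_plus r R) \<subseteq> {k. 0 \<le> Im k}"
      using path_image_bdry_D0_plus[OF r R] frontier_D0_plus[OF r] by auto
    ultimately have "(E has_contour_integral (F (pathfinish (bdry_D0_plus r R)) - F (pathstart (bdry_D0_plus r R)))) (bdry_D0_plus r R)"
      using F by (intro contour_integral_primitive[of "{k. 0 \<le> Im k}"]) auto
    moreover have "pathfinish (bdry_D0_plus r R) = Complex (R * (sqrt 2 / 2)) (R * (sqrt 2 / 2))"
      "pathstart (bdry_D0_plus r R) = Complex (- (R * (sqrt 2 / 2))) (R * (sqrt 2 / 2))"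
      by (auto simp: bdry_D0_plus_def complex_eq_iff cos_45 sin_45 cos_sin_135)
    ultimately show ?thesis by simp
  qed
  have 0: "((\<lambda>X. F (Complex X 0) - F (Complex (- X) 0)) \<longlongrightarrow> (LINT x|lborel. E (of_real x))) at_top"
    using primitive_horizontal_tendsto[OF F, of 0] by simp
  have "((\<lambda>X. (F (Complex X 0) - F (Complex (- X) 0)) + (F (Complex X X) - F (Complex X 0)) - (F (Complex (- X) X) - F (Complex (- X) 0)))
     \<longlongrightarrow> (LINT x|lborel. E (of_real x)) + 0 - 0) at_top"
    using primitive_diagonal_tendsto[OF F, of 1] primitive_diagonal_tendsto[OF F, of "-1"]
    by (intro tendsto_add tendsto_diff 0) auto
  then have "((\<lambda>X. F (Complex X X) - F (Complex (- X) X)) \<longlongrightarrow> (LINT x|lborel. E (of_real x))) at_top"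
    by simp
  moreover have "filterlim (\<lambda>R. R * (sqrt 2 / 2)) at_top at_top" by real_asymp
  ultimately have "((\<lambda>R. F (Complex (R * (sqrt 2 / 2)) (R * (sqrt 2 / 2))) - F (Complex (- (R * (sqrt 2 / 2))) (R * (sqrt 2 / 2))))
     \<longlongrightarrow> (LINT x|lborel. E (of_real x))) at_top"
    by (rule filterlim_compose)
  then have "((\<lambda>R. contour_integral (bdry_D0_plus r R) E) \<longlongrightarrow> (LINT x|lborel. E (of_real x))) at_top"
    by (rule Lim_transform_eventually)
      (use eventually_ge_at_top[of r] in \<open>eventually_elim, auto simp: contour_integral_unique[OF ci]\<close>)
  moreover have "\<forall>\<^sub>F R in at_top. E contour_integrable_on bdry_D0_plus r R"
    using eventually_ge_at_top[of r] by eventually_elim (use ci in \<open>auto simp: contour_integrable_on_def\<close>)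
  ultimately show ?thesis unfolding has_improper_contour_integral_def by blast
qed

end

lemma norm_gaussian_uhp_le:
  assumes "uhp_decay f C d" "d > 0" "\<beta> > 0"
  shows "norm (LINT x|lborel. gauss \<beta> (of_real x) * f (of_real x))
     \<le> C * (exp (1 - d / sqrt \<beta>) * sqrt (pi / \<beta>))"
proof -
  interpret uhp_gauss f C d \<beta> using assms by unfold_locales
  show ?thesis using norm_integral_le by (simp only: E_def)
qed

lemma has_improper_contour_integral_D0_plus:
  assumes "uhp_decay f C d" "d > 0" "\<beta> > 0" "r > 0"
  shows "has_improper_contour_integral (\<lambda>k. gauss \<beta> k * f k)
     (LINT x|lborel. gauss \<beta> (of_real x) * f (of_real x)) (bdry_D0_plus r)"
proof -
  interpret uhp_gauss f C d \<beta> using assms by unfold_locales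
  show ?thesis using has_improper_contour_integral_E[OF assms(4)] unfolding E_def .
qed

text \<open>The two contours correspond pointwise under k -> - k, direction of travel included, so
  the minus sign is that of dk.\<close>

lemma has_improper_contour_integral_D0_minus:
  assumes "has_improper_contour_integral (\<lambda>k. f (- k)) I (bdry_D0_plus r)" and r: "r > 0"
  shows "has_improper_contour_integral f (- I) (bdry_D0_minus r)"
proof -
  have *: "(f has_contour_integral (- J)) (bdry_D0_minus r R)"
    if J: "((\<lambda>k. f (- k)) has_contour_integral J) (bdry_D0_plus r R)" for R J
  proof -
    have v: "valid_path (bdry_D0_plus r R)"
      unfolding bdry_D0_plus_def by (intro valid_path_join valid_path_linepath valid_path_part_circlepath)
        (auto simp: cis_conv_exp)
    have "bdry_D0_minus r R = uminus \<circ> bdry_D0_plus r R"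
      by (simp add: fun_eq_iff bdry_D0_minus_eq)
    moreover have "(f has_contour_integral (- J)) (uminus \<circ> bdry_D0_plus r R)"
      using has_contour_integral_negatepath[OF v, of f "- J"] J by simp
    ultimately show ?thesis by simp
  qed
  have int: "\<forall>\<^sub>F R in at_top. (\<lambda>k. f (- k)) contour_integrable_on bdry_D0_plus r R"
    and lim: "((\<lambda>R. contour_integral (bdry_D0_plus r R) (\<lambda>k. f (- k))) \<longlongrightarrow> I) at_top"
    using assms(1) by (auto simp: has_improper_contour_integral_def)
  have "\<forall>\<^sub>F R in at_top. f contour_integrable_on bdry_D0_minus r R \<and>
      - contour_integral (bdry_D0_plus r R) (\<lambda>k. f (- k)) = contour_integral (bdry_D0_minus r R) f"
    using int
  proof eventually_elim
    case (elim R)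
    from *[OF has_contour_integral_integral[OF elim]] show ?case
      by (auto simp: contour_integrable_on_def dest: contour_integral_unique)
  qed
  then show ?thesis
    unfolding has_improper_contour_integral_def
    by (auto intro: Lim_transform_eventually[OF tendsto_minus[OF lim]] elim: eventually_mono)
qed

section \<open>The half-line transform of integrable data\<close>

lemma norm_mult_exp_neg_le:
  fixes x \<delta> :: real
  assumes "x < 0" "\<delta> > 0"
  shows "\<bar>x\<bar> * exp (x * \<delta>) \<le> 1 / \<delta>"
proof -
  have "- (x * \<delta>) \<le> exp (- (x * \<delta>))" using exp_ge_add_one_self[of "- (x * \<delta>)"] by linarith
  then have "- (x * \<delta>) * exp (x * \<delta>) \<le> 1"
    by (simp add: exp_minus field_simps)
  then show ?thesis using assms by (simp add: field_simps)
qed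

text \<open>The support x < - a gives the rate \<open>a\<close>. For real k mere integrability of
  the data yields continuity; for Im k > 0 the factor |x| produced by differentiating in k is
  absorbed by exp(x Im k).\<close>

lemma half_line_ft_uhp_decay:
  assumes "a > 0" and u0: "u0 absolutely_integrable_on {..<-a}"
  shows "uhp_decay (half_line_ft a u0) (LINT x:{..<-a}|lebesgue. norm (u0 x)) a"
proof -
  define g where "g x = indicat_real {..<-a} x *\<^sub>R u0 x" for x
  have g: "integrable lebesgue g" "integrable lebesgue (\<lambda>x. norm (g x))"
    using u0 by (auto simp: g_def[abs_def] set_integrable_def dest: integrable_norm)
  have [measurable]: "g \<in> borel_measurable lebesgue" using g(1) by auto
  have [measurable]: "(\<lambda>x. complex_of_real x) \<in> borel_measurable lebesgue"
    by (rule measurable_completion) simp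
  have m[measurable]: "(\<lambda>x. exp (- \<i> * k * of_real x)) \<in> borel_measurable lebesgue" for k
    by (rule measurable_completion) simp
  have mg: "(\<lambda>x. exp (- \<i> * k * of_real x) * g x) \<in> borel_measurable lebesgue" for k
    by measurable
  have F: "half_line_ft a u0 k = (LINT x|lebesgue. exp (- \<i> * k * of_real x) * g x)" for k
    unfolding half_line_ft_def set_lebesgue_integral_def g_def by (simp add: scaleR_conv_of_real mult_ac)
  have le: "norm (exp (- \<i> * k * of_real x) * g x) \<le> exp (- (a * Im k)) * norm (g x)" if "0 \<le> Im k" for k x
  proof (cases "x < - a")
    case True
    have "x * Im k \<le> - a * Im k" using True that by (intro mult_right_mono) auto
    then show ?thesis by (auto simp: norm_mult mult.commute intro!: mult_left_mono)
  qed (simp add: g_def)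
  have le1: "norm (exp (- \<i> * k * of_real x) * g x) \<le> norm (g x)" if "0 \<le> Im k" for k x
  proof -
    have "exp (- (a * Im k)) \<le> 1" using that assms(1) by simp
    then show ?thesis using le[OF that, of x] mult_right_mono[of "exp (- (a * Im k))" 1 "norm (g x)"] by simp
  qed
  have int: "integrable lebesgue (\<lambda>x. exp (- \<i> * k * of_real x) * g x)" if "0 \<le> Im k" for k
    by (rule Bochner_Integration.integrable_bound[OF g(2) mg]) (use le1[OF that] in auto)
  have "continuous_on {k. 0 \<le> Im k} (half_line_ft a u0)"
    unfolding continuous_on_sequentially
  proof (intro ballI allI impI)
    fix X k assume k: "k \<in> {k. 0 \<le> Im k}" and X: "(\<forall>n. X n \<in> {k. 0 \<le> Im k}) \<and> X \<longlonglongrightarrow> k"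
    show "(half_line_ft a u0 \<circ> X) \<longlonglongrightarrow> half_line_ft a u0 k"
      unfolding F o_def
    proof (rule integral_dominated_convergence[where w = "\<lambda>x. norm (g x)"])
      show "AE x in lebesgue. (\<lambda>n. exp (- \<i> * X n * of_real x) * g x) \<longlonglongrightarrow> exp (- \<i> * k * of_real x) * g x"
        using X by (intro AE_I2 tendsto_intros) auto
      show "AE x in lebesgue. norm (exp (- \<i> * X n * of_real x) * g x) \<le> norm (g x)" for n
        using X le1 by auto
    qed (use g in measurable)
  qed
  moreover have "half_line_ft a u0 field_differentiable at k" if k: "Im k > 0" for k
  proof -
    \<comment> \<open>Half of \<open>Im k\<close> keeps \<open>S\<close> off the real axis, so the
      k-derivative of the kernel is bounded by \<open>1 / \<delta>\<close> on all of
      \<open>S\<close>, uniformly in negative x.\<close>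
    define \<delta> where "\<delta> = Im k / 2"
    define S where "S = {z. Im z > \<delta>}"
    have \<delta>: "\<delta> > 0" and S: "open S" "convex S" "k \<in> S"
      using k unfolding S_def by (simp_all only: open_halfspace_Im_gt convex_halfspace_Im_gt) (simp_all add: \<delta>_def)
    have lip: "norm (exp (- \<i> * z * of_real x) - exp (- \<i> * k * of_real x)) \<le> 1 / \<delta> * norm (z - k)"
      if "z \<in> S" "x < 0" for z x
    proof (rule field_differentiable_bound[OF S(2)])
      fix w assume w: "w \<in> S"
      show "((\<lambda>w. exp (- \<i> * w * of_real x)) has_field_derivative (- \<i> * of_real x * exp (- \<i> * w * of_real x))) (at w within S)"
        by (auto intro!: derivative_eq_intros)
      have "norm (- \<i> * of_real x * exp (- \<i> * w * of_real x)) = \<bar>x\<bar> * exp (x * Im w)"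
        by (simp add: norm_mult mult.commute)
      also have "\<dots> \<le> \<bar>x\<bar> * exp (x * \<delta>)"
        using w that by (intro mult_left_mono) (auto simp: S_def intro!: mult_left_mono_neg)
      also have "\<dots> \<le> 1 / \<delta>" using that \<delta> by (intro norm_mult_exp_neg_le)
      finally show "norm (- \<i> * of_real x * exp (- \<i> * w * of_real x)) \<le> 1 / \<delta>" .
    qed (use that S in auto)
    have "(half_line_ft a u0 has_field_derivative (LINT x|lebesgue. - \<i> * of_real x * exp (- \<i> * k * of_real x) * g x)) (at k within S)"
      unfolding has_field_derivative_iff tendsto_at_iff_sequentially
    proof (intro allI impI)
      fix X assume X: "\<forall>i. X i \<in> S - {k}" "X \<longlonglongrightarrow> k"
      have "(\<lambda>n. LINT x|lebesgue. (exp (- \<i> * X n * of_real x) - exp (- \<i> * k * of_real x)) / (X n - k) * g x)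
         \<longlonglongrightarrow> (LINT x|lebesgue. - \<i> * of_real x * exp (- \<i> * k * of_real x) * g x)"
      \<comment> \<open>The Lipschitz estimate \<open>lip\<close> dominates the difference
        quotients.\<close>
      proof (rule integral_dominated_convergence[where w = "\<lambda>x. 1 / \<delta> * norm (g x)"])
        show "AE x in lebesgue. (\<lambda>n. (exp (- \<i> * X n * of_real x) - exp (- \<i> * k * of_real x)) / (X n - k) * g x)
            \<longlonglongrightarrow> - \<i> * of_real x * exp (- \<i> * k * of_real x) * g x"
        proof (intro AE_I2 tendsto_mult tendsto_const)
          fix x :: real
          have "((\<lambda>w. exp (- \<i> * w * of_real x)) has_field_derivative (- \<i> * of_real x * exp (- \<i> * k * of_real x))) (at k within S)"
            by (auto intro!: derivative_eq_intros)
          then show "(\<lambda>n. (exp (- \<i> * X n * of_real x) - exp (- \<i> * k * of_real x)) / (X n - k))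
              \<longlonglongrightarrow> - \<i> * of_real x * exp (- \<i> * k * of_real x)"
            using X unfolding has_field_derivative_iff tendsto_at_iff_sequentially by (auto simp: o_def)
        qed
        show "AE x in lebesgue. norm ((exp (- \<i> * X n * of_real x) - exp (- \<i> * k * of_real x)) / (X n - k) * g x)
            \<le> 1 / \<delta> * norm (g x)" for n
        proof (intro AE_I2)
          fix x :: real
          show "norm ((exp (- \<i> * X n * of_real x) - exp (- \<i> * k * of_real x)) / (X n - k) * g x) \<le> 1 / \<delta> * norm (g x)"
          proof (cases "x < - a")
            case True
            then have "norm (exp (- \<i> * X n * of_real x) - exp (- \<i> * k * of_real x)) \<le> 1 / \<delta> * norm (X n - k)"
              using X assms(1) by (intro lip) auto
            moreover have "norm (X n - k) > 0" using X by auto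
            ultimately have "norm (exp (- \<i> * X n * of_real x) - exp (- \<i> * k * of_real x)) / norm (X n - k) \<le> 1 / \<delta>"
              by (simp only: pos_divide_le_eq)
            then show ?thesis unfolding norm_mult norm_divide by (rule mult_right_mono) simp
          qed (simp add: g_def)
        qed
        show "integrable lebesgue (\<lambda>x. 1 / \<delta> * norm (g x))" using g(2) by (rule integrable_mult_right)
        show "(\<lambda>x. - \<i> * of_real x * exp (- \<i> * k * of_real x) * g x) \<in> borel_measurable lebesgue"
          by measurable
        show "(\<lambda>x. (exp (- \<i> * X n * of_real x) - exp (- \<i> * k * of_real x)) / (X n - k) * g x)
          \<in> borel_measurable lebesgue" for n
          by measurable
      qed
      moreover have "(LINT x|lebesgue. (exp (- \<i> * X n * of_real x) - exp (- \<i> * k * of_real x)) / (X n - k) * g x)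
         = (half_line_ft a u0 (X n) - half_line_ft a u0 k) / (X n - k)" for n
      proof -
        have "Im (X n) > 0" using X \<delta> by (auto simp: S_def dest!: spec[of _ n])
        then have "half_line_ft a u0 (X n) - half_line_ft a u0 k
           = (LINT x|lebesgue. exp (- \<i> * X n * of_real x) * g x - exp (- \<i> * k * of_real x) * g x)"
          unfolding F using int k by (intro Bochner_Integration.integral_diff[symmetric]) auto
        then have "(half_line_ft a u0 (X n) - half_line_ft a u0 k) / (X n - k)
           = (LINT x|lebesgue. (exp (- \<i> * X n * of_real x) * g x - exp (- \<i> * k * of_real x) * g x) / (X n - k))"
          by (simp only: integral_divide_zero)
        then show ?thesis by (simp only: left_diff_distrib times_divide_eq_left)
      qed
      ultimately show "((\<lambda>y. (half_line_ft a u0 y - half_line_ft a u0 k) / (y - k)) \<circ> X)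
         \<longlonglongrightarrow> (LINT x|lebesgue. - \<i> * of_real x * exp (- \<i> * k * of_real x) * g x)"
        by (simp only: o_def)
    qed
    then show ?thesis
      unfolding at_within_open[OF S(3,1)] field_differentiable_def by (rule exI)
  qed
  then have "half_line_ft a u0 holomorphic_on {k. 0 < Im k}"
    by (auto simp: holomorphic_on_def intro: field_differentiable_at_within)
  moreover have "norm (half_line_ft a u0 k) \<le> (LINT x:{..<-a}|lebesgue. norm (u0 x)) * exp (- (a * Im k))"
    if k: "0 \<le> Im k" for k
  proof -
    have "norm (half_line_ft a u0 k) \<le> (LINT x|lebesgue. exp (- (a * Im k)) * norm (g x))"
      unfolding F by (rule Bochner_Integration.integral_norm_bound_integral) (use int[OF k] g le[OF k] in auto)
    also have "\<dots> = exp (- (a * Im k)) * (LINT x:{..<-a}|lebesgue. norm (u0 x))"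
      by (simp add: g_def set_lebesgue_integral_def)
    finally show ?thesis by (simp add: mult.commute)
  qed
  ultimately show ?thesis by (auto simp: uhp_decay_def)
qed

section \<open>Inversion from a Green function\<close>

text \<open>The substitution k -> - k preserves the integral for every \<open>g\<close>; a
  nonintegrable function has integral 0 by convention.\<close>

lemma integral_odd_eq_0:
  fixes g :: "real \<Rightarrow> complex"
  assumes "\<And>k. g (- k) = - g k"
  shows "integral\<^sup>L lborel g = 0"
proof -
  have "integral\<^sup>L lborel g = (LINT k|lborel. g (- k))"
    using lborel_integral_real_affine[of "-1" g 0] by simp
  also have "\<dots> = - integral\<^sup>L lborel g" by (simp add: assms)
  finally show ?thesis by (simp add: equation_minus_iff)
qed

text \<open>\<open>\<phi> k\<close> stands for the Green function with pole at \<open>x\<close>; the last assumption says that its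
  reflected part has travelled at least the distance \<open>d\<close>.\<close>

locale heat_inversion =
  fixes U :: "real \<Rightarrow> real \<Rightarrow> complex" and \<phi> :: "complex \<Rightarrow> real \<Rightarrow> complex"
    and x t \<sigma> C d :: real
  assumes \<sigma>: "\<sigma> > 0" and t: "t > 0" and d: "d > 0"
    and U_int: "\<And>s. s \<ge> 0 \<Longrightarrow> integrable lebesgue (\<lambda>y. U y s)"
    and U_borel: "\<And>s. s > 0 \<Longrightarrow> (\<lambda>y. U y s) \<in> borel_measurable borel"
    and U_L1: "\<And>s0. s0 \<ge> 0 \<Longrightarrow> ((\<lambda>s. LINT y|lebesgue. norm (U y s - U y s0)) \<longlongrightarrow> 0) (at s0 within {0..})"
    and U_cont: "isCont (\<lambda>(y, s). U y s) (x, t)"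
    and \<phi>_meas: "(\<lambda>(k, y). \<phi> (of_real k) y) \<in> borel_measurable (borel \<Otimes>\<^sub>M borel)"
    and \<phi>_decay: "\<And>y. uhp_decay (\<lambda>k. \<phi> k y - exp (\<i> * k * of_real \<bar>y - x\<bar>)) C d"
begin

section \<open>The spectral transform and its Gaussian average\<close>

definition W :: "real \<Rightarrow> real \<Rightarrow> complex" where
  "W k s = (LINT y|lebesgue. U y s * \<phi> (of_real k) y)"

definition A :: "real \<Rightarrow> complex" where
  "A s = (LINT k|lborel. gauss (\<sigma>\<^sup>2 * (t - s)) (of_real k) * W k s)"

lemma C0: "0 \<le> C" using uhp_decay_nonneg \<phi>_decay by blast

lemma \<phi>_bound: "norm (\<phi> (of_real k) y) \<le> C + 1" for k :: real
proof -
  have "norm (\<phi> (of_real k) y - exp (\<i> * of_real k * of_real \<bar>y - x\<bar>)) \<le> C"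
    using uhp_decayD(3)[OF \<phi>_decay[of y], of "of_real k"] by simp
  moreover have "norm (exp (\<i> * of_real k * of_real \<bar>y - x\<bar>)) = 1" by simp
  ultimately show ?thesis
    using norm_triangle_ineq2[of "\<phi> (of_real k) y" "exp (\<i> * of_real k * of_real \<bar>y - x\<bar>)"] by linarith
qed

lemma \<phi>_meas_y: "(\<lambda>y. \<phi> (of_real k) y) \<in> borel_measurable borel" for k :: real
proof -
  have "(\<lambda>y. (k, y)) \<in> borel \<rightarrow>\<^sub>M borel \<Otimes>\<^sub>M borel" by measurable
  from measurable_compose[OF this \<phi>_meas] show ?thesis by simp
qed

lemma \<phi>_meas_y': "(\<lambda>y. \<phi> (of_real k) y) \<in> borel_measurable lebesgue" for k :: real
  using \<phi>_meas_y by (intro measurable_completion) simp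

lemma integrable_W: "integrable lebesgue (\<lambda>y. U y s * \<phi> (of_real k) y)" if "s \<ge> 0" for k :: real
proof (rule Bochner_Integration.integrable_bound)
  show "integrable lebesgue (\<lambda>y. norm (U y s) * (C + 1))" using U_int[OF that] by simp
  show "(\<lambda>y. U y s * \<phi> (of_real k) y) \<in> borel_measurable lebesgue"
    using \<phi>_meas_y' borel_measurable_integrable[OF U_int[OF that]] by measurable
  show "AE y in lebesgue. norm (U y s * \<phi> (of_real k) y) \<le> norm (norm (U y s) * (C + 1))"
    using \<phi>_bound C0 by (auto simp: norm_mult abs_mult intro!: mult_left_mono)
qed

lemma W_bound: "norm (W k s) \<le> (LINT y|lebesgue. norm (U y s)) * (C + 1)" if "s \<ge> 0"
proof -
  have "norm (W k s) \<le> (LINT y|lebesgue. norm (U y s) * (C + 1))"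
    unfolding W_def using integrable_W[OF that] U_int[OF that] \<phi>_bound
    by (intro Bochner_Integration.integral_norm_bound_integral) (auto simp: norm_mult intro!: mult_left_mono)
  then show ?thesis by simp
qed

text \<open>The bound is uniform in \<open>k\<close>; through it continuity in time with values in
  L1 carries over to \<open>W k\<close>.\<close>

lemma W_diff: "norm (W k s - W k s0) \<le> (LINT y|lebesgue. norm (U y s - U y s0)) * (C + 1)"
  if "s \<ge> 0" "s0 \<ge> 0"
proof -
  have "W k s - W k s0 = (LINT y|lebesgue. (U y s - U y s0) * \<phi> (of_real k) y)"
    unfolding W_def left_diff_distrib using integrable_W that by (intro Bochner_Integration.integral_diff[symmetric]) auto
  also have "norm \<dots> \<le> (LINT y|lebesgue. norm (U y s - U y s0) * (C + 1))"
    using integrable_W[OF that(1), of k] integrable_W[OF that(2), of k] U_int[OF that(1)] U_int[OF that(2)] \<phi>_bound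
    by (intro Bochner_Integration.integral_norm_bound_integral)
       (auto simp: norm_mult intro!: mult_left_mono, simp add: left_diff_distrib)
  finally show ?thesis by simp
qed

text \<open>At positive times the integrand is Borel measurable. This moves the integral to
  \<open>lborel\<close>, where Fubini and measurability in the parameter \<open>k\<close> are
  available.\<close>

lemma W_lborel: "W k s = (LINT y|lborel. U y s * \<phi> (of_real k) y)" if "s > 0"
proof -
  have "(\<lambda>y. U y s * \<phi> (of_real k) y) \<in> borel_measurable lborel"
    using U_borel[OF that] \<phi>_meas_y by simp
  then show ?thesis unfolding W_def by (rule integral_completion)
qed

lemma U_int_lborel: "integrable lborel (\<lambda>y. U y s)" if "s > 0"
  using U_int[of s] U_borel[OF that] that by (simp add: integrable_completion)

lemma norm_U_lborel: "(LINT y|lborel. norm (U y s)) = (LINT y|lebesgue. norm (U y s))" if "s > 0"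
  using U_borel[OF that] by (intro integral_completion[symmetric]) simp

lemma W_meas: "(\<lambda>k. W k s) \<in> borel_measurable borel" if "s > 0"
proof -
  have [measurable]: "(\<lambda>y. U y s) \<in> borel_measurable borel" by (rule U_borel[OF that])
  have [measurable]: "(\<lambda>p. \<phi> (of_real (fst p)) (snd p)) \<in> borel_measurable (borel \<Otimes>\<^sub>M borel)"
    using \<phi>_meas by (simp add: case_prod_beta')
  have "(\<lambda>k. LINT y|lborel. U y s * \<phi> (of_real k) y) \<in> borel_measurable borel"
    by measurable
  then show ?thesis using W_lborel[OF that] by simp
qed

lemma A_int: "integrable lborel (\<lambda>k. gauss (\<sigma>\<^sup>2 * (t - s)) (of_real k) * W k s)" if "0 < s" "s < t"
  using that \<sigma> W_meas
  by (intro integrable_gaussian_mult[where C = "(LINT y|lebesgue. norm (U y s)) * (C + 1)"] W_bound) auto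

text \<open>Factoring exp(- \<sigma>^2 t k^2) out of both Gaussians leaves exactly the increment of
  \<open>odd\<close>, so the difference of the two values of \<open>A\<close> is the integral of an
  odd function.\<close>

lemma A_const:
  assumes odd: "\<And>k s1 s2. 0 < s1 \<Longrightarrow> s1 < s2 \<Longrightarrow> heat_increment (\<sigma>\<^sup>2 * k\<^sup>2) s1 s2 (W (- k))
        = - (heat_increment (\<sigma>\<^sup>2 * k\<^sup>2) s1 s2 (W k))"
    and s: "0 < s1" "s1 < s2" "s2 < t"
  shows "A s1 = A s2"
proof -
  have e: "gauss (\<sigma>\<^sup>2 * (t - s)) (of_real k) = gauss (\<sigma>\<^sup>2 * t) (of_real k) * exp (of_real (\<sigma>\<^sup>2 * k\<^sup>2 * s) :: complex)" for k s
    by (simp add: algebra_simps flip: exp_add)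
  have "A s2 - A s1 = (LINT k|lborel. gauss (\<sigma>\<^sup>2 * (t - s2)) (of_real k) * W k s2 - gauss (\<sigma>\<^sup>2 * (t - s1)) (of_real k) * W k s1)"
    unfolding A_def using A_int s by (intro Bochner_Integration.integral_diff[symmetric]) auto
  also have "\<dots> = (LINT k|lborel. gauss (\<sigma>\<^sup>2 * t) (of_real k) *
      (heat_increment (\<sigma>\<^sup>2 * k\<^sup>2) s1 s2 (W k)))"
    unfolding e by (simp only: right_diff_distrib mult.assoc)
  also have "\<dots> = 0"
  proof (rule integral_odd_eq_0)
    fix k :: real
    show "gauss (\<sigma>\<^sup>2 * t) (of_real (- k)) *
      (heat_increment (\<sigma>\<^sup>2 * (- k)\<^sup>2) s1 s2 (W (- k)))
     = - (gauss (\<sigma>\<^sup>2 * t) (of_real k) *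
      (heat_increment (\<sigma>\<^sup>2 * k\<^sup>2) s1 s2 (W k)))"
      using odd[OF s(1,2), of k] by (simp only: power2_minus of_real_minus mult_minus_right)
  qed
  finally show ?thesis by simp
qed

lemma norm_U_tendsto:
  assumes "s0 \<ge> 0" "X \<longlonglongrightarrow> s0" "\<And>n. X n \<ge> 0" "\<And>n. X n \<noteq> s0"
  shows "(\<lambda>n. LINT y|lebesgue. norm (U y (X n) - U y s0)) \<longlonglongrightarrow> 0"
    "\<exists>B. \<forall>n. (LINT y|lebesgue. norm (U y (X n))) \<le> B"
proof -
  show 1: "(\<lambda>n. LINT y|lebesgue. norm (U y (X n) - U y s0)) \<longlonglongrightarrow> 0"
    using U_L1[OF assms(1)] assms unfolding tendsto_at_iff_sequentially by (auto simp: o_def)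
  obtain B where B: "\<And>n. norm (LINT y|lebesgue. norm (U y (X n) - U y s0)) \<le> B"
    using convergent_imp_Bseq[OF convergentI[OF 1]] unfolding Bseq_def by blast
  have "(LINT y|lebesgue. norm (U y (X n))) \<le> B + (LINT y|lebesgue. norm (U y s0))" for n
  proof -
    have "(LINT y|lebesgue. norm (U y (X n))) \<le> (LINT y|lebesgue. norm (U y (X n) - U y s0) + norm (U y s0))"
      using U_int[OF assms(3)[of n]] U_int[OF assms(1)]
      by (intro integral_mono) (auto simp: norm_triangle_sub add.commute)
    also have "\<dots> = (LINT y|lebesgue. norm (U y (X n) - U y s0)) + (LINT y|lebesgue. norm (U y s0))"
      using U_int[OF assms(3)[of n]] U_int[OF assms(1)] by (intro Bochner_Integration.integral_add) auto
    finally show ?thesis using B[of n] by simp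
  qed
  then show "\<exists>B. \<forall>n. (LINT y|lebesgue. norm (U y (X n))) \<le> B" by blast
qed

lemma A_tendsto_0:
  defines "X \<equiv> \<lambda>n. t / 2 / real (Suc n)"
  shows "(\<lambda>n. A (X n)) \<longlonglongrightarrow> (LINT k|lborel. gauss (\<sigma>\<^sup>2 * t) (of_real k) * W k 0)"
proof -
  have X: "X \<longlonglongrightarrow> 0" "\<And>n. X n > 0" "\<And>n. X n \<le> t / 2"
    using t tendsto_mult_right_zero[OF LIMSEQ_inverse_real_of_nat, of "t/2"] by (auto simp: X_def field_simps)
  have X0: "X n \<ge> 0" "X n \<noteq> 0" for n using X(2)[of n] by auto
  note lim = norm_U_tendsto[OF order.refl X(1) X0]
  obtain B where B: "\<And>n. (LINT y|lebesgue. norm (U y (X n))) \<le> B" using lim(2) by blast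
  have W: "(\<lambda>n. W k (X n)) \<longlonglongrightarrow> W k 0" for k
  proof (rule LIM_zero_cancel)
    show "(\<lambda>n. W k (X n) - W k 0) \<longlonglongrightarrow> 0"
    proof (rule Lim_null_comparison)
      show "(\<lambda>n. (LINT y|lebesgue. norm (U y (X n) - U y 0)) * (C + 1)) \<longlonglongrightarrow> 0"
        using lim(1) by (rule tendsto_mult_left_zero)
      show "\<forall>\<^sub>F n in sequentially. norm (W k (X n) - W k 0) \<le> (LINT y|lebesgue. norm (U y (X n) - U y 0)) * (C + 1)"
        using W_diff[of _ 0] X0 by (intro always_eventually) auto
    qed
  qed
  \<comment> \<open>At time 0 only Lebesgue measurability of \<open>U\<close> is known, so
    measurability in \<open>k\<close> is inherited from the positive times
    \<open>X n\<close>.\<close>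
  have W0: "(\<lambda>k. W k 0) \<in> borel_measurable borel"
    by (rule borel_measurable_LIMSEQ_metric[OF _ W]) (use W_meas X in auto)
  have B0: "norm (W k (X n)) \<le> B * (C + 1)" for k n
    using W_bound[OF X0(1)[of n], of k] mult_right_mono[OF B[of n], of "C + 1"] C0 by linarith
  show ?thesis unfolding A_def
  \<comment> \<open>Since \<open>X n \<le> t / 2\<close>, at least the time \<open>t / 2\<close> is
    left in the Gaussian for every \<open>n\<close>.\<close>
  proof (rule integral_dominated_convergence[where w = "\<lambda>k. exp (- (\<sigma>\<^sup>2 * (t / 2)) * k\<^sup>2) * (B * (C + 1))"])
    show "integrable lborel (\<lambda>k. exp (- (\<sigma>\<^sup>2 * (t / 2)) * k\<^sup>2) * (B * (C + 1)))"
      using gaussian_integral[of "\<sigma>\<^sup>2 * (t / 2)"] \<sigma> t by (intro integrable_mult_left) (auto simp: has_bochner_integral_iff)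
    show "AE k in lborel. (\<lambda>n. gauss (\<sigma>\<^sup>2 * (t - X n)) (of_real k) * W k (X n))
       \<longlonglongrightarrow> gauss (\<sigma>\<^sup>2 * t) (of_real k) * W k 0"
    proof (intro AE_I2 tendsto_mult W tendsto_exp tendsto_minus tendsto_const)
      fix k :: real
      have "(\<lambda>n. \<sigma>\<^sup>2 * (t - X n)) \<longlonglongrightarrow> \<sigma>\<^sup>2 * (t - 0)" by (intro tendsto_intros X)
      then have "(\<lambda>n. \<sigma>\<^sup>2 * (t - X n)) \<longlonglongrightarrow> \<sigma>\<^sup>2 * t" by simp
      then show "(\<lambda>n. complex_of_real (\<sigma>\<^sup>2 * (t - X n))) \<longlonglongrightarrow> of_real (\<sigma>\<^sup>2 * t)" by (rule tendsto_of_real)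
    qed
    show "AE k in lborel. norm (gauss (\<sigma>\<^sup>2 * (t - X n)) (of_real k) * W k (X n))
         \<le> exp (- (\<sigma>\<^sup>2 * (t / 2)) * k\<^sup>2) * (B * (C + 1))" for n
    proof (intro AE_I2)
      fix k :: real
      have "norm (gauss (\<sigma>\<^sup>2 * (t - X n)) (of_real k) :: complex) = exp (- (\<sigma>\<^sup>2 * (t - X n)) * k\<^sup>2)"
        unfolding norm_exp_neg_square by simp
      also have "\<dots> \<le> exp (- (\<sigma>\<^sup>2 * (t / 2)) * k\<^sup>2)"
      proof -
        have "\<sigma>\<^sup>2 * (t / 2) * k\<^sup>2 \<le> \<sigma>\<^sup>2 * (t - X n) * k\<^sup>2"
          using X(3)[of n] by (intro mult_right_mono mult_left_mono) auto
        then show ?thesis by simp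
      qed
      finally show "norm (gauss (\<sigma>\<^sup>2 * (t - X n)) (of_real k) * W k (X n))
         \<le> exp (- (\<sigma>\<^sup>2 * (t / 2)) * k\<^sup>2) * (B * (C + 1))"
        unfolding norm_mult using B0[of k n] by (intro mult_mono) auto
    qed
    show "(\<lambda>k. gauss (\<sigma>\<^sup>2 * (t - X n)) (of_real k) * W k (X n)) \<in> borel_measurable lborel" for n
      using W_meas[OF X(2)] by measurable
    show "(\<lambda>k. gauss (\<sigma>\<^sup>2 * t) (of_real k) * W k 0) \<in> borel_measurable lborel"
      using W0 by measurable
  qed
qed

text \<open>For |y - x| < \<eta> the incident wave integrates exactly to the heat kernel, and the
  remainder has rate d \<ge> \<eta>. Otherwise the incident wave itself has rate at least \<eta> and
  is counted as error, which costs the 1 in \<open>C + 1\<close>.\<close>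

lemma gauss_\<phi>:
  assumes \<beta>: "\<beta> > 0" and \<eta>: "0 < \<eta>" "\<eta> \<le> d"
  shows "norm ((LINT k|lborel. gauss \<beta> (of_real k) * \<phi> (of_real k) y)
     - (if \<bar>y - x\<bar> < \<eta> then of_real (sqrt (pi / \<beta>) * exp (- (y - x)\<^sup>2 / (4 * \<beta>))) else 0))
     \<le> (C + 1) * (exp (1 - \<eta> / sqrt \<beta>) * sqrt (pi / \<beta>))"
proof (cases "\<bar>y - x\<bar> < \<eta>")
  case True
  have i: "integrable lborel (\<lambda>k. gauss \<beta> (of_real k) * \<phi> (of_real k) y)"
    using \<phi>_bound \<phi>_meas measurable_compose[of "\<lambda>k. (k, y)" borel "borel \<Otimes>\<^sub>M borel", OF _ \<phi>_meas]
    by (intro integrable_gaussian_mult[OF \<beta>]) auto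
  have j: "integrable lborel (\<lambda>k. gauss \<beta> (of_real k) * exp (\<i> * of_real k * of_real \<bar>y - x\<bar>))"
    by (intro integrable_gaussian_mult[OF \<beta>, where C = 1]) auto
  have "uhp_decay (\<lambda>k. \<phi> k y - exp (\<i> * k * of_real \<bar>y - x\<bar>)) (C + 1) \<eta>"
    using \<phi>_decay by (rule uhp_decay_weaken) (use \<eta> in auto)
  from norm_gaussian_uhp_le[OF this \<eta>(1) \<beta>] show ?thesis
    using True gaussian_fourier[OF \<beta>, of "\<bar>y - x\<bar>"] i j by (simp add: right_diff_distrib)
next
  case False
  have "uhp_decay (\<lambda>k. (\<phi> k y - exp (\<i> * k * of_real \<bar>y - x\<bar>)) + exp (\<i> * k * of_real \<bar>y - x\<bar>)) (C + 1) (min d \<bar>y - x\<bar>)"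
    by (intro uhp_decay_add \<phi>_decay uhp_decay_exp)
  from uhp_decay_weaken[OF this order.refl, of \<eta>] have "uhp_decay (\<lambda>k. \<phi> k y) (C + 1) \<eta>"
    using False \<eta> by simp
  from norm_gaussian_uhp_le[OF this \<eta>(1) \<beta>] False show ?thesis by simp
qed

lemma A_Fubini:
  assumes s: "0 < s" "s < t"
  defines "K \<equiv> \<lambda>y. LINT k|lborel. gauss (\<sigma>\<^sup>2 * (t - s)) (of_real k) * \<phi> (of_real k) y"
  shows "A s = (LINT y|lborel. U y s * K y)" "integrable lborel (\<lambda>y. U y s * K y)"
proof -
  define \<beta> where "\<beta> = \<sigma>\<^sup>2 * (t - s)"
  have \<beta>: "\<beta> > 0" using s \<sigma> by (simp add: \<beta>_def)
  have [measurable]: "(\<lambda>y. U y s) \<in> borel_measurable borel" by (rule U_borel[OF s(1)])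
  have [measurable]: "(\<lambda>p. \<phi> (of_real (fst p)) (snd p)) \<in> borel_measurable (borel \<Otimes>\<^sub>M borel)"
    using \<phi>_meas by (simp add: case_prod_beta')
  let ?f = "\<lambda>k y. gauss \<beta> (of_real k) * (U y s * \<phi> (of_real k) y)"
  have int: "integrable (lborel \<Otimes>\<^sub>M lborel) (\<lambda>(k, y). ?f k y)"
  proof (rule Bochner_Integration.integrable_bound)
    have "integrable (lborel \<Otimes>\<^sub>M lborel) (\<lambda>(k, y). exp (- \<beta> * k\<^sup>2) * ((C + 1) * norm (U y s)))"
      using gaussian_integral[OF \<beta>] U_int_lborel[OF s(1)]
      by (intro lborel_pair.Fubini_integrable) (auto simp: has_bochner_integral_iff abs_mult)
    then show "integrable (lborel \<Otimes>\<^sub>M lborel) (\<lambda>(k, y). exp (- \<beta> * k\<^sup>2) * ((C + 1) * norm (U y s)))" .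
    show "AE p in lborel \<Otimes>\<^sub>M lborel. norm (case p of (k, y) \<Rightarrow> ?f k y) \<le> norm (case p of (k, y) \<Rightarrow> exp (- \<beta> * k\<^sup>2) * ((C + 1) * norm (U y s)))"
    proof (intro AE_I2, clarify)
      fix k y
      have "norm (?f k y) = exp (- \<beta> * k\<^sup>2) * (norm (\<phi> (of_real k) y) * norm (U y s))"
        unfolding norm_mult norm_exp_neg_square by simp
      also have "\<dots> \<le> exp (- \<beta> * k\<^sup>2) * ((C + 1) * norm (U y s))"
        using \<phi>_bound by (intro mult_left_mono mult_right_mono) auto
      finally show "norm (?f k y) \<le> norm (exp (- \<beta> * k\<^sup>2) * ((C + 1) * norm (U y s)))" by simp
    qed
    show "(\<lambda>(k, y). ?f k y) \<in> borel_measurable (lborel \<Otimes>\<^sub>M lborel)"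
      by (simp add: case_prod_beta')
  qed
  have K: "(LINT k|lborel. ?f k y) = U y s * K y" for y
    unfolding K_def \<beta>_def[symmetric] by (simp add: mult.left_commute[of _ "U y s"])
  show "A s = (LINT y|lborel. U y s * K y)"
    using lborel_pair.Fubini_integral[OF int] unfolding K A_def \<beta>_def[symmetric] W_lborel[OF s(1)] by simp
  show "integrable lborel (\<lambda>y. U y s * K y)"
    using lborel_pair.integrable_snd[OF int] unfolding K .
qed

text \<open>Without its cut-off the kernel has mass 2 \<pi> and width of order sqrt \<beta>.
  Rescaling by y = x + c w with c = sqrt(2 \<beta>) turns it into 2 \<pi> times the standard normal
  density. The cut-off |y - x| < \<eta> provides the bound \<open>M\<close> for dominated
  convergence and disappears because c tends to 0.\<close>

lemma near_part_tendsto: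
  assumes \<eta>: "\<eta> > 0" and M: "\<And>y s. \<bar>y - x\<bar> < \<eta> \<Longrightarrow> \<bar>s - t\<bar> < \<eta> \<Longrightarrow> norm (U y s) \<le> M"
    and X: "X \<longlonglongrightarrow> t" "\<And>n. 0 < X n" "\<And>n. X n < t" "\<And>n. \<bar>X n - t\<bar> < \<eta>"
  defines "H \<equiv> \<lambda>\<beta> y. if \<bar>y - x\<bar> < \<eta> then complex_of_real (sqrt (pi / \<beta>) * exp (- (y - x)\<^sup>2 / (4 * \<beta>))) else 0"
  shows "(\<lambda>n. LINT y|lborel. U y (X n) * H (\<sigma>\<^sup>2 * (t - X n)) y) \<longlonglongrightarrow> 2 * of_real pi * U x t"
proof -
  define c where "c n = sqrt (2 * (\<sigma>\<^sup>2 * (t - X n)))" for n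
  have c: "c n > 0" for n using X(3)[of n] \<sigma> by (simp add: c_def)
  have c0: "c \<longlonglongrightarrow> 0"
  proof -
    have "(\<lambda>n. sqrt (2 * (\<sigma>\<^sup>2 * (t - X n)))) \<longlonglongrightarrow> sqrt (2 * (\<sigma>\<^sup>2 * (t - t)))"
      by (intro tendsto_intros X)
    then show ?thesis by (simp add: c_def[abs_def])
  qed
  have M0: "0 \<le> M" using M[of x t] \<eta> norm_ge_zero[of "U x t"] by (simp del: norm_ge_zero)
  let ?g = "\<lambda>n w. (if \<bar>c n * w\<bar> < \<eta> then U (x + c n * w) (X n) else 0) * of_real (std_normal_density w)"
  have "(LINT y|lborel. U y (X n) * H (\<sigma>\<^sup>2 * (t - X n)) y) = 2 * of_real pi * (LINT w|lborel. ?g n w)" for n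
  proof -
    define \<beta> where "\<beta> = \<sigma>\<^sup>2 * (t - X n)"
    have \<beta>: "\<beta> > 0" "c n = sqrt (2 * \<beta>)" using X(3)[of n] \<sigma> by (simp_all add: \<beta>_def c_def)
    have "(LINT y|lborel. U y (X n) * H \<beta> y) = \<bar>c n\<bar> *\<^sub>R (LINT w|lborel. U (x + c n * w) (X n) * H \<beta> (x + c n * w))"
      using c[of n] by (intro lborel_integral_real_affine) auto
    also have "\<dots> = (LINT w|lborel. c n *\<^sub>R (U (x + c n * w) (X n) * H \<beta> (x + c n * w)))"
      using c[of n] by simp
    also have "(\<lambda>w. c n *\<^sub>R (U (x + c n * w) (X n) * H \<beta> (x + c n * w))) = (\<lambda>w. 2 * of_real pi * ?g n w)"
    proof
      fix w
      define Z where "Z = sqrt (pi / \<beta>) * (sqrt (2 * pi) * std_normal_density w)"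
      have "(c n * w)\<^sup>2 / (4 * \<beta>) = w\<^sup>2 / 2" using \<beta> by (simp add: power_mult_distrib)
      then have e: "Z = sqrt (pi / \<beta>) * exp (- (x + c n * w - x)\<^sup>2 / (4 * \<beta>))"
        by (simp add: std_normal_density_def Z_def)
      have "c n * sqrt (pi / \<beta>) = sqrt (2 * pi)" using \<beta> by (simp add: real_sqrt_mult[symmetric])
      then have "c n * Z = 2 * pi * std_normal_density w"
        unfolding Z_def mult.assoc[symmetric] by (simp only: real_sqrt_mult_self) simp
      then have Z: "of_real (c n) * of_real Z = (2 * of_real pi * of_real (std_normal_density w) :: complex)"
        by (metis of_real_mult of_real_numeral)
      show "c n *\<^sub>R (U (x + c n * w) (X n) * H \<beta> (x + c n * w)) = 2 * of_real pi * ?g n w"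
        unfolding H_def e[symmetric] scaleR_conv_of_real mult.left_commute[of "of_real (c n)"]
        by (simp add: Z)
    qed
    also have "(LINT w|lborel. 2 * of_real pi * ?g n w) = 2 * of_real pi * (LINT w|lborel. ?g n w)"
      by (rule integral_mult_right_zero)
    finally show ?thesis by (simp add: \<beta>_def)
  qed
  moreover have "(\<lambda>n. LINT w|lborel. ?g n w) \<longlonglongrightarrow> (LINT w|lborel. U x t * of_real (std_normal_density w))"
  proof (rule integral_dominated_convergence[where w = "\<lambda>w. M * std_normal_density w"])
    show "AE w in lborel. (\<lambda>n. ?g n w) \<longlonglongrightarrow> U x t * of_real (std_normal_density w)"
    proof (intro AE_I2 tendsto_mult tendsto_const)
      fix w :: real
      have cw: "(\<lambda>n. c n * w) \<longlonglongrightarrow> 0" using c0 by (rule tendsto_mult_left_zero)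
      then have "(\<lambda>n. \<bar>c n * w\<bar>) \<longlonglongrightarrow> 0" by (rule tendsto_rabs_zero)
      then have ev: "\<forall>\<^sub>F n in sequentially. \<bar>c n * w\<bar> < \<eta>" using \<eta> by (rule order_tendstoD(2))
      have "(\<lambda>n. (x + c n * w, X n)) \<longlonglongrightarrow> (x + 0, t)" by (intro tendsto_intros cw X)
      then have "(\<lambda>n. U (x + c n * w) (X n)) \<longlonglongrightarrow> U x t"
        using isCont_tendsto_compose[OF U_cont, of "\<lambda>n. (x + c n * w, X n)"] by simp
      then show "(\<lambda>n. if \<bar>c n * w\<bar> < \<eta> then U (x + c n * w) (X n) else 0) \<longlonglongrightarrow> U x t"
        by (rule Lim_transform_eventually) (use ev in \<open>auto elim: eventually_mono\<close>)
    qed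
    show "AE w in lborel. norm (?g n w) \<le> M * std_normal_density w" for n
      using M[of "x + c n * _" "X n"] X(4)[of n] M0
      by (intro AE_I2) (auto simp: norm_mult intro!: mult_right_mono)
    show "(\<lambda>w. ?g n w) \<in> borel_measurable lborel" for n
    proof -
      have [measurable]: "(\<lambda>y. U y (X n)) \<in> borel_measurable borel" by (rule U_borel[OF X(2)])
      show ?thesis by measurable
    qed
  qed auto
  moreover have "(LINT w|lborel. U x t * of_real (std_normal_density w)) = U x t"
    by (subst integral_mult_right_zero) (simp only: integral_complex_of_real integral_normal_density zero_less_one, simp)
  ultimately show ?thesis by (simp add: tendsto_mult_left)
qed

lemma A_tendsto_t: "\<exists>X. (\<forall>n. 0 < X n \<and> X n < t) \<and> (\<lambda>n. A (X n)) \<longlonglongrightarrow> 2 * of_real pi * U x t"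
proof -
  obtain \<eta>0 where \<eta>0: "\<eta>0 > 0" "\<And>p. dist p (x, t) < \<eta>0 \<Longrightarrow> dist (case p of (y, s) \<Rightarrow> U y s) (U x t) < 1"
    using U_cont[unfolded continuous_at, unfolded Lim_at] zero_less_one
    by (metis (no_types, lifting) case_prod_conv dist_self zero_less_dist_iff)
  \<comment> \<open>The half is taken because the distance in the plane is bounded by the sum of the
    two coordinate distances; the minimum with \<open>d\<close> makes \<open>gauss_\<phi>\<close>
    applicable.\<close>
  define \<eta> where "\<eta> = min d (\<eta>0 / 2)"
  have \<eta>: "0 < \<eta>" "\<eta> \<le> d" "\<eta> \<le> \<eta>0 / 2" using \<eta>0 d by (auto simp: \<eta>_def)
  have M: "norm (U y s) \<le> norm (U x t) + 1" if "\<bar>y - x\<bar> < \<eta>" "\<bar>s - t\<bar> < \<eta>" for y s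
  proof -
    have "dist (y, s) (x, t) \<le> \<bar>y - x\<bar> + \<bar>s - t\<bar>"
      by (simp add: dist_prod_def dist_real_def sqrt_sum_squares_le_sum_abs)
    then have "dist (U y s) (U x t) < 1" using \<eta>0(2)[of "(y, s)"] that \<eta> by simp
    then show ?thesis using norm_triangle_ineq2[of "U y s" "U x t"] by (simp add: dist_norm)
  qed
  define c where "c = min (t / 2) (\<eta> / 2)"
  have c: "c > 0" "c < t" "c < \<eta>" using t \<eta> by (auto simp: c_def)
  define X where "X n = t - c / real (Suc n)" for n
  have cn: "0 < c / real (Suc n)" "c / real (Suc n) \<le> c" for n using c by (auto simp: field_simps)
  have X: "X \<longlonglongrightarrow> t" "\<And>n. 0 < X n" "\<And>n. X n < t" "\<And>n. \<bar>X n - t\<bar> < \<eta>"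
  proof -
    have "(\<lambda>n. t - c * inverse (real (Suc n))) \<longlonglongrightarrow> t - c * 0"
      by (intro tendsto_intros LIMSEQ_inverse_real_of_nat)
    then show "X \<longlonglongrightarrow> t" by (simp add: X_def[abs_def] divide_inverse)
    show "0 < X n" "X n < t" "\<bar>X n - t\<bar> < \<eta>" for n
      using cn[of n] c by (auto simp: X_def simp del: of_nat_Suc)
  qed
  have X': "0 \<le> X n" "X n \<noteq> t" for n using X(2,3)[of n] by auto
  obtain B where B: "\<And>n. (LINT y|lebesgue. norm (U y (X n))) \<le> B"
    using norm_U_tendsto(2)[OF less_imp_le[OF t] X(1) X'] by blast
  define \<beta> where "\<beta> n = \<sigma>\<^sup>2 * (t - X n)" for n
  have \<beta>: "\<beta> n > 0" for n using X(3)[of n] \<sigma> by (simp add: \<beta>_def)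
  have \<beta>0: "filterlim \<beta> (at_right 0) sequentially"
  proof -
    have "(\<lambda>n. \<sigma>\<^sup>2 * (t - X n)) \<longlonglongrightarrow> \<sigma>\<^sup>2 * (t - t)" by (intro tendsto_intros X)
    then show ?thesis using \<beta> by (simp add: filterlim_at \<beta>_def[abs_def, symmetric] less_imp_neq[symmetric])
  qed
  define H where "H \<beta> y = (if \<bar>y - x\<bar> < \<eta> then complex_of_real (sqrt (pi / \<beta>) * exp (- (y - x)\<^sup>2 / (4 * \<beta>))) else 0)" for \<beta> y
  define K where "K n y = (LINT k|lborel. gauss (\<beta> n) (of_real k) * \<phi> (of_real k) y)" for n y
  have lim: "(\<lambda>n. LINT y|lborel. U y (X n) * H (\<beta> n) y) \<longlonglongrightarrow> 2 * of_real pi * U x t"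
    unfolding H_def \<beta>_def using \<eta>(1) M X by (rule near_part_tendsto)
  \<comment> \<open>The error bound of \<open>gauss_\<phi>\<close>. It is uniform in
    \<open>y\<close>, so it multiplies the L1 norms of the slices of \<open>U\<close>, which are
    bounded by \<open>B\<close>.\<close>
  define \<epsilon> where "\<epsilon> n = (C + 1) * (exp (1 - \<eta> / sqrt (\<beta> n)) * sqrt (pi / \<beta> n))" for n
  have \<epsilon>: "\<epsilon> \<longlonglongrightarrow> 0"
  proof -
    have "((\<lambda>b. exp (1 - \<eta> / sqrt b) * sqrt (pi / b)) \<longlongrightarrow> 0) (at_right 0)"
      using \<eta>(1) by real_asymp
    from filterlim_compose[OF this \<beta>0] show ?thesis
      unfolding \<epsilon>_def by (rule tendsto_mult_right_zero)
  qed
  have "(\<lambda>n. A (X n) - (LINT y|lborel. U y (X n) * H (\<beta> n) y)) \<longlonglongrightarrow> 0"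
  proof (rule Lim_null_comparison)
    show "(\<lambda>n. B * \<epsilon> n) \<longlonglongrightarrow> 0" using \<epsilon> by (rule tendsto_mult_right_zero)
    have "norm (A (X n) - (LINT y|lborel. U y (X n) * H (\<beta> n) y)) \<le> B * \<epsilon> n" for n
    proof -
      have [measurable]: "(\<lambda>y. U y (X n)) \<in> borel_measurable borel" by (rule U_borel[OF X(2)])
      have i1: "A (X n) = (LINT y|lborel. U y (X n) * K n y)" "integrable lborel (\<lambda>y. U y (X n) * K n y)"
        using A_Fubini[OF X(2,3)[of n]] by (simp_all only: K_def \<beta>_def)
      note iU = U_int_lborel[OF X(2)[of n]]
      have i2: "integrable lborel (\<lambda>y. U y (X n) * H (\<beta> n) y)"
      proof (rule Bochner_Integration.integrable_bound)
        show "integrable lborel (\<lambda>y. norm (U y (X n)) * sqrt (pi / \<beta> n))" using iU by simp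
        show "(\<lambda>y. U y (X n) * H (\<beta> n) y) \<in> borel_measurable lborel" unfolding H_def by measurable
        show "AE y in lborel. norm (U y (X n) * H (\<beta> n) y) \<le> norm (norm (U y (X n)) * sqrt (pi / \<beta> n))"
        proof (intro AE_I2)
          fix y
          have "norm (H (\<beta> n) y) \<le> sqrt (pi / \<beta> n)"
            using \<beta>[of n] by (auto simp: H_def norm_mult intro!: mult_right_le_one_le)
          then show "norm (U y (X n) * H (\<beta> n) y) \<le> norm (norm (U y (X n)) * sqrt (pi / \<beta> n))"
            using \<beta>[of n] by (auto simp: norm_mult abs_mult intro!: mult_left_mono)
        qed
      qed
      have "A (X n) - (LINT y|lborel. U y (X n) * H (\<beta> n) y) = (LINT y|lborel. U y (X n) * (K n y - H (\<beta> n) y))"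
        unfolding i1(1) right_diff_distrib using i1(2) i2 by (intro Bochner_Integration.integral_diff[symmetric])
      also have "norm \<dots> \<le> (LINT y|lborel. norm (U y (X n)) * \<epsilon> n)"
      proof (rule Bochner_Integration.integral_norm_bound_integral)
        show "integrable lborel (\<lambda>y. U y (X n) * (K n y - H (\<beta> n) y))"
          unfolding right_diff_distrib using i1(2) i2 by simp
        fix y
        show "norm (U y (X n) * (K n y - H (\<beta> n) y)) \<le> norm (U y (X n)) * \<epsilon> n"
          unfolding norm_mult K_def H_def \<epsilon>_def by (intro mult_left_mono gauss_\<phi> \<beta> \<eta>) auto
      qed (use iU in auto)
      also have "\<dots> = (LINT y|lebesgue. norm (U y (X n))) * \<epsilon> n"
        using norm_U_lborel[OF X(2)] by simp
      also have "\<dots> \<le> B * \<epsilon> n"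
        using B[of n] C0 \<beta>[of n] by (intro mult_right_mono) (auto simp: \<epsilon>_def)
      finally show ?thesis .
    qed
    then show "\<forall>\<^sub>F n in sequentially. norm (A (X n) - (LINT y|lborel. U y (X n) * H (\<beta> n) y)) \<le> B * \<epsilon> n" by simp
  qed
  from tendsto_add[OF this lim] have "(\<lambda>n. A (X n)) \<longlonglongrightarrow> 2 * of_real pi * U x t" by simp
  then show ?thesis by (intro exI[of _ X] conjI allI X)
qed

lemma inversion:
  assumes odd: "\<And>k s1 s2. 0 < s1 \<Longrightarrow> s1 < s2 \<Longrightarrow> heat_increment (\<sigma>\<^sup>2 * k\<^sup>2) s1 s2 (W (- k))
        = - (heat_increment (\<sigma>\<^sup>2 * k\<^sup>2) s1 s2 (W k))"
  shows "(LINT k|lborel. gauss (\<sigma>\<^sup>2 * t) (of_real k) * W k 0) = 2 * of_real pi * U x t"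
proof -
  have const: "A s = A (t / 2)" if "0 < s" "s < t" for s
  proof (cases s "t / 2" rule: linorder_cases)
    case less
    show ?thesis by (rule A_const[OF odd]) (use that less t in auto)
  next
    case greater
    show ?thesis by (rule A_const[OF odd, symmetric]) (use that greater t in auto)
  next
    case equal
    then show ?thesis by (simp only:)
  qed
  have "A (t / 2 / real (Suc n)) = A (t / 2)" for n
  proof (rule const)
    have "t / 2 / real (Suc n) \<le> t / 2" using t by (simp add: field_simps)
    then show "t / 2 / real (Suc n) < t" using t by linarith
  qed (use t in simp)
  with A_tendsto_0 have "(LINT k|lborel. gauss (\<sigma>\<^sup>2 * t) (of_real k) * W k 0) = A (t / 2)"
    by (simp add: LIMSEQ_const_iff)
  moreover obtain X where "\<forall>n. 0 < X n \<and> X n < t" "(\<lambda>n. A (X n)) \<longlonglongrightarrow> 2 * of_real pi * U x t"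
    using A_tendsto_t by blast
  ultimately show ?thesis using const by (simp add: LIMSEQ_const_iff)
qed

end

section \<open>Green identities for classical solutions\<close>

lemma chs_deriv:
  assumes "classical_heat_solution \<sigma> J u ux"
  obtains ut uxx where
    "\<And>x t. x \<in> J \<Longrightarrow> t > 0 \<Longrightarrow> ((\<lambda>s. u x s) has_vector_derivative ut x t) (at t)"
    "\<And>x t. x \<in> J \<Longrightarrow> t > 0 \<Longrightarrow> ((\<lambda>y. u y t) has_vector_derivative ux x t) (at x)"
    "\<And>x t. x \<in> J \<Longrightarrow> t > 0 \<Longrightarrow> ((\<lambda>y. ux y t) has_vector_derivative uxx x t) (at x)"
    "\<And>x t. x \<in> J \<Longrightarrow> t > 0 \<Longrightarrow> ut x t = of_real (\<sigma>\<^sup>2) * uxx x t"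
    "continuous_on (J \<times> {0<..}) (\<lambda>(x, t). ut x t)"
    "continuous_on (J \<times> {0<..}) (\<lambda>(x, t). uxx x t)"
proof -
  from assms obtain ut uxx where
    "\<forall>x\<in>J. \<forall>t>0.
           ((\<lambda>s. u x s) has_vector_derivative ut x t) (at t) \<and>
           ((\<lambda>y. u y t) has_vector_derivative ux x t) (at x) \<and>
           ((\<lambda>y. ux y t) has_vector_derivative uxx x t) (at x) \<and>
           ut x t = of_real (\<sigma>\<^sup>2) * uxx x t"
    "continuous_on (J \<times> {0<..}) (\<lambda>(x, t). ut x t)" "continuous_on (J \<times> {0<..}) (\<lambda>(x, t). uxx x t)"
    unfolding classical_heat_solution_def by (elim conjE exE)
  then show ?thesis by (intro that[of ut uxx]) blast+
qed

lemma chs_cont: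
  assumes "classical_heat_solution \<sigma> J u ux"
  shows "continuous_on (closure J \<times> {0<..}) (\<lambda>(x, t). u x t)"
    and "continuous_on (closure J \<times> {0<..}) (\<lambda>(x, t). ux x t)"
  using assms unfolding classical_heat_solution_def by blast+

lemma chs_integrable:
  assumes "classical_heat_solution \<sigma> J u ux"
  shows "t \<ge> 0 \<Longrightarrow> (\<lambda>x. u x t) absolutely_integrable_on J"
    and "t0 \<ge> 0 \<Longrightarrow> ((\<lambda>t. LINT x:J|lebesgue. norm (u x t - u x t0)) \<longlongrightarrow> 0) (at t0 within {0..})"
  using assms unfolding classical_heat_solution_def by blast+

lemma chs_uniform:
  assumes "classical_heat_solution \<sigma> J u ux" "compact K" "K \<subseteq> {0<..}"
  shows "uniform_limit K u (\<lambda>_. 0) (inf at_infinity (principal J))"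
    and "uniform_limit K ux (\<lambda>_. 0) (inf at_infinity (principal J))"
  using assms unfolding classical_heat_solution_def by blast+

text \<open>The equation is imposed on the whole line. Each piece of a Green function is a sum of
  exponentials and extends beyond its layer, so no one-sided derivatives arise at
  interfaces.\<close>

definition wave_solution :: "real \<Rightarrow> (real \<Rightarrow> complex) \<Rightarrow> (real \<Rightarrow> complex) \<Rightarrow> bool" where
  "wave_solution c \<phi> \<phi>' \<longleftrightarrow> (\<forall>y. (\<phi> has_vector_derivative \<phi>' y) (at y) \<and>
     (\<phi>' has_vector_derivative - of_real c * \<phi> y) (at y))"

lemma wave_solutionD:
  assumes "wave_solution c \<phi> \<phi>'"
  shows "(\<phi> has_vector_derivative \<phi>' y) (at y within S)"
    "(\<phi>' has_vector_derivative - of_real c * \<phi> y) (at y within S)"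
    "continuous_on S \<phi>" "continuous_on S \<phi>'"
proof -
  show 1: "(\<phi> has_vector_derivative \<phi>' y) (at y within S)"
    "(\<phi>' has_vector_derivative - of_real c * \<phi> y) (at y within S)" for y S
    using assms unfolding wave_solution_def by (blast intro: has_vector_derivative_at_within)+
  show "continuous_on S \<phi>" "continuous_on S \<phi>'"
    by (rule continuous_on_vector_derivative, rule 1)+
qed

section \<open>Green's identity on strips and half-lines\<close>

context
  fixes \<sigma> c \<omega> s1 s2 :: real and J :: "real set" and u ux :: "real \<Rightarrow> real \<Rightarrow> complex" and \<phi> \<phi>' :: "real \<Rightarrow> complex"
  assumes sol: "classical_heat_solution \<sigma> J u ux"
    and s: "0 < s1" "s1 \<le> s2"
    and \<phi>: "wave_solution c \<phi> \<phi>'"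
    and \<omega>: "\<omega> = \<sigma>\<^sup>2 * c"
begin

text \<open>With \<omega> = \<sigma>^2 c, the s-derivative of exp(\<omega> s) u \<phi> equals the
  y-derivative of exp(\<omega> s) \<sigma>^2 (u_x \<phi> - u \<phi>'). This is the time integral of
  that flux.\<close>

definition green_flux :: "real \<Rightarrow> complex" where
  "green_flux y = integral {s1..s2} (\<lambda>s. exp (of_real (\<omega> * s)) * (of_real (\<sigma>\<^sup>2) * (ux y s * \<phi> y - u y s * \<phi>' y)))"

lemma cont_u_time: "y \<in> closure J \<Longrightarrow> continuous_on {s1..s2} (\<lambda>s. u y s)"
    "y \<in> closure J \<Longrightarrow> continuous_on {s1..s2} (\<lambda>s. ux y s)"
  using s by (auto intro!: continuous_on_compose2[OF chs_cont(1)[OF sol], of _ "\<lambda>s. (y, s)", simplified]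
      continuous_on_compose2[OF chs_cont(2)[OF sol], of _ "\<lambda>s. (y, s)", simplified] continuous_intros)

lemma cont_u_space: "S \<subseteq> closure J \<Longrightarrow> t > 0 \<Longrightarrow> continuous_on S (\<lambda>y. u y t)"
    "S \<subseteq> closure J \<Longrightarrow> t > 0 \<Longrightarrow> continuous_on S (\<lambda>y. ux y t)"
  by (auto intro!: continuous_on_compose2[OF chs_cont(1)[OF sol], of _ "\<lambda>y. (y, t)", simplified]
      continuous_on_compose2[OF chs_cont(2)[OF sol], of _ "\<lambda>y. (y, t)", simplified] continuous_intros)

text \<open>The time derivative is controlled only inside \<open>J\<close>, hence a compact interval
  in \<open>J\<close>. Differentiating under the integral in s produces the y-derivative of the flux
  \<open>G\<close>; integrating in y and then in s gives the identity.\<close>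

lemma green_strip_interior:
  assumes pq: "p \<le> q" "{p..q} \<subseteq> J"
  shows "heat_increment \<omega> s1 s2 (\<lambda>s. integral {p..q} (\<lambda>y. u y s * \<phi> y)) = green_flux q - green_flux p"
proof -
  obtain ut uxx where
    D: "\<And>x t. x \<in> J \<Longrightarrow> t > 0 \<Longrightarrow> ((\<lambda>s. u x s) has_vector_derivative ut x t) (at t)"
    "\<And>x t. x \<in> J \<Longrightarrow> t > 0 \<Longrightarrow> ((\<lambda>y. u y t) has_vector_derivative ux x t) (at x)"
    "\<And>x t. x \<in> J \<Longrightarrow> t > 0 \<Longrightarrow> ((\<lambda>y. ux y t) has_vector_derivative uxx x t) (at x)"
    "\<And>x t. x \<in> J \<Longrightarrow> t > 0 \<Longrightarrow> ut x t = of_real (\<sigma>\<^sup>2) * uxx x t"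
    and cut: "continuous_on (J \<times> {0<..}) (\<lambda>(x, t). ut x t)"
    by (rule chs_deriv[OF sol]) blast
  have pqJ: "y \<in> closure J" if "y \<in> {p..q}" for y using that pq closure_subset by blast
  define e where "e s = exp (of_real (\<omega> * s) :: complex)" for s
  have e': "(e has_vector_derivative of_real \<omega> * e s) (at s within S)" for s S
    unfolding e_def of_real_mult
    by (rule has_vector_derivative_real_field[where f = "\<lambda>z. exp (of_real \<omega> * z)"])
       (auto intro!: derivative_eq_intros)
  have ce: "continuous_on S e" for S unfolding e_def by (intro continuous_intros)
  define G where "G s y = e s * (of_real (\<sigma>\<^sup>2) * (ux y s * \<phi> y - u y s * \<phi>' y))" for s y
  have cont2: "continuous_on ({s1..s2} \<times> cbox p q) (\<lambda>(s, y). u y s)"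
    "continuous_on ({s1..s2} \<times> cbox p q) (\<lambda>(s, y). ut y s)"
    unfolding case_prod_beta'
    using s pq pqJ
    by (auto intro!: continuous_on_compose2[OF chs_cont(1)[OF sol], of _ "\<lambda>p. (snd p, fst p)", simplified]
        continuous_on_compose2[OF cut, of _ "\<lambda>p. (snd p, fst p)", simplified] continuous_intros)
  have c\<phi>: "continuous_on ({s1..s2} \<times> cbox p q) (\<lambda>p. \<phi> (snd p))"
    by (intro continuous_on_compose2[OF wave_solutionD(3)[OF \<phi>, of UNIV]] continuous_intros) auto
  have deriv: "((\<lambda>s. integral (cbox p q) (\<lambda>y. e s * u y s * \<phi> y)) has_vector_derivative
      integral (cbox p q) (\<lambda>y. (of_real \<omega> * e t * u y t + e t * ut y t) * \<phi> y)) (at t within {s1..s2})"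
    if t: "t \<in> {s1..s2}" for t
  proof (rule leibniz_rule_vector_derivative)
    fix s' y assume sy: "s' \<in> {s1..s2}" "y \<in> cbox p q"
    then have "((\<lambda>s. u y s) has_vector_derivative ut y s') (at s' within {s1..s2})"
      using pq(2) s(1) by (intro has_vector_derivative_at_within[OF D(1)]) auto
    from has_vector_derivative_mult[OF has_vector_derivative_mult[OF e' this] has_vector_derivative_const[of "\<phi> y"]]
    show "((\<lambda>s. e s * u y s * \<phi> y) has_vector_derivative
        (of_real \<omega> * e s' * u y s' + e s' * ut y s') * \<phi> y) (at s' within {s1..s2})"
      by (simp add: add_ac)
  next
    fix s' assume "s' \<in> {s1..s2}"
    then show "(\<lambda>y. e s' * u y s' * \<phi> y) integrable_on cbox p q"
      using s pqJ by (intro integrable_continuous continuous_intros cont_u_space wave_solutionD(3)[OF \<phi>]) auto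
  next
    show "continuous_on ({s1..s2} \<times> cbox p q) (\<lambda>(s, y). (of_real \<omega> * e s * u y s + e s * ut y s) * \<phi> y)"
      using cont2 c\<phi> continuous_on_compose2[OF ce[of UNIV] continuous_on_fst[OF continuous_on_id]]
      unfolding case_prod_beta' by (intro continuous_intros) auto
  qed (use t in auto)
  have space: "integral (cbox p q) (\<lambda>y. (of_real \<omega> * e t * u y t + e t * ut y t) * \<phi> y) = G t q - G t p"
    if t: "t \<in> {s1..s2}" for t
  proof -
    have "((\<lambda>y. (of_real \<omega> * e t * u y t + e t * ut y t) * \<phi> y) has_integral (G t q - G t p)) {p..q}"
    proof (rule fundamental_theorem_of_calculus[OF pq(1)])
      fix y assume y: "y \<in> {p..q}"
      have yJ: "y \<in> J" "t > 0" using y pq t s by auto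
      have "((\<lambda>y. ux y t * \<phi> y - u y t * \<phi>' y) has_vector_derivative
         (ux y t * \<phi>' y + uxx y t * \<phi> y) - (u y t * (- of_real c * \<phi> y) + ux y t * \<phi>' y)) (at y within {p..q})"
        by (intro has_vector_derivative_diff has_vector_derivative_mult wave_solutionD[OF \<phi>]
            has_vector_derivative_at_within[OF D(2)] has_vector_derivative_at_within[OF D(3)] yJ)
      from has_vector_derivative_mult_right[OF has_vector_derivative_mult_right[OF this, of "of_real (\<sigma>\<^sup>2)"], of "e t"]
      show "(G t has_vector_derivative (of_real \<omega> * e t * u y t + e t * ut y t) * \<phi> y) (at y within {p..q})"
        unfolding G_def D(4)[OF yJ] \<omega> by (simp add: algebra_simps)
    qed
    then show ?thesis by (simp add: integral_unique)
  qed
  have "((\<lambda>s. G s q - G s p) has_integral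
      integral (cbox p q) (\<lambda>y. e s2 * u y s2 * \<phi> y) - integral (cbox p q) (\<lambda>y. e s1 * u y s1 * \<phi> y)) {s1..s2}"
    using deriv space s(2) by (intro fundamental_theorem_of_calculus) auto
  then have "integral (cbox p q) (\<lambda>y. e s2 * u y s2 * \<phi> y) - integral (cbox p q) (\<lambda>y. e s1 * u y s1 * \<phi> y)
     = integral {s1..s2} (\<lambda>s. G s q - G s p)"
    by (simp add: integral_unique)
  also have "\<dots> = integral {s1..s2} (\<lambda>s. G s q) - integral {s1..s2} (\<lambda>s. G s p)"
    unfolding G_def using pq pqJ
    by (intro integral_diff integrable_continuous_real continuous_intros ce cont_u_time) auto
  finally show ?thesis unfolding green_flux_def G_def e_def[symmetric] by (simp add: mult.assoc)
qed

lemma continuous_green_flux: "continuous_on (closure J) green_flux"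
proof -
  have "continuous_on (closure J \<times> cbox s1 s2)
     (\<lambda>(y, s). exp (of_real (\<omega> * s)) * (of_real (\<sigma>\<^sup>2) * (ux y s * \<phi> y - u y s * \<phi>' y)))"
    unfolding case_prod_beta'
  proof (intro continuous_intros)
    show "continuous_on (closure J \<times> cbox s1 s2) (\<lambda>x. ux (fst x) (snd x))"
      using s by (intro continuous_on_subset[OF chs_cont(2)[OF sol, unfolded case_prod_beta']]) auto
    show "continuous_on (closure J \<times> cbox s1 s2) (\<lambda>x. u (fst x) (snd x))"
      using s by (intro continuous_on_subset[OF chs_cont(1)[OF sol, unfolded case_prod_beta']]) auto
    show "continuous_on (closure J \<times> cbox s1 s2) (\<lambda>x. \<phi> (fst x))" "continuous_on (closure J \<times> cbox s1 s2) (\<lambda>x. \<phi>' (fst x))"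
      by (intro continuous_on_compose2[OF wave_solutionD(3)[OF \<phi>, of UNIV]]
          continuous_on_compose2[OF wave_solutionD(4)[OF \<phi>, of UNIV]] continuous_intros; auto)+
  qed
  from integral_continuous_on_param[OF this] show ?thesis
    unfolding green_flux_def[abs_def] by simp
qed

text \<open>At an interface only \<open>u\<close> and \<open>ux\<close> extend continuously. Both
  sides of the identity are continuous in the end points, so it passes from compact subintervals to
  the closed strip, one end at a time from the midpoint outwards.\<close>

lemma green_strip:
  assumes pq: "p < q" "{p<..<q} \<subseteq> J"
  shows "heat_increment \<omega> s1 s2 (\<lambda>s. integral {p..q} (\<lambda>y. u y s * \<phi> y)) = green_flux q - green_flux p"
proof -
  define m where "m = (p + q) / 2"
  have m: "p < m" "m < q" using pq by (auto simp: m_def)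
  have pqc: "{p..q} \<subseteq> closure J" using closure_mono[OF pq(2)] pq(1) by simp
  have int: "(\<lambda>y. u y t * \<phi> y) integrable_on {p..q}" if "t > 0" for t
    using pqc that by (intro integrable_continuous_real continuous_intros cont_u_space wave_solutionD(3)[OF \<phi>])
  have s2: "s2 > 0" using s by simp
  have int': "(\<lambda>y. u y t * \<phi> y) integrable_on {m..q}" "(\<lambda>y. u y t * \<phi> y) integrable_on {p..m}" if "t > 0" for t
    using int[OF that] m by (auto intro: integrable_subinterval_real)
  let ?R = "\<lambda>q. heat_increment \<omega> s1 s2 (\<lambda>s. integral {m..q} (\<lambda>y. u y s * \<phi> y)) - (green_flux q - green_flux m)" and ?L = "\<lambda>p. heat_increment \<omega> s1 s2 (\<lambda>s. integral {p..m} (\<lambda>y. u y s * \<phi> y)) - (green_flux m - green_flux p)"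
  have R: "?R q = 0"
  proof (rule continuous_constant_on_closure[where S = "{m..<q}" and f = ?R])
    show "continuous_on (closure {m..<q}) ?R"
      using m pqc by (auto intro!: continuous_intros indefinite_integral_continuous_1 int' s2 s continuous_on_subset[OF continuous_green_flux])
    fix q' assume "q' \<in> {m..<q}"
    then show "?R q' = 0"
      using green_strip_interior[of m q'] m pq by (force simp: subset_iff)
  qed (use m in auto)
  have L: "?L p = 0"
  proof (rule continuous_constant_on_closure[where S = "{p<..m}" and f = ?L])
    show "continuous_on (closure {p<..m}) ?L"
      using m pqc by (auto intro!: continuous_intros indefinite_integral_continuous_1' int' s2 s continuous_on_subset[OF continuous_green_flux])
    fix p' assume "p' \<in> {p<..m}"
    then show "?L p' = 0"
      using green_strip_interior[of p' m] m pq by (force simp: subset_iff)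
  qed (use m in auto)
  have split: "integral {p..q} (\<lambda>y. u y t * \<phi> y) = integral {p..m} (\<lambda>y. u y t * \<phi> y) + integral {m..q} (\<lambda>y. u y t * \<phi> y)" if "t > 0" for t
    using Henstock_Kurzweil_Integration.integral_combine[OF less_imp_le[OF m(1)] less_imp_le[OF m(2)] int[OF that]] by simp
  show ?thesis unfolding split[OF s(1)] split[OF s2] using L R by algebra
qed

text \<open>Isolates the time integrals of \<sigma>^2 u_x and of u, the two quantities that the
  transmission conditions equate across an interface.\<close>

lemma green_flux_eq:
  assumes "y \<in> closure J"
  shows "green_flux y = \<phi> y * integral {s1..s2} (\<lambda>s. exp (of_real (\<omega> * s)) * (of_real (\<sigma>\<^sup>2) * ux y s))
     - of_real (\<sigma>\<^sup>2) * \<phi>' y * integral {s1..s2} (\<lambda>s. exp (of_real (\<omega> * s)) * u y s)"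
proof -
  have "green_flux y = integral {s1..s2} (\<lambda>s. \<phi> y * (exp (of_real (\<omega> * s)) * (of_real (\<sigma>\<^sup>2) * ux y s))
     - of_real (\<sigma>\<^sup>2) * \<phi>' y * (exp (of_real (\<omega> * s)) * u y s))"
    unfolding green_flux_def by (simp add: algebra_simps)
  also have "\<dots> = integral {s1..s2} (\<lambda>s. \<phi> y * (exp (of_real (\<omega> * s)) * (of_real (\<sigma>\<^sup>2) * ux y s)))
     - integral {s1..s2} (\<lambda>s. of_real (\<sigma>\<^sup>2) * \<phi>' y * (exp (of_real (\<omega> * s)) * u y s))"
    using assms by (intro integral_diff integrable_continuous_real continuous_intros cont_u_time)
  finally show ?thesis by simp
qed

lemma green_flux_tendsto_0:
  assumes "filterlim X at_infinity F" "eventually (\<lambda>n. X n \<in> J) F"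
    and b: "\<And>y. y \<in> J \<Longrightarrow> norm (\<phi> y) \<le> B" "\<And>y. y \<in> J \<Longrightarrow> norm (\<phi>' y) \<le> B"
  shows "((\<lambda>n. green_flux (X n)) \<longlongrightarrow> 0) F"
proof (rule tendstoI)
  fix \<epsilon> :: real assume \<epsilon>: "\<epsilon> > 0"
  \<comment> \<open>The summand 1 keeps \<open>E\<close> positive even if \<open>B = 0\<close> or
    \<open>s1 = s2\<close>; the flux will be bounded by \<open>\<eta> * (E - 1)\<close>.\<close>
  define E where "E = exp (\<bar>\<omega>\<bar> * s2) * (\<sigma>\<^sup>2 * (2 * \<bar>B\<bar>)) * (s2 - s1) + 1"
  have E: "E > 0" using s unfolding E_def by (intro add_nonneg_pos mult_nonneg_nonneg) auto
  define \<eta> where "\<eta> = \<epsilon> / E / 2"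
  have \<eta>: "\<eta> > 0" using \<epsilon> E by (simp add: \<eta>_def)
  have X: "filterlim X (inf at_infinity (principal J)) F"
    using assms(1,2) by (simp add: filterlim_inf filterlim_principal)
  have K: "compact {s1..s2}" "{s1..s2} \<subseteq> {0<..}" using s by auto
  have "eventually (\<lambda>n. \<forall>s\<in>{s1..s2}. dist (u n s) 0 < \<eta>) (inf at_infinity (principal J))"
    "eventually (\<lambda>n. \<forall>s\<in>{s1..s2}. dist (ux n s) 0 < \<eta>) (inf at_infinity (principal J))"
    using chs_uniform[OF sol K] \<eta> by (auto simp: uniform_limit_iff)
  from eventually_compose_filterlim[OF this(1) X] eventually_compose_filterlim[OF this(2) X] assms(2)
  show "\<forall>\<^sub>F n in F. dist (green_flux (X n)) 0 < \<epsilon>"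
  proof eventually_elim
    case (elim n)
    then have XJ: "X n \<in> closure J" using closure_subset by blast
    have "norm (green_flux (X n)) \<le> exp (\<bar>\<omega>\<bar> * s2) * (\<sigma>\<^sup>2 * (\<eta> * \<bar>B\<bar> + \<eta> * \<bar>B\<bar>)) * (s2 - s1)"
      unfolding green_flux_def
    proof (rule integral_bound[OF s(2)])
      show "continuous_on {s1..s2} (\<lambda>s. exp (of_real (\<omega> * s)) * (of_real (\<sigma>\<^sup>2) * (ux (X n) s * \<phi> (X n) - u (X n) s * \<phi>' (X n))))"
        by (intro continuous_intros cont_u_time XJ)
      fix t assume t: "t \<in> {s1..s2}"
      have B: "norm (\<phi> (X n)) \<le> \<bar>B\<bar>" "norm (\<phi>' (X n)) \<le> \<bar>B\<bar>" using b[OF elim(3)] by auto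
      have "norm (ux (X n) t * \<phi> (X n) - u (X n) t * \<phi>' (X n)) \<le> norm (ux (X n) t) * norm (\<phi> (X n)) + norm (u (X n) t) * norm (\<phi>' (X n))"
        by (metis norm_mult norm_triangle_ineq4)
      also have "\<dots> \<le> \<eta> * \<bar>B\<bar> + \<eta> * \<bar>B\<bar>"
        using B elim t \<eta> by (intro add_mono mult_mono) (auto simp: less_imp_le)
      finally have 1: "norm (ux (X n) t * \<phi> (X n) - u (X n) t * \<phi>' (X n)) \<le> \<eta> * \<bar>B\<bar> + \<eta> * \<bar>B\<bar>" .
      have "\<omega> * t \<le> \<bar>\<omega>\<bar> * s2" using t s by (intro mult_mono) auto
      then have "norm (exp (of_real (\<omega> * t) :: complex)) \<le> exp (\<bar>\<omega>\<bar> * s2)" by simp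
      then show "norm (exp (of_real (\<omega> * t)) * (of_real (\<sigma>\<^sup>2) * (ux (X n) t * \<phi> (X n) - u (X n) t * \<phi>' (X n))))
         \<le> exp (\<bar>\<omega>\<bar> * s2) * (\<sigma>\<^sup>2 * (\<eta> * \<bar>B\<bar> + \<eta> * \<bar>B\<bar>))"
        using 1 unfolding norm_mult norm_of_real by (intro mult_mono) (auto intro!: mult_left_mono)
    qed
    also have "\<dots> = \<eta> * (E - 1)" by (simp add: E_def algebra_simps)
    also have "\<dots> < \<epsilon>" using E \<epsilon> by (simp add: \<eta>_def field_simps add_pos_pos)
    finally show ?case by simp
  qed
qed

lemma set_integral_eq_integral:
  assumes "{p..q} \<subseteq> closure J" "t > 0"
  shows "(LINT y:{p..q}|lebesgue. u y t * \<phi> y) = integral {p..q} (\<lambda>y. u y t * \<phi> y)"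
  using assms by (intro set_lebesgue_integral_eq_integral(2) absolutely_integrable_continuous_real
      continuous_intros cont_u_space wave_solutionD(3)[OF \<phi>])

text \<open>The right end of a strip is sent to infinity: the integrals converge because \<phi> is
  bounded and the slices of u are integrable, and the flux at that end tends to 0.\<close>

lemma green_half_line:
  assumes p: "{p<..} \<subseteq> J" and b: "\<And>y. y \<in> J \<Longrightarrow> norm (\<phi> y) \<le> B" "\<And>y. y \<in> J \<Longrightarrow> norm (\<phi>' y) \<le> B"
  shows "heat_increment \<omega> s1 s2 (\<lambda>s. LINT y:{p<..}|lebesgue. u y s * \<phi> y) = - green_flux p"
proof -
  have pc: "{p..q} \<subseteq> closure J" for q
  proof -
    have "closure {p<..} \<subseteq> closure J" by (rule closure_mono[OF p])
    then show ?thesis by auto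
  qed
  have lim: "((\<lambda>q. LINT y:{p..q}|lebesgue. u y t * \<phi> y) \<longlongrightarrow> (LINT y:{p<..}|lebesgue. u y t * \<phi> y)) at_top"
    if t: "t > 0" for t
  proof -
    have int: "(\<lambda>y. u y t * \<phi> y) absolutely_integrable_on {p<..}"
    proof (rule set_integrable_bound)
      show "set_integrable lebesgue {p<..} (\<lambda>y. norm (u y t) * \<bar>B\<bar>)"
        using set_integrable_subset[OF chs_integrable(1)[OF sol, of t], of "{p<..}"] p t by (auto intro: set_integrable_norm)
      show "set_borel_measurable lebesgue {p<..} (\<lambda>y. u y t * \<phi> y)"
        unfolding set_borel_measurable_def scaleR_conv_of_real
      proof -
        have "(\<lambda>y. indicat_real {p<..} y *\<^sub>R (u y t * \<phi> y)) \<in> borel_measurable borel"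
          using p t closure_subset[of J]
          by (intro borel_measurable_continuous_on_indicator continuous_intros cont_u_space wave_solutionD(3)[OF \<phi>]) auto
        then have "(\<lambda>y. indicat_real {p<..} y *\<^sub>R (u y t * \<phi> y)) \<in> borel_measurable lebesgue"
          by (intro measurable_completion) simp
        then show "(\<lambda>y. of_real (indicat_real {p<..} y) * (u y t * \<phi> y)) \<in> borel_measurable lebesgue"
          by (simp add: scaleR_conv_of_real)
      qed
      show "AE y in lebesgue. y \<in> {p<..} \<longrightarrow> norm (u y t * \<phi> y) \<le> norm (norm (u y t) * \<bar>B\<bar>)"
        using b p by (auto simp: norm_mult abs_mult intro!: AE_I2 mult_left_mono intro: order_trans[OF _ abs_ge_self])
    qed
    \<comment> \<open>The integrals over \<open>{p..q}\<close> exhaust the closed half-line, which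
      differs from the open one by a null set.\<close>
    have int': "set_integrable lebesgue {p..} (\<lambda>y. u y t * \<phi> y)"
      using int by (rule absolutely_integrable_spike_set_eq[THEN iffD1, rotated 2])
        (auto intro: negligible_subset[OF negligible_sing[of p]])
    have "(LINT y:{p..}|lebesgue. u y t * \<phi> y) = (LINT y:{p<..}|lebesgue. u y t * \<phi> y)"
    proof (rule set_integral_cong_set)
      show "AE y in lebesgue. y \<in> {p<..} \<longleftrightarrow> y \<in> {p..}"
        using AE_completion[OF AE_lborel_singleton[of p]] by eventually_elim auto
    qed (use int int' in \<open>auto simp: set_integrable_def set_borel_measurable_def\<close>)
    then show ?thesis using tendsto_set_lebesgue_integral_at_top[OF _ int'] by simp
  qed
  have s2: "s2 > 0" using s by simp
  have "((\<lambda>q. heat_increment \<omega> s1 s2 (\<lambda>s. LINT y:{p..q}|lebesgue. u y s * \<phi> y)) \<longlongrightarrow>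
     heat_increment \<omega> s1 s2 (\<lambda>s. LINT y:{p<..}|lebesgue. u y s * \<phi> y)) at_top"
    by (intro tendsto_intros lim s2 s)
  moreover have fl: "((\<lambda>q. green_flux q - green_flux p) \<longlongrightarrow> 0 - green_flux p) at_top"
  proof (intro tendsto_diff tendsto_const, rule green_flux_tendsto_0[where B = B])
    show "filterlim (\<lambda>q::real. q) at_infinity at_top"
      using filterlim_at_top_imp_at_infinity filterlim_ident by blast
    show "\<forall>\<^sub>F n in at_top. n \<in> J"
      using eventually_gt_at_top[of p] by eventually_elim (use p in auto)
  qed (use b in auto)
  have "\<forall>\<^sub>F q in at_top. green_flux q - green_flux p =
     heat_increment \<omega> s1 s2 (\<lambda>s. LINT y:{p..q}|lebesgue. u y s * \<phi> y)"
    using eventually_gt_at_top[of p]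
  proof eventually_elim
    case (elim q)
    have "{p<..<q} \<subseteq> J" using p by auto
    from green_strip[OF elim this] show ?case
      by (simp add: set_integral_eq_integral[OF pc] s s2)
  qed
  note Lim_transform_eventually[OF fl this]
  ultimately show ?thesis
    using tendsto_unique[OF trivial_limit_at_top_linorder] by fastforce
qed

end

section \<open>Reflection\<close>

lemma has_bochner_integral_lebesgue_reflect:
  fixes f :: "real \<Rightarrow> 'a :: euclidean_space"
  shows "has_bochner_integral lebesgue (\<lambda>x. f (- x)) i \<longleftrightarrow> has_bochner_integral lebesgue f i"
  using has_bochner_integral_lebesgue_real_affine_iff[of "-1" f i 0] by simp

lemma integrable_lebesgue_reflect:
  fixes f :: "real \<Rightarrow> 'a :: euclidean_space"
  shows "integrable lebesgue (\<lambda>x. f (- x)) \<longleftrightarrow> integrable lebesgue f"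
  unfolding integrable.simps has_bochner_integral_lebesgue_reflect ..

lemma integral_lebesgue_reflect:
  fixes f :: "real \<Rightarrow> 'a :: euclidean_space"
  shows "(LINT x|lebesgue. f (- x)) = (LINT x|lebesgue. f x)"
proof (cases "integrable lebesgue f")
  case True
  then have "has_bochner_integral lebesgue (\<lambda>x. f (- x)) (LINT x|lebesgue. f x)"
    unfolding has_bochner_integral_lebesgue_reflect by (rule has_bochner_integral_integrable)
  then show ?thesis by (rule has_bochner_integral_integral_eq)
next
  case False
  then show ?thesis using integrable_lebesgue_reflect[of f] by (simp add: not_integrable_integral_eq)
qed

lemma indicator_uminus_image: "indicat_real (uminus ` J) x = indicator J (- x)"
  for x :: real by (simp add: indicator_def image_iff) (metis minus_minus)

lemma absolutely_integrable_on_reflect: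
  fixes f :: "real \<Rightarrow> 'a :: euclidean_space"
  shows "(\<lambda>x. f (- x)) absolutely_integrable_on (uminus ` J) \<longleftrightarrow> f absolutely_integrable_on J"
  unfolding set_integrable_def indicator_uminus_image by (rule integrable_lebesgue_reflect)

lemma set_integral_lebesgue_reflect:
  fixes f :: "real \<Rightarrow> 'a :: euclidean_space"
  shows "(LINT x:uminus ` J|lebesgue. f (- x)) = (LINT x:J|lebesgue. f x)"
  unfolding set_lebesgue_integral_def indicator_uminus_image by (rule integral_lebesgue_reflect)

lemma has_vector_derivative_reflect:
  fixes f :: "real \<Rightarrow> 'a :: real_normed_vector"
  assumes "(f has_vector_derivative f') (at (- x))"
  shows "((\<lambda>x. f (- x)) has_vector_derivative - f') (at x)"
proof -
  have "(uminus has_vector_derivative - 1) (at x)" for x :: real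
    by (auto intro!: derivative_eq_intros)
  from vector_diff_chain_at[OF this assms] show ?thesis by (simp add: o_def)
qed

lemma classical_heat_solution_reflect:
  assumes sol: "classical_heat_solution \<sigma> J u ux"
  shows "classical_heat_solution \<sigma> (uminus ` J) (\<lambda>x. u (- x)) (\<lambda>x t. - ux (- x) t)"
proof -
  obtain ut uxx where
    D: "\<And>x t. x \<in> J \<Longrightarrow> t > 0 \<Longrightarrow> ((\<lambda>s. u x s) has_vector_derivative ut x t) (at t)"
    "\<And>x t. x \<in> J \<Longrightarrow> t > 0 \<Longrightarrow> ((\<lambda>y. u y t) has_vector_derivative ux x t) (at x)"
    "\<And>x t. x \<in> J \<Longrightarrow> t > 0 \<Longrightarrow> ((\<lambda>y. ux y t) has_vector_derivative uxx x t) (at x)"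
    "\<And>x t. x \<in> J \<Longrightarrow> t > 0 \<Longrightarrow> ut x t = of_real (\<sigma>\<^sup>2) * uxx x t"
    and cut: "continuous_on (J \<times> {0<..}) (\<lambda>(x, t). ut x t)" "continuous_on (J \<times> {0<..}) (\<lambda>(x, t). uxx x t)"
    by (rule chs_deriv[OF sol]) blast
  have cont: "continuous_on (uminus ` S \<times> {0<..}) (\<lambda>(x, t). f (- x) t)"
    if "continuous_on (S \<times> {0<..}) (\<lambda>(x, t). f x t)" for S and f :: "real \<Rightarrow> real \<Rightarrow> complex"
    unfolding case_prod_beta'
    using that by (intro continuous_on_compose2[of _ "\<lambda>p. f (fst p) (snd p)" _ "\<lambda>p. (- fst p, snd p)", simplified] continuous_intros)
      (auto simp: case_prod_beta')
  have cl: "closure (uminus ` J) = uminus ` closure J"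
    using closure_injective_linear_image[of uminus J] by (simp add: linear_uminus)
  moreover have "interior (uminus ` J) = uminus ` interior J" by (rule interior_negations)
  ultimately have fr: "frontier (uminus ` J) = uminus ` frontier J"
    by (simp add: frontier_def image_set_diff)
  have at_inf: "filterlim uminus at_infinity (at_infinity :: real filter)"
    unfolding filterlim_at_infinity_conv_norm_at_top norm_minus_cancel by (rule filterlim_norm_at_top)
  have "filterlim uminus (inf at_infinity (principal J)) (inf at_infinity (principal (uminus ` J)))"
    unfolding filterlim_inf filterlim_principal
    by (intro conjI filterlim_mono[OF at_inf order.refl inf_le1]) (auto simp: eventually_inf_principal intro!: always_eventually)
  note lim = filterlim_compose[OF _ this]
  have chs: "\<exists>ut uxx. (\<forall>x\<in>uminus ` J. \<forall>t>0.
           ((\<lambda>s. u (- x) s) has_vector_derivative ut x t) (at t) \<and>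
           ((\<lambda>y. u (- y) t) has_vector_derivative - ux (- x) t) (at x) \<and>
           ((\<lambda>y. - ux (- y) t) has_vector_derivative uxx x t) (at x) \<and>
           ut x t = of_real (\<sigma>\<^sup>2) * uxx x t) \<and>
        continuous_on (uminus ` J \<times> {0<..}) (\<lambda>(x, t). ut x t) \<and>
        continuous_on (uminus ` J \<times> {0<..}) (\<lambda>(x, t). uxx x t)"
  proof (rule exI[of _ "\<lambda>x. ut (- x)"], rule exI[of _ "\<lambda>x. uxx (- x)"], intro conjI ballI allI impI cont cut)
    fix x t :: real assume x: "x \<in> uminus ` J" and t: "t > 0"
    have xJ: "- x \<in> J" using x by auto
    show "((\<lambda>s. u (- x) s) has_vector_derivative ut (- x) t) (at t)" by (rule D(1)[OF xJ t])
    show "((\<lambda>y. u (- y) t) has_vector_derivative - ux (- x) t) (at x)"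
      by (rule has_vector_derivative_reflect[OF D(2)[OF xJ t]])
    show "((\<lambda>y. - ux (- y) t) has_vector_derivative uxx (- x) t) (at x)"
      using has_vector_derivative_minus[OF has_vector_derivative_reflect[OF D(3)[OF xJ t]]] by simp
    show "ut (- x) t = of_real (\<sigma>\<^sup>2) * uxx (- x) t" by (rule D(4)[OF xJ t])
  qed
  have fin: "\<forall>x\<in>frontier J. \<forall>T>0. u x absolutely_integrable_on {0<..<T} \<and> ux x absolutely_integrable_on {0<..<T}"
    using sol unfolding classical_heat_solution_def by blast
  show ?thesis
    unfolding classical_heat_solution_def
  proof (intro conjI chs)
    show "continuous_on (closure (uminus ` J) \<times> {0<..}) (\<lambda>(x, t). u (- x) t)"
      unfolding cl by (rule cont[OF chs_cont(1)[OF sol]])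
    show "continuous_on (closure (uminus ` J) \<times> {0<..}) (\<lambda>(x, t). - ux (- x) t)"
      using continuous_on_minus[OF cont[OF chs_cont(2)[OF sol]]] unfolding cl by (simp add: case_prod_beta')
    show "\<forall>x\<in>frontier (uminus ` J). \<forall>T>0. u (- x) absolutely_integrable_on {0<..<T} \<and>
        (\<lambda>t. - ux (- x) t) absolutely_integrable_on {0<..<T}"
      unfolding fr using fin by (auto simp: set_integrable_def)
    show "\<forall>t\<ge>0. (\<lambda>x. u (- x) t) absolutely_integrable_on uminus ` J"
      using chs_integrable(1)[OF sol] absolutely_integrable_on_reflect[of J "\<lambda>x. u x _"] by blast
    show "\<forall>t0\<ge>0. ((\<lambda>t. LINT x:uminus ` J|lebesgue. norm (u (- x) t - u (- x) t0)) \<longlongrightarrow> 0) (at t0 within {0..})"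
      using chs_integrable(2)[OF sol] by (simp add: set_integral_lebesgue_reflect[of J "\<lambda>x. norm (u x _ - u x _)"])
    show "\<forall>K. compact K \<and> K \<subseteq> {0<..} \<longrightarrow>
       uniform_limit K (\<lambda>x. u (- x)) (\<lambda>_. 0) (inf at_infinity (principal (uminus ` J))) \<and>
       uniform_limit K (\<lambda>x t. - ux (- x) t) (\<lambda>_. 0) (inf at_infinity (principal (uminus ` J)))"
    proof (intro allI impI conjI; elim conjE)
      fix K :: "real set" assume K: "compact K" "K \<subseteq> {0<..}"
      show "uniform_limit K (\<lambda>x. u (- x)) (\<lambda>_. 0) (inf at_infinity (principal (uminus ` J)))"
        by (rule lim[OF chs_uniform(1)[OF sol K]])
      show "uniform_limit K (\<lambda>x t. - ux (- x) t) (\<lambda>_. 0) (inf at_infinity (principal (uminus ` J)))"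
        using uniform_limit_uminus[OF lim[OF chs_uniform(2)[OF sol K]]] by simp
    qed
  qed
qed

lemma wave_solution_reflect:
  assumes "wave_solution c \<phi> \<phi>'"
  shows "wave_solution c (\<lambda>y. \<phi> (- y)) (\<lambda>y. - \<phi>' (- y))"
proof -
  have "((\<lambda>y. - \<phi>' (- y)) has_vector_derivative - of_real c * \<phi> (- y)) (at y)" for y
    using has_vector_derivative_minus[OF has_vector_derivative_reflect[OF wave_solutionD(2)[OF assms]]] by simp
  then show ?thesis
    unfolding wave_solution_def using has_vector_derivative_reflect[OF wave_solutionD(1)[OF assms]] by blast
qed

text \<open>Reflection negates both space derivatives and hence the whole flux; this cancels the
  sign in \<open>green_half_line\<close>.\<close>

lemma green_half_line_left:
  assumes sol: "classical_heat_solution \<sigma> {..<p} u ux"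
    and s: "0 < s1" "s1 \<le> s2" and \<phi>: "wave_solution c \<phi> \<phi>'" and \<omega>: "\<omega> = \<sigma>\<^sup>2 * c"
    and b: "\<And>y. y < p \<Longrightarrow> norm (\<phi> y) \<le> B" "\<And>y. y < p \<Longrightarrow> norm (\<phi>' y) \<le> B"
  shows "heat_increment \<omega> s1 s2 (\<lambda>s. LINT y:{..<p}|lebesgue. u y s * \<phi> y) = green_flux \<sigma> \<omega> s1 s2 u ux \<phi> \<phi>' p"
proof -
  have im: "uminus ` {..<p} = {- p<..}" by simp
  have "heat_increment \<omega> s1 s2 (\<lambda>s. LINT y:{- p<..}|lebesgue. u (- y) s * \<phi> (- y))
    = - green_flux \<sigma> \<omega> s1 s2 (\<lambda>y. u (- y)) (\<lambda>y s. - ux (- y) s) (\<lambda>y. \<phi> (- y)) (\<lambda>y. - \<phi>' (- y)) (- p)"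
    using classical_heat_solution_reflect[OF sol] s wave_solution_reflect[OF \<phi>] \<omega>
    unfolding im by (rule green_half_line[where B = B]) (use b in auto)
  also have "\<dots> = green_flux \<sigma> \<omega> s1 s2 u ux \<phi> \<phi>' p"
    unfolding green_flux_def[OF sol s \<phi> \<omega>] green_flux_def[OF classical_heat_solution_reflect[OF sol] s wave_solution_reflect[OF \<phi>] \<omega>]
    by (simp flip: integral_neg add: algebra_simps)
  finally show ?thesis
    using set_integral_lebesgue_reflect[of "{..<p}" "\<lambda>y. u y _ * \<phi> y"] unfolding im by simp
qed

section \<open>The three-layer problem\<close>

lemma absolutely_integrable_mult_bounded:
  fixes f g :: "real \<Rightarrow> complex"
  assumes f: "f absolutely_integrable_on S" and g: "continuous_on UNIV g" and b: "\<And>y. y \<in> S \<Longrightarrow> norm (g y) \<le> B"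
  shows "(\<lambda>y. f y * g y) absolutely_integrable_on S"
  unfolding set_integrable_def
proof (rule Bochner_Integration.integrable_bound)
  let ?f = "\<lambda>y. indicat_real S y *\<^sub>R f y"
  have i: "integrable lebesgue ?f" using f by (simp add: set_integrable_def)
  show "integrable lebesgue (\<lambda>y. norm (?f y) * \<bar>B\<bar>)" using integrable_norm[OF i] by (rule integrable_mult_left)
  have "g \<in> borel_measurable lebesgue"
    using borel_measurable_continuous_onI[OF g] by (intro measurable_completion) simp
  then have "(\<lambda>y. ?f y * g y) \<in> borel_measurable lebesgue"
    using borel_measurable_integrable[OF i] by measurable
  then show "(\<lambda>y. indicat_real S y *\<^sub>R (f y * g y)) \<in> borel_measurable lebesgue" by simp
  show "AE y in lebesgue. norm (indicat_real S y *\<^sub>R (f y * g y)) \<le> norm (norm (?f y) * \<bar>B\<bar>)"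
  proof (intro AE_I2)
    fix y show "norm (indicat_real S y *\<^sub>R (f y * g y)) \<le> norm (norm (?f y) * \<bar>B\<bar>)"
      using b[of y] by (cases "y \<in> S") (auto simp: norm_mult abs_mult intro!: mult_left_mono)
  qed
qed

text \<open>The break points and the overlap of the closed intervals are null sets. Closed intervals
  suit the strips, to whose ends the solution extends continuously.\<close>

lemma lebesgue_integral_split4:
  fixes f :: "real \<Rightarrow> complex"
  assumes "p \<le> q" "q \<le> r" and m: "f \<in> borel_measurable lebesgue"
    and i: "set_integrable lebesgue {..<p} f1" "set_integrable lebesgue {p..q} f2"
      "set_integrable lebesgue {q..r} f3" "set_integrable lebesgue {r<..} f4"
    and f: "\<And>y. y < p \<Longrightarrow> f y = f1 y" "\<And>y. p < y \<Longrightarrow> y < q \<Longrightarrow> f y = f2 y"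
      "\<And>y. q < y \<Longrightarrow> y < r \<Longrightarrow> f y = f3 y" "\<And>y. r < y \<Longrightarrow> f y = f4 y"
  shows "(LINT y|lebesgue. f y) = (LINT y:{..<p}|lebesgue. f1 y) + (LINT y:{p..q}|lebesgue. f2 y)
     + (LINT y:{q..r}|lebesgue. f3 y) + (LINT y:{r<..}|lebesgue. f4 y)"
proof -
  let ?g = "\<lambda>y. indicat_real {..<p} y *\<^sub>R f1 y + indicat_real {p..q} y *\<^sub>R f2 y
     + indicat_real {q..r} y *\<^sub>R f3 y + indicat_real {r<..} y *\<^sub>R f4 y"
  note ii = i[unfolded set_integrable_def]
  have g: "integrable lebesgue ?g" using ii by (intro Bochner_Integration.integrable_add)
  have ne: "AE y in lebesgue. y \<noteq> z" for z :: real
    by (rule AE_completion[OF AE_lborel_singleton])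
  have "AE y in lebesgue. f y = ?g y"
    using ne[of p] ne[of q] ne[of r]
  proof eventually_elim
    case (elim y)
    then consider "y < p" | "p < y" "y < q" | "q < y" "y < r" | "r < y" by linarith
    then show ?case using assms(1,2) f by cases auto
  qed
  then have "(LINT y|lebesgue. f y) = (LINT y|lebesgue. ?g y)"
    using m borel_measurable_integrable[OF g] by (intro integral_cong_AE)
  also have "\<dots> = (LINT y:{..<p}|lebesgue. f1 y) + (LINT y:{p..q}|lebesgue. f2 y)
     + (LINT y:{q..r}|lebesgue. f3 y) + (LINT y:{r<..}|lebesgue. f4 y)"
    unfolding set_lebesgue_integral_def
    using ii by (simp only: Bochner_Integration.integral_add Bochner_Integration.integrable_add)
  finally show ?thesis .
qed

lemma isCont_classical_heat_solution:
  assumes sol: "classical_heat_solution \<sigma> J u ux" and "open J" "x \<in> J" "t > 0"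
    and U: "\<And>y s. y \<in> J \<Longrightarrow> U y s = u y s"
  shows "isCont (\<lambda>(y, s). U y s) (x, t)"
proof -
  have o: "open (J \<times> {0::real<..})" using assms by (intro open_Times) auto
  have "continuous_on (J \<times> {0<..}) (\<lambda>(y, s). u y s)"
    using closure_subset[of J] by (intro continuous_on_subset[OF chs_cont(1)[OF sol]]) auto
  then have "continuous_on (J \<times> {0<..}) (\<lambda>(y, s). U y s)"
    by (rule continuous_on_eq) (auto simp: U)
  then show ?thesis using o assms by (simp add: continuous_on_eq_continuous_at)
qed

text \<open>Regroups the flux differences by break point, so that each bracket compares the two
  one-sided fluxes there.\<close>

lemma telescope4:
  fixes A1 :: complex
  assumes "A1 - A2 = fl" "B1 - B2 = g2 - g1" "C1 - C2 = h2 - h1" "D1 - D2 = - k"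
  shows "A1 + B1 + C1 + D1 - (A2 + B2 + C2 + D2) = (fl - g1) + (g2 - h1) + (h2 - k)"
proof -
  have "A1 + B1 + C1 + D1 - (A2 + B2 + C2 + D2) = (A1 - A2) + (B1 - B2) + (C1 - C2) + (D1 - D2)"
    by simp
  also have "\<dots> = (fl - g1) + (g2 - h1) + (h2 - k)" unfolding assms by simp
  finally show ?thesis .
qed

text \<open>The break points are the two interfaces and the pole of the Green function. Neighbouring
  pieces may lie in the same layer, so one statement serves a pole in the middle and a pole on the
  right.\<close>

lemma green_identity_pieces:
  fixes V :: "real \<Rightarrow> real \<Rightarrow> complex"
  assumes s: "0 < s1" "s1 \<le> s2" and pqr: "p < q" "q < r"
    and sol: "classical_heat_solution \<sigma>1 {..<p} u1 v1" "classical_heat_solution \<sigma>2 J2 u2 v2"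
      "classical_heat_solution \<sigma>3 J3 u3 v3" "classical_heat_solution \<sigma>4 J4 u4 v4"
    and J: "{p<..<q} \<subseteq> J2" "{q<..<r} \<subseteq> J3" "{r<..} \<subseteq> J4"
    and w: "wave_solution c1 \<phi>1 \<phi>1'" "wave_solution c2 \<phi>2 \<phi>2'" "wave_solution c3 \<phi>3 \<phi>3'" "wave_solution c4 \<phi>4 \<phi>4'"
    and \<omega>: "\<omega> = \<sigma>1\<^sup>2 * c1" "\<omega> = \<sigma>2\<^sup>2 * c2" "\<omega> = \<sigma>3\<^sup>2 * c3" "\<omega> = \<sigma>4\<^sup>2 * c4"
    and b: "\<And>y. norm (\<phi>1 y) \<le> B" "\<And>y. norm (\<phi>1' y) \<le> B" "\<And>y. norm (\<phi>4 y) \<le> B" "\<And>y. norm (\<phi>4' y) \<le> B"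
    and V: "\<And>y s. y < p \<Longrightarrow> V y s * \<phi> y = u1 y s * \<phi>1 y" "\<And>y s. p < y \<Longrightarrow> y < q \<Longrightarrow> V y s * \<phi> y = u2 y s * \<phi>2 y"
      "\<And>y s. q < y \<Longrightarrow> y < r \<Longrightarrow> V y s * \<phi> y = u3 y s * \<phi>3 y" "\<And>y s. r < y \<Longrightarrow> V y s * \<phi> y = u4 y s * \<phi>4 y"
    and m: "\<And>s. s > 0 \<Longrightarrow> (\<lambda>y. V y s * \<phi> y) \<in> borel_measurable borel"
  shows "heat_increment \<omega> s1 s2 (\<lambda>s. LINT y|lebesgue. V y s * \<phi> y)
    = (green_flux \<sigma>1 \<omega> s1 s2 u1 v1 \<phi>1 \<phi>1' p - green_flux \<sigma>2 \<omega> s1 s2 u2 v2 \<phi>2 \<phi>2' p)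
    + (green_flux \<sigma>2 \<omega> s1 s2 u2 v2 \<phi>2 \<phi>2' q - green_flux \<sigma>3 \<omega> s1 s2 u3 v3 \<phi>3 \<phi>3' q)
    + (green_flux \<sigma>3 \<omega> s1 s2 u3 v3 \<phi>3 \<phi>3' r - green_flux \<sigma>4 \<omega> s1 s2 u4 v4 \<phi>4 \<phi>4' r)"
proof -
  have s2: "s2 > 0" using s by simp
  have c: "{p..q} \<subseteq> closure J2" "{q..r} \<subseteq> closure J3"
    using closure_mono[OF J(1)] closure_mono[OF J(2)] pqr by auto
  have split: "(LINT y|lebesgue. V y t * \<phi> y) = (LINT y:{..<p}|lebesgue. u1 y t * \<phi>1 y)
     + integral {p..q} (\<lambda>y. u2 y t * \<phi>2 y) + integral {q..r} (\<lambda>y. u3 y t * \<phi>3 y)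
     + (LINT y:{r<..}|lebesgue. u4 y t * \<phi>4 y)" if t: "t > 0" for t
    unfolding set_integral_eq_integral[OF sol(2) s w(2) \<omega>(2) c(1) t, symmetric]
      set_integral_eq_integral[OF sol(3) s w(3) \<omega>(3) c(2) t, symmetric]
  proof (rule lebesgue_integral_split4)
    show "(\<lambda>y. V y t * \<phi> y) \<in> borel_measurable lebesgue"
      using m[OF t] by (intro measurable_completion) simp
    show "set_integrable lebesgue {..<p} (\<lambda>y. u1 y t * \<phi>1 y)"
      using t by (intro absolutely_integrable_mult_bounded[OF _ _ b(1)] chs_integrable(1)[OF sol(1)] wave_solutionD(3)[OF w(1)]) auto
    show "set_integrable lebesgue {p..q} (\<lambda>y. u2 y t * \<phi>2 y)"
      by (intro absolutely_integrable_continuous_real continuous_intros cont_u_space(1)[OF sol(2) s w(2) \<omega>(2)] c t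
          wave_solutionD(3)[OF w(2)])
    show "set_integrable lebesgue {q..r} (\<lambda>y. u3 y t * \<phi>3 y)"
      by (intro absolutely_integrable_continuous_real continuous_intros cont_u_space(1)[OF sol(3) s w(3) \<omega>(3)] c t
          wave_solutionD(3)[OF w(3)])
    show "set_integrable lebesgue {r<..} (\<lambda>y. u4 y t * \<phi>4 y)"
      using t J(3) by (intro absolutely_integrable_mult_bounded[OF _ _ b(3)]
          set_integrable_subset[OF chs_integrable(1)[OF sol(4)]] wave_solutionD(3)[OF w(4)]) auto
  qed (use pqr V in auto)
  note t = green_half_line_left[OF sol(1) s w(1) \<omega>(1) b(1,2)] green_strip[OF sol(2) s w(2) \<omega>(2) pqr(1) J(1)]
    green_strip[OF sol(3) s w(3) \<omega>(3) pqr(2) J(2)] green_half_line[OF sol(4) s w(4) \<omega>(4) J(3) b(3,4)]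
  show ?thesis
    unfolding split[OF s(1)] split[OF s2] distrib_left by (rule telescope4[OF t])
qed

section \<open>The glued solution and its transmission conditions\<close>

locale three_layer =
  fixes a \<sigma>L \<sigma>M \<sigma>R :: real and uL uM uR uLx uMx uRx :: "real \<Rightarrow> real \<Rightarrow> complex"
  assumes pos: "a > 0" "\<sigma>L > 0" "\<sigma>M > 0" "\<sigma>R > 0"
    and solL: "classical_heat_solution \<sigma>L {..<-a} uL uLx"
    and solM: "classical_heat_solution \<sigma>M {-a<..<a} uM uMx"
    and solR: "classical_heat_solution \<sigma>R {a<..} uR uRx"
    and contLM: "\<And>t. t > 0 \<Longrightarrow> uL (-a) t = uM (-a) t"
    and contMR: "\<And>t. t > 0 \<Longrightarrow> uM a t = uR a t"
    and fluxLM: "\<And>t. t > 0 \<Longrightarrow> of_real (\<sigma>L\<^sup>2) * uLx (-a) t = of_real (\<sigma>M\<^sup>2) * uMx (-a) t"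
    and fluxMR: "\<And>t. t > 0 \<Longrightarrow> of_real (\<sigma>M\<^sup>2) * uMx a t = of_real (\<sigma>R\<^sup>2) * uRx a t"
begin

text \<open>The value 0 on the interfaces, a null set, makes \<open>U\<close> the sum of the three
  layer functions cut off by indicators of open sets.\<close>

definition U :: "real \<Rightarrow> real \<Rightarrow> complex" where
  "U y s = (if y < -a then uL y s else if -a < y \<and> y < a then uM y s else if a < y then uR y s else 0)"

lemma U_indicator:
  "U y s = indicat_real {..<-a} y *\<^sub>R uL y s + indicat_real {-a<..<a} y *\<^sub>R uM y s + indicat_real {a<..} y *\<^sub>R uR y s"
  using pos by (auto simp: U_def)

lemma integrable_U:
  assumes "s \<ge> 0"
  shows "integrable lebesgue (\<lambda>y. U y s)"
  unfolding U_indicator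
  using chs_integrable(1)[OF solL assms] chs_integrable(1)[OF solM assms] chs_integrable(1)[OF solR assms]
  by (intro Bochner_Integration.integrable_add) (auto simp: set_integrable_def)

lemma borel_measurable_U:
  assumes "s > 0"
  shows "(\<lambda>y. U y s) \<in> borel_measurable borel"
proof -
  have c: "(\<lambda>y. indicat_real J y *\<^sub>R u y s) \<in> borel_measurable borel"
    if "classical_heat_solution \<sigma> J u ux" "open J" for \<sigma> J u ux
    using that assms closure_subset[of J]
    by (intro borel_measurable_continuous_on_indicator continuous_on_compose2[OF chs_cont(1)[OF that(1)], of _ "\<lambda>y. (y, s)", simplified] continuous_intros) auto
  show ?thesis
    unfolding U_indicator by (intro borel_measurable_add c[OF solL] c[OF solM] c[OF solR]) auto
qed

lemma U_L1:
  assumes "s0 \<ge> 0"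
  shows "((\<lambda>s. LINT y|lebesgue. norm (U y s - U y s0)) \<longlongrightarrow> 0) (at s0 within {0..})"
proof -
  have i: "integrable lebesgue (\<lambda>y. indicat_real J y *\<^sub>R norm (u y s - u y s0))"
    if "classical_heat_solution \<sigma> J u ux" "s \<ge> 0" for \<sigma> J u ux s
    using set_integrable_norm[OF set_integral_diff(1)[OF chs_integrable(1)[OF that] chs_integrable(1)[OF that(1) assms]]]
    by (simp add: set_integrable_def)
  have eq: "(LINT y|lebesgue. norm (U y s - U y s0)) = (LINT y:{..<-a}|lebesgue. norm (uL y s - uL y s0))
     + (LINT y:{-a<..<a}|lebesgue. norm (uM y s - uM y s0)) + (LINT y:{a<..}|lebesgue. norm (uR y s - uR y s0))"
    if "s \<ge> 0" for s
  proof -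
    have "norm (U y s - U y s0) = indicat_real {..<-a} y *\<^sub>R norm (uL y s - uL y s0)
       + indicat_real {-a<..<a} y *\<^sub>R norm (uM y s - uM y s0) + indicat_real {a<..} y *\<^sub>R norm (uR y s - uR y s0)" for y
      using pos by (auto simp: U_def)
    then show ?thesis
      using i[OF solL that] i[OF solM that] i[OF solR that] unfolding set_lebesgue_integral_def
      by (simp only: Bochner_Integration.integral_add Bochner_Integration.integrable_add)
  qed
  have "((\<lambda>s. (LINT y:{..<-a}|lebesgue. norm (uL y s - uL y s0))
     + (LINT y:{-a<..<a}|lebesgue. norm (uM y s - uM y s0)) + (LINT y:{a<..}|lebesgue. norm (uR y s - uR y s0)))
     \<longlongrightarrow> 0 + 0 + 0) (at s0 within {0..})"
    by (intro tendsto_add chs_integrable(2)[OF solL] chs_integrable(2)[OF solM] chs_integrable(2)[OF solR] assms)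
  moreover have "\<forall>\<^sub>F s in at s0 within {0..}. s \<ge> 0"
    by (auto simp: eventually_at_filter)
  then have "\<forall>\<^sub>F s in at s0 within {0..}. (LINT y:{..<-a}|lebesgue. norm (uL y s - uL y s0))
     + (LINT y:{-a<..<a}|lebesgue. norm (uM y s - uM y s0)) + (LINT y:{a<..}|lebesgue. norm (uR y s - uR y s0))
     = (LINT y|lebesgue. norm (U y s - U y s0))"
    by eventually_elim (simp add: eq)
  ultimately show ?thesis
    using Lim_transform_eventually by fastforce
qed

lemma mirror: "three_layer a \<sigma>R \<sigma>M \<sigma>L (\<lambda>x. uR (- x)) (\<lambda>x. uM (- x)) (\<lambda>x. uL (- x))
    (\<lambda>x t. - uRx (- x) t) (\<lambda>x t. - uMx (- x) t) (\<lambda>x t. - uLx (- x) t)"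
proof
  show "classical_heat_solution \<sigma>R {..<- a} (\<lambda>x. uR (- x)) (\<lambda>x t. - uRx (- x) t)"
    using classical_heat_solution_reflect[OF solR] by simp
  show "classical_heat_solution \<sigma>M {- a<..<a} (\<lambda>x. uM (- x)) (\<lambda>x t. - uMx (- x) t)"
    using classical_heat_solution_reflect[OF solM] by simp
  show "classical_heat_solution \<sigma>L {a<..} (\<lambda>x. uL (- x)) (\<lambda>x t. - uLx (- x) t)"
    using classical_heat_solution_reflect[OF solL] by simp
qed (use pos contLM contMR fluxLM fluxMR in auto)

lemma closures: "- a \<in> closure {..<-a}" "- a \<in> closure {-a<..<a}" "a \<in> closure {-a<..<a}" "a \<in> closure {a<..}"
  using pos by auto

context
  fixes s1 s2 \<omega> :: real
  assumes s: "0 < s1" "s1 \<le> s2"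
begin

text \<open>The flux is bilinear in the pairs (u, \<sigma>^2 u_x) and (\<phi>, \<sigma>^2 \<phi>').
  Both pairs are continuous across the interface, hence so is the flux.\<close>

lemma green_flux_interface_left:
  assumes "wave_solution c \<phi> \<phi>'" "\<omega> = \<sigma>L\<^sup>2 * c" "wave_solution c' \<psi> \<psi>'" "\<omega> = \<sigma>M\<^sup>2 * c'"
    and m: "\<phi> (-a) = \<psi> (-a)" "of_real (\<sigma>L\<^sup>2) * \<phi>' (-a) = of_real (\<sigma>M\<^sup>2) * \<psi>' (-a)"
  shows "green_flux \<sigma>L \<omega> s1 s2 uL uLx \<phi> \<phi>' (-a) = green_flux \<sigma>M \<omega> s1 s2 uM uMx \<psi> \<psi>' (-a)"
proof -
  have "integral {s1..s2} (\<lambda>s. exp (of_real (\<omega> * s)) * (of_real (\<sigma>L\<^sup>2) * uLx (-a) s))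
     = integral {s1..s2} (\<lambda>s. exp (of_real (\<omega> * s)) * (of_real (\<sigma>M\<^sup>2) * uMx (-a) s))"
    by (intro integral_cong arg_cong2[where f = "(*)"] refl fluxLM) (use s in auto)
  moreover have "integral {s1..s2} (\<lambda>s. exp (of_real (\<omega> * s)) * uL (-a) s)
     = integral {s1..s2} (\<lambda>s. exp (of_real (\<omega> * s)) * uM (-a) s)"
    using s by (intro integral_cong) (simp add: contLM)
  ultimately show ?thesis
    unfolding green_flux_eq[OF solL s assms(1,2) closures(1)] green_flux_eq[OF solM s assms(3,4) closures(2)]
    by (simp only: m)
qed

lemma green_flux_interface_right:
  assumes "wave_solution c \<phi> \<phi>'" "\<omega> = \<sigma>M\<^sup>2 * c" "wave_solution c' \<psi> \<psi>'" "\<omega> = \<sigma>R\<^sup>2 * c'"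
    and m: "\<phi> a = \<psi> a" "of_real (\<sigma>M\<^sup>2) * \<phi>' a = of_real (\<sigma>R\<^sup>2) * \<psi>' a"
  shows "green_flux \<sigma>M \<omega> s1 s2 uM uMx \<phi> \<phi>' a = green_flux \<sigma>R \<omega> s1 s2 uR uRx \<psi> \<psi>' a"
proof -
  have "integral {s1..s2} (\<lambda>s. exp (of_real (\<omega> * s)) * (of_real (\<sigma>M\<^sup>2) * uMx a s))
     = integral {s1..s2} (\<lambda>s. exp (of_real (\<omega> * s)) * (of_real (\<sigma>R\<^sup>2) * uRx a s))"
    by (intro integral_cong arg_cong2[where f = "(*)"] refl fluxMR) (use s in auto)
  moreover have "integral {s1..s2} (\<lambda>s. exp (of_real (\<omega> * s)) * uM a s)
     = integral {s1..s2} (\<lambda>s. exp (of_real (\<omega> * s)) * uR a s)"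
    using s by (intro integral_cong) (simp add: contMR)
  ultimately show ?thesis
    unfolding green_flux_eq[OF solM s assms(1,2) closures(3)] green_flux_eq[OF solR s assms(3,4) closures(4)]
    by (simp only: m)
qed

text \<open>Both interface brackets vanish. At the pole x the test function is continuous, so the
  terms with u_x cancel and only the jump of its derivative, multiplied by u, is left.\<close>

lemma green_identity_right:
  assumes x: "x > a"
    and w: "wave_solution cL \<phi>L \<phi>L'" "wave_solution cM \<phi>M \<phi>M'" "wave_solution cR \<phi>1 \<phi>1'" "wave_solution cR \<phi>2 \<phi>2'"
    and \<omega>: "\<omega> = \<sigma>L\<^sup>2 * cL" "\<omega> = \<sigma>M\<^sup>2 * cM" "\<omega> = \<sigma>R\<^sup>2 * cR"
    and b: "\<And>y. norm (\<phi>L y) \<le> B" "\<And>y. norm (\<phi>L' y) \<le> B" "\<And>y. norm (\<phi>2 y) \<le> B" "\<And>y. norm (\<phi>2' y) \<le> B"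
    and mL: "\<phi>L (-a) = \<phi>M (-a)" "of_real (\<sigma>L\<^sup>2) * \<phi>L' (-a) = of_real (\<sigma>M\<^sup>2) * \<phi>M' (-a)"
    and mR: "\<phi>M a = \<phi>1 a" "of_real (\<sigma>M\<^sup>2) * \<phi>M' a = of_real (\<sigma>R\<^sup>2) * \<phi>1' a"
    and mx: "\<phi>1 x = \<phi>2 x"
    and \<phi>: "\<And>y. y < -a \<Longrightarrow> \<phi> y = \<phi>L y" "\<And>y. -a < y \<Longrightarrow> y < a \<Longrightarrow> \<phi> y = \<phi>M y"
      "\<And>y. a < y \<Longrightarrow> y < x \<Longrightarrow> \<phi> y = \<phi>1 y" "\<And>y. x < y \<Longrightarrow> \<phi> y = \<phi>2 y"
    and \<phi>m: "\<phi> \<in> borel_measurable borel"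
  shows "heat_increment \<omega> s1 s2 (\<lambda>s. LINT y|lebesgue. U y s * \<phi> y)
     = of_real (\<sigma>R\<^sup>2) * (\<phi>2' x - \<phi>1' x) * integral {s1..s2} (\<lambda>s. exp (of_real (\<omega> * s)) * uR x s)"
proof -
  have c: "x \<in> closure {a<..}" using x by simp
  have "heat_increment \<omega> s1 s2 (\<lambda>s. LINT y|lebesgue. U y s * \<phi> y)
    = (green_flux \<sigma>L \<omega> s1 s2 uL uLx \<phi>L \<phi>L' (-a) - green_flux \<sigma>M \<omega> s1 s2 uM uMx \<phi>M \<phi>M' (-a))
    + (green_flux \<sigma>M \<omega> s1 s2 uM uMx \<phi>M \<phi>M' a - green_flux \<sigma>R \<omega> s1 s2 uR uRx \<phi>1 \<phi>1' a)
    + (green_flux \<sigma>R \<omega> s1 s2 uR uRx \<phi>1 \<phi>1' x - green_flux \<sigma>R \<omega> s1 s2 uR uRx \<phi>2 \<phi>2' x)"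
    using borel_measurable_U \<phi>m pos x \<phi>
    by (intro green_identity_pieces[OF s _ _ solL solM solR solR _ _ _ w \<omega> \<omega>(3) b]) (auto simp: U_def)
  also have "\<dots> = of_real (\<sigma>R\<^sup>2) * (\<phi>2' x - \<phi>1' x) * integral {s1..s2} (\<lambda>s. exp (of_real (\<omega> * s)) * uR x s)"
    unfolding green_flux_interface_left[OF w(1) \<omega>(1) w(2) \<omega>(2) mL] green_flux_interface_right[OF w(2) \<omega>(2) w(3) \<omega>(3) mR]
      green_flux_eq[OF solR s w(3) \<omega>(3) c] green_flux_eq[OF solR s w(4) \<omega>(3) c] mx
    by (simp only: right_diff_distrib left_diff_distrib) simp
  finally show ?thesis .
qed

lemma green_identity_middle:
  assumes x: "-a < x" "x < a"
    and w: "wave_solution cL \<phi>L \<phi>L'" "wave_solution cM \<phi>1 \<phi>1'" "wave_solution cM \<phi>2 \<phi>2'" "wave_solution cR \<phi>R \<phi>R'"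
    and \<omega>: "\<omega> = \<sigma>L\<^sup>2 * cL" "\<omega> = \<sigma>M\<^sup>2 * cM" "\<omega> = \<sigma>R\<^sup>2 * cR"
    and b: "\<And>y. norm (\<phi>L y) \<le> B" "\<And>y. norm (\<phi>L' y) \<le> B" "\<And>y. norm (\<phi>R y) \<le> B" "\<And>y. norm (\<phi>R' y) \<le> B"
    and mL: "\<phi>L (-a) = \<phi>1 (-a)" "of_real (\<sigma>L\<^sup>2) * \<phi>L' (-a) = of_real (\<sigma>M\<^sup>2) * \<phi>1' (-a)"
    and mR: "\<phi>2 a = \<phi>R a" "of_real (\<sigma>M\<^sup>2) * \<phi>2' a = of_real (\<sigma>R\<^sup>2) * \<phi>R' a"
    and mx: "\<phi>1 x = \<phi>2 x"
    and \<phi>: "\<And>y. y < -a \<Longrightarrow> \<phi> y = \<phi>L y" "\<And>y. -a < y \<Longrightarrow> y < x \<Longrightarrow> \<phi> y = \<phi>1 y"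
      "\<And>y. x < y \<Longrightarrow> y < a \<Longrightarrow> \<phi> y = \<phi>2 y" "\<And>y. a < y \<Longrightarrow> \<phi> y = \<phi>R y"
    and \<phi>m: "\<phi> \<in> borel_measurable borel"
  shows "heat_increment \<omega> s1 s2 (\<lambda>s. LINT y|lebesgue. U y s * \<phi> y)
     = of_real (\<sigma>M\<^sup>2) * (\<phi>2' x - \<phi>1' x) * integral {s1..s2} (\<lambda>s. exp (of_real (\<omega> * s)) * uM x s)"
proof -
  have c: "x \<in> closure {-a<..<a}" using x by simp
  have "heat_increment \<omega> s1 s2 (\<lambda>s. LINT y|lebesgue. U y s * \<phi> y)
    = (green_flux \<sigma>L \<omega> s1 s2 uL uLx \<phi>L \<phi>L' (-a) - green_flux \<sigma>M \<omega> s1 s2 uM uMx \<phi>1 \<phi>1' (-a))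
    + (green_flux \<sigma>M \<omega> s1 s2 uM uMx \<phi>1 \<phi>1' x - green_flux \<sigma>M \<omega> s1 s2 uM uMx \<phi>2 \<phi>2' x)
    + (green_flux \<sigma>M \<omega> s1 s2 uM uMx \<phi>2 \<phi>2' a - green_flux \<sigma>R \<omega> s1 s2 uR uRx \<phi>R \<phi>R' a)"
    using borel_measurable_U \<phi>m pos x \<phi>
    by (intro green_identity_pieces[OF s _ _ solL solM solM solR _ _ _ w \<omega>(1,2) \<omega>(2,3) b]) (auto simp: U_def)
  also have "\<dots> = of_real (\<sigma>M\<^sup>2) * (\<phi>2' x - \<phi>1' x) * integral {s1..s2} (\<lambda>s. exp (of_real (\<omega> * s)) * uM x s)"
    unfolding green_flux_interface_left[OF w(1) \<omega>(1) w(2) \<omega>(2) mL] green_flux_interface_right[OF w(3) \<omega>(2) w(4) \<omega>(3) mR]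
      green_flux_eq[OF solM s w(2) \<omega>(2) c] green_flux_eq[OF solM s w(3) \<omega>(2) c] mx
    by (simp only: right_diff_distrib left_diff_distrib) simp
  finally show ?thesis .
qed

end

end

section \<open>The Green functions\<close>

definition osc :: "complex \<Rightarrow> real \<Rightarrow> complex" where
  "osc k z = exp (\<i> * k * of_real z)"

lemma osc_add: "osc k (z + w) = osc k z * osc k w"
  by (simp add: osc_def distrib_left exp_add)

lemma uhp_decay_osc: "uhp_decay (\<lambda>k. osc k z) 1 z"
  unfolding osc_def by (rule uhp_decay_exp)

lemma norm_osc_real [simp]: "norm (osc (of_real k) z) = 1"
  by (simp add: osc_def)

lemma uhp_decay_diff:
  assumes "uhp_decay f C d" "uhp_decay g C' d'"
  shows "uhp_decay (\<lambda>k. f k - g k) (C + C') (min d d')"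
proof -
  have "uhp_decay (\<lambda>k. - 1 * g k) (norm (- 1 :: complex) * C') (0 + d')"
    by (intro uhp_decay_mult uhp_decay_const assms)
  from uhp_decay_add[OF assms(1) this] show ?thesis by simp
qed

text \<open>A nonnegative phase gives |\<open>osc k z\<close>| \<le> 1 on the closed upper
  half-plane, so the denominator has modulus at least 1 - |c|.\<close>

lemma uhp_decay_resolvent:
  assumes c: "\<bar>c\<bar> < 1" and z: "z \<ge> 0"
  shows "uhp_decay (\<lambda>k. 1 / (1 - of_real c * osc k z)) (1 / (1 - \<bar>c\<bar>)) 0"
    and "0 \<le> Im k \<Longrightarrow> 1 - of_real c * osc k z \<noteq> 0"
proof -
  have b: "1 - \<bar>c\<bar> \<le> norm (1 - of_real c * osc k z)" if "0 \<le> Im k" for k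
  proof -
    have "norm (osc k z) \<le> 1" using that z by (simp add: osc_def)
    then have "norm (of_real c * osc k z) \<le> \<bar>c\<bar>" by (simp add: norm_mult mult_left_le)
    then show ?thesis using norm_triangle_ineq2[of 1 "of_real c * osc k z"] by simp
  qed
  then show nz: "1 - of_real c * osc k z \<noteq> 0" if "0 \<le> Im k" for k
    using c that by (metis diff_gt_0_iff_gt norm_zero not_le)
  have "norm (1 / (1 - of_real c * osc k z)) \<le> 1 / (1 - \<bar>c\<bar>) * exp (- (0 * Im k))" if "0 \<le> Im k" for k
    using b[OF that] c by (simp add: norm_divide frac_le)
  moreover have "continuous_on {k. 0 \<le> Im k} (\<lambda>k. 1 / (1 - of_real c * osc k z))"
    using nz unfolding osc_def by (intro continuous_intros) auto
  moreover have "(\<lambda>k. 1 / (1 - of_real c * osc k z)) holomorphic_on {k. 0 < Im k}"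
    using nz unfolding osc_def by (intro holomorphic_intros) auto
  ultimately show "uhp_decay (\<lambda>k. 1 / (1 - of_real c * osc k z)) (1 / (1 - \<bar>c\<bar>)) 0"
    by (simp add: uhp_decay_def)
qed

text \<open>Boundedness, available because k is real, makes the flux vanish at infinity. The bound
  is existential so that sums of waves can be formed without tracking constants.\<close>

definition bounded_wave :: "real \<Rightarrow> (real \<Rightarrow> complex) \<Rightarrow> (real \<Rightarrow> complex) \<Rightarrow> bool" where
  "bounded_wave c \<phi> \<phi>' \<longleftrightarrow> wave_solution c \<phi> \<phi>' \<and> (\<exists>B. \<forall>y. norm (\<phi> y) \<le> B \<and> norm (\<phi>' y) \<le> B)"

lemma bounded_wave_osc:
  assumes "c = (k * q)\<^sup>2"
  shows "bounded_wave c (\<lambda>y. A * osc (of_real k) (z + q * y)) (\<lambda>y. \<i> * of_real (k * q) * (A * osc (of_real k) (z + q * y)))"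
proof -
  have d: "((\<lambda>y. A * osc (of_real k) (z + q * y)) has_vector_derivative \<i> * of_real (k * q) * (A * osc (of_real k) (z + q * y))) (at y)" for A y
    unfolding osc_def of_real_add of_real_mult
    by (rule has_vector_derivative_real_field[where f = "\<lambda>y. A * exp (\<i> * of_real k * (of_real z + of_real q * y))"])
       (auto intro!: derivative_eq_intros)
  have "((\<lambda>y. \<i> * of_real (k * q) * (A * osc (of_real k) (z + q * y))) has_vector_derivative
      - of_real c * (A * osc (of_real k) (z + q * y))) (at y)" for y
    using d[of "\<i> * of_real (k * q) * A" y] unfolding assms by (simp add: power2_eq_square algebra_simps)
  moreover have "norm (A * osc (of_real k) (z + q * y)) \<le> max (norm A) (\<bar>k * q\<bar> * norm A)"
    "norm (\<i> * of_real (k * q) * (A * osc (of_real k) (z + q * y))) \<le> max (norm A) (\<bar>k * q\<bar> * norm A)" for y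
    by (auto simp: norm_mult abs_mult)
  ultimately show ?thesis using d unfolding bounded_wave_def wave_solution_def by blast
qed

lemma bounded_wave_add:
  assumes "bounded_wave c \<phi> \<phi>'" "bounded_wave c \<psi> \<psi>'"
  shows "bounded_wave c (\<lambda>y. \<phi> y + \<psi> y) (\<lambda>y. \<phi>' y + \<psi>' y)"
proof -
  obtain B B' where B: "\<And>y. norm (\<phi> y) \<le> B" "\<And>y. norm (\<phi>' y) \<le> B" "\<And>y. norm (\<psi> y) \<le> B'" "\<And>y. norm (\<psi>' y) \<le> B'"
    using assms unfolding bounded_wave_def by blast
  have "norm (\<phi> y + \<psi> y) \<le> B + B'" "norm (\<phi>' y + \<psi>' y) \<le> B + B'" for y
    using B[of y] by (auto intro: norm_triangle_le)
  moreover have "wave_solution c (\<lambda>y. \<phi> y + \<psi> y) (\<lambda>y. \<phi>' y + \<psi>' y)"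
    using assms unfolding bounded_wave_def wave_solution_def
    by (auto intro!: derivative_eq_intros simp: distrib_left)
  ultimately show ?thesis unfolding bounded_wave_def by blast
qed

section \<open>Reflection coefficients and Green functions\<close>

context three_layer
begin

text \<open>Amplitude reflection coefficient at the left interface for a wave inside the middle
  layer; for a wave coming from the left layer it is \<open>- \<rho>L\<close>.\<close>

definition \<rho>L :: real where "\<rho>L = (\<sigma>M - \<sigma>L) / (\<sigma>M + \<sigma>L)"
definition \<rho>R :: real where "\<rho>R = (\<sigma>M - \<sigma>R) / (\<sigma>M + \<sigma>R)"

lemma \<rho>_bounds: "\<bar>\<rho>L\<bar> \<le> 1" "\<bar>\<rho>R\<bar> \<le> 1" "\<bar>\<rho>L * \<rho>R\<bar> < 1"
proof -
  have "\<bar>\<rho>L\<bar> < 1" "\<bar>\<rho>R\<bar> < 1" using pos by (auto simp: \<rho>L_def \<rho>R_def abs_if field_simps)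
  then show "\<bar>\<rho>L\<bar> \<le> 1" "\<bar>\<rho>R\<bar> \<le> 1" "\<bar>\<rho>L * \<rho>R\<bar> < 1"
    by (auto simp: abs_mult intro: mult_strict_mono'[of "\<bar>\<rho>L\<bar>" 1 "\<bar>\<rho>R\<bar>" 1, simplified])
qed

text \<open>Flux balance at an interface: transmitted on the outer side, incident minus reflected on
  the middle side. The weights are \<sigma> instead of \<sigma>^2 because wave numbers scale like 1
  / \<sigma>.\<close>

lemma \<rho>_flux:
  "complex_of_real \<sigma>L * (1 + of_real \<rho>L) = of_real \<sigma>M * (1 - of_real \<rho>L)"
  "complex_of_real \<sigma>R * (1 + of_real \<rho>R) = of_real \<sigma>M * (1 - of_real \<rho>R)"
proof -
  have "\<sigma>L * (1 + \<rho>L) = \<sigma>M * (1 - \<rho>L)" "\<sigma>R * (1 + \<rho>R) = \<sigma>M * (1 - \<rho>R)"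
    using pos by (auto simp: \<rho>L_def \<rho>R_def field_simps)
  then have "complex_of_real (\<sigma>L * (1 + \<rho>L)) = of_real (\<sigma>M * (1 - \<rho>L))"
    "complex_of_real (\<sigma>R * (1 + \<rho>R)) = of_real (\<sigma>M * (1 - \<rho>R))" by (simp_all only:)
  then show "complex_of_real \<sigma>L * (1 + of_real \<rho>L) = of_real \<sigma>M * (1 - of_real \<rho>L)"
    "complex_of_real \<sigma>R * (1 + of_real \<rho>R) = of_real \<sigma>M * (1 - of_real \<rho>R)" by simp_all
qed

text \<open>Multiple reflections between the two interfaces: \<open>1 / \<delta>\<close> is the geometric series of the round trips,
  in the wave number of a layer with coefficient \<open>\<sigma>\<close>.\<close>

definition \<delta> :: "real \<Rightarrow> complex \<Rightarrow> complex" where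
  "\<delta> \<sigma> k = 1 - of_real (\<rho>L * \<rho>R) * osc k (4 * a * (\<sigma> / \<sigma>M))"

abbreviation (input) K :: real where "K \<equiv> 1 / (1 - \<bar>\<rho>L * \<rho>R\<bar>)"

lemma K_pos: "K > 0" using \<rho>_bounds(3) by simp

lemma uhp_decay_\<delta>: "\<sigma> > 0 \<Longrightarrow> uhp_decay (\<lambda>k. 1 / \<delta> \<sigma> k) K 0"
  unfolding \<delta>_def using pos by (intro uhp_decay_resolvent \<rho>_bounds) auto

lemma \<delta>_nonzero: "\<sigma> > 0 \<Longrightarrow> 0 \<le> Im k \<Longrightarrow> \<delta> \<sigma> k \<noteq> 0"
  unfolding \<delta>_def using pos by (intro uhp_decay_resolvent \<rho>_bounds) auto

text \<open>In \<open>osc k z\<close> the phase \<open>z\<close> is the optical length of a path from \<open>x\<close> to \<open>y\<close>, with lengths in a layer \<open>\<sigma>'\<close>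
  scaled by \<open>\<sigma> / \<sigma>'\<close>, \<open>\<sigma>\<close> belonging to the layer of \<open>x\<close>. Crossing an interface contributes a transmission coefficient,
  e.g. \<open>1 + \<rho>L\<close> from the middle to the left, \<open>1 - \<rho>R\<close> from the right to the middle.\<close>

definition greenR :: "real \<Rightarrow> complex \<Rightarrow> real \<Rightarrow> complex" where
  "greenR x k y =
     (if y < -a then of_real ((1 - \<rho>R) * (1 + \<rho>L)) / \<delta> \<sigma>R k * osc k ((x - a) + 2 * a * (\<sigma>R / \<sigma>M) - \<sigma>R / \<sigma>L * (y + a))
      else if y < a then of_real (1 - \<rho>R) / \<delta> \<sigma>R k * (osc k ((x - a) + \<sigma>R / \<sigma>M * (a - y))
        + of_real \<rho>L * osc k ((x - a) + \<sigma>R / \<sigma>M * (3 * a + y)))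
      else osc k \<bar>y - x\<bar> + (of_real \<rho>L * osc k (4 * a * (\<sigma>R / \<sigma>M)) - of_real \<rho>R) / \<delta> \<sigma>R k * osc k (x + y - 2 * a))"

text \<open>For y in the middle layer the four image terms are the path reflected once on the left,
  the one reflected once on the right, and the two paths reflected once on each side, leaving x to
  the right (\<open>4 * a + y - x\<close>) or to the left (\<open>4 * a + x - y\<close>). Longer
  paths add round trips, summed by \<open>1 / \<delta>\<close>.\<close>

definition greenM :: "real \<Rightarrow> complex \<Rightarrow> real \<Rightarrow> complex" where
  "greenM x k y =
     (if y < -a then of_real (1 + \<rho>L) / \<delta> \<sigma>M k * (osc k ((x + a) - \<sigma>M / \<sigma>L * (y + a))
        + of_real \<rho>R * osc k ((3 * a - x) - \<sigma>M / \<sigma>L * (y + a)))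
      else if y < a then osc k \<bar>y - x\<bar> + 1 / \<delta> \<sigma>M k * (of_real \<rho>L * osc k (y + x + 2 * a) + of_real \<rho>R * osc k (2 * a - y - x)
        + of_real (\<rho>L * \<rho>R) * (osc k (4 * a + y - x) + osc k (4 * a + x - y)))
      else of_real (1 + \<rho>R) / \<delta> \<sigma>M k * (osc k ((a - x) + \<sigma>M / \<sigma>R * (y - a))
        + of_real \<rho>L * osc k ((3 * a + x) + \<sigma>M / \<sigma>R * (y - a))))"

lemma borel_measurable_greenR: "(\<lambda>(k, y). greenR x (of_real k) y) \<in> borel_measurable (borel \<Otimes>\<^sub>M borel)"
  unfolding greenR_def \<delta>_def osc_def case_prod_beta' by measurable

lemma borel_measurable_greenM: "(\<lambda>(k, y). greenM x (of_real k) y) \<in> borel_measurable (borel \<Otimes>\<^sub>M borel)"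
  unfolding greenM_def \<delta>_def osc_def case_prod_beta' by measurable

lemma uhp_decay_\<delta>_osc:
  assumes "\<sigma> > 0" "\<bar>c\<bar> \<le> B" "d \<le> z"
  shows "uhp_decay (\<lambda>k. of_real c / \<delta> \<sigma> k * osc k z) (B * K) d"
proof -
  have "uhp_decay (\<lambda>k. of_real c * (1 / \<delta> \<sigma> k) * osc k z) (norm (complex_of_real c) * K * 1) (0 + 0 + z)"
    by (intro uhp_decay_mult uhp_decay_const uhp_decay_\<delta> uhp_decay_osc assms)
  moreover have "norm (complex_of_real c) * K * 1 \<le> B * K"
    using assms(2) K_pos by (simp only: norm_of_real mult_1_right mult_le_cancel_right) linarith
  ultimately have "uhp_decay (\<lambda>k. of_real c * (1 / \<delta> \<sigma> k) * osc k z) (B * K) d"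
    by (rule uhp_decay_weaken) (use assms in simp)
  then show ?thesis by simp
qed

text \<open>Except for the incident wave in the right layer, which is subtracted, every path from x
  first reaches the interface at a; hence the rate x - a. For y < a the subtracted wave has this
  rate too and accounts for the 1. The factor 4 bounds the product of two transmission coefficients,
  each at most 2.\<close>

lemma uhp_decay_greenR:
  assumes x: "x > a"
  shows "uhp_decay (\<lambda>k. greenR x k y - exp (\<i> * k * of_real \<bar>y - x\<bar>)) (4 * K + 1) (x - a)"
  unfolding osc_def[symmetric]
proof -
  have \<rho>: "0 \<le> 1 - \<rho>R" "1 - \<rho>R \<le> 2" "0 \<le> 1 + \<rho>L" "1 + \<rho>L \<le> 2" using \<rho>_bounds by linarith+
  have K0: "0 < K" by (rule K_pos)
  consider "y < -a" | "-a \<le> y" "y < a" | "a \<le> y" by linarith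
  then show "uhp_decay (\<lambda>k. greenR x k y - osc k \<bar>y - x\<bar>) (4 * K + 1) (x - a)"
  proof cases
    case 1
    have c: "\<bar>(1 - \<rho>R) * (1 + \<rho>L)\<bar> \<le> 4"
      using \<rho> mult_mono[OF \<rho>(2,4) _ \<rho>(3)] by (simp add: abs_mult)
    have "\<sigma>R / \<sigma>L * (y + a) \<le> 0" using 1 pos by (intro mult_nonneg_nonpos) auto
    then have z: "x - a \<le> (x - a) + 2 * a * (\<sigma>R / \<sigma>M) - \<sigma>R / \<sigma>L * (y + a)" using pos
      by (smt (verit) divide_pos_pos mult_pos_pos)
    from uhp_decay_weaken[OF uhp_decay_diff[OF uhp_decay_\<delta>_osc[OF pos(4) c z] uhp_decay_osc[of "\<bar>y - x\<bar>"]], of "4 * K + 1" "x - a"]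
    show ?thesis using 1 x pos by (simp add: greenR_def)
  next
    case 2
    have c: "\<bar>1 - \<rho>R\<bar> \<le> 2" "\<bar>(1 - \<rho>R) * \<rho>L\<bar> \<le> 2"
      using \<rho> \<rho>_bounds mult_mono[OF \<rho>(2) \<rho>_bounds(1)] by (simp_all add: abs_mult)
    have "0 \<le> \<sigma>R / \<sigma>M * (a - y)" "0 \<le> \<sigma>R / \<sigma>M * (3 * a + y)" using 2 pos by (auto intro!: mult_nonneg_nonneg)
    then have z: "x - a \<le> (x - a) + \<sigma>R / \<sigma>M * (a - y)" "x - a \<le> (x - a) + \<sigma>R / \<sigma>M * (3 * a + y)" by linarith+
    from uhp_decay_weaken[OF uhp_decay_diff[OF uhp_decay_add[OF uhp_decay_\<delta>_osc[OF pos(4) c(1) z(1)] uhp_decay_\<delta>_osc[OF pos(4) c(2) z(2)]] uhp_decay_osc[of "\<bar>y - x\<bar>"]], of "4 * K + 1" "x - a"]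
    show ?thesis using 2 x pos by (simp add: greenR_def algebra_simps)
  next
    case 3
    have c: "\<bar>\<rho>L\<bar> \<le> 1" "\<bar>- \<rho>R\<bar> \<le> 1" using \<rho>_bounds by auto
    have z: "x - a \<le> (x + y - 2 * a) + 4 * a * (\<sigma>R / \<sigma>M)" "x - a \<le> x + y - 2 * a"
      using 3 pos by (auto intro: add_increasing2)
    from uhp_decay_weaken[OF uhp_decay_add[OF uhp_decay_\<delta>_osc[OF pos(4) c(1) z(1)] uhp_decay_\<delta>_osc[OF pos(4) c(2) z(2)]], of "4 * K + 1" "x - a"]
    moreover have "greenR x k y - osc k \<bar>y - x\<bar> = of_real \<rho>L / \<delta> \<sigma>R k * osc k (x + y - 2 * a + 4 * a * (\<sigma>R / \<sigma>M))
        + of_real (- \<rho>R) / \<delta> \<sigma>R k * osc k (x + y - 2 * a)" for k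
      using 3 pos unfolding osc_add[of k "x + y - 2 * a"] by (simp add: greenR_def diff_divide_distrib left_diff_distrib)
    ultimately show ?thesis using K0 by simp
  qed
qed

text \<open>The rate is the distance from x to the nearer interface. In the middle layer
  \<open>4 * K\<close> pays for the four image terms, in the outer layers for two terms with
  coefficients at most 2.\<close>

lemma uhp_decay_greenM:
  assumes x: "-a < x" "x < a"
  shows "uhp_decay (\<lambda>k. greenM x k y - exp (\<i> * k * of_real \<bar>y - x\<bar>)) (4 * K + 1) (a - \<bar>x\<bar>)"
  unfolding osc_def[symmetric]
proof -
  have \<rho>: "\<bar>1 + \<rho>L\<bar> \<le> 2" "\<bar>(1 + \<rho>L) * \<rho>R\<bar> \<le> 2" "\<bar>1 + \<rho>R\<bar> \<le> 2" "\<bar>(1 + \<rho>R) * \<rho>L\<bar> \<le> 2"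
  proof -
    show 1: "\<bar>1 + \<rho>L\<bar> \<le> 2" "\<bar>1 + \<rho>R\<bar> \<le> 2" using \<rho>_bounds by linarith+
    show "\<bar>(1 + \<rho>L) * \<rho>R\<bar> \<le> 2" "\<bar>(1 + \<rho>R) * \<rho>L\<bar> \<le> 2"
      using mult_mono[OF 1(1) \<rho>_bounds(2)] mult_mono[OF 1(2) \<rho>_bounds(1)] by (simp_all add: abs_mult)
  qed
  have K0: "0 < K" by (rule K_pos)
  consider "y < -a" | "-a \<le> y" "y < a" | "a \<le> y" by linarith
  then show "uhp_decay (\<lambda>k. greenM x k y - osc k \<bar>y - x\<bar>) (4 * K + 1) (a - \<bar>x\<bar>)"
  proof cases
    case 1
    have "\<sigma>M / \<sigma>L * (y + a) \<le> 0" using 1 pos by (intro mult_nonneg_nonpos) auto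
    then have z: "a - \<bar>x\<bar> \<le> (x + a) - \<sigma>M / \<sigma>L * (y + a)" "a - \<bar>x\<bar> \<le> (3 * a - x) - \<sigma>M / \<sigma>L * (y + a)" using pos by linarith+
    from uhp_decay_weaken[OF uhp_decay_diff[OF uhp_decay_add[OF uhp_decay_\<delta>_osc[OF pos(3) \<rho>(1) z(1)] uhp_decay_\<delta>_osc[OF pos(3) \<rho>(2) z(2)]] uhp_decay_osc[of "\<bar>y - x\<bar>"]], of "4 * K + 1" "a - \<bar>x\<bar>"]
    show ?thesis using 1 x pos by (simp add: greenM_def algebra_simps)
  next
    case 2
    have z: "a - \<bar>x\<bar> \<le> y + x + 2 * a" "a - \<bar>x\<bar> \<le> 2 * a - y - x" "a - \<bar>x\<bar> \<le> 4 * a + y - x" "a - \<bar>x\<bar> \<le> 4 * a + x - y"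
      using 2 x by linarith+
    have c: "\<bar>\<rho>L * \<rho>R\<bar> \<le> 1" using \<rho>_bounds by simp
    from uhp_decay_weaken[OF uhp_decay_add[OF uhp_decay_add[OF uhp_decay_\<delta>_osc[OF pos(3) \<rho>_bounds(1) z(1)] uhp_decay_\<delta>_osc[OF pos(3) \<rho>_bounds(2) z(2)]]
        uhp_decay_add[OF uhp_decay_\<delta>_osc[OF pos(3) c z(3)] uhp_decay_\<delta>_osc[OF pos(3) c z(4)]]], of "4 * K + 1" "a - \<bar>x\<bar>"]
    show ?thesis using 2 x pos K0 by (simp add: greenM_def algebra_simps add_divide_distrib)
  next
    case 3
    have "0 \<le> \<sigma>M / \<sigma>R * (y - a)" using 3 pos by (intro mult_nonneg_nonneg) auto
    then have z: "a - \<bar>x\<bar> \<le> (a - x) + \<sigma>M / \<sigma>R * (y - a)" "a - \<bar>x\<bar> \<le> (3 * a + x) + \<sigma>M / \<sigma>R * (y - a)" using pos by linarith+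
    from uhp_decay_weaken[OF uhp_decay_diff[OF uhp_decay_add[OF uhp_decay_\<delta>_osc[OF pos(3) \<rho>(3) z(1)] uhp_decay_\<delta>_osc[OF pos(3) \<rho>(4) z(2)]] uhp_decay_osc[of "\<bar>y - x\<bar>"]], of "4 * K + 1" "a - \<bar>x\<bar>"]
    show ?thesis using 3 x pos by (simp add: greenM_def algebra_simps)
  qed
qed

section \<open>Green's identity for the explicit Green functions\<close>

lemma green_identity_greenR:
  fixes k s1 s2 x :: real
  assumes s: "0 < s1" "s1 \<le> s2" and x: "x > a"
  shows "heat_increment (\<sigma>R\<^sup>2 * k\<^sup>2) s1 s2 (\<lambda>s. LINT y|lebesgue. U y s * greenR x (of_real k) y)
     = of_real (\<sigma>R\<^sup>2) * (2 * \<i> * of_real k) * integral {s1..s2} (\<lambda>s. exp (of_real (\<sigma>R\<^sup>2 * k\<^sup>2 * s)) * uR x s)"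
proof -
  let ?o = "osc (of_real k)" and ?qL = "\<sigma>R / \<sigma>L" and ?qM = "\<sigma>R / \<sigma>M"
  let ?w = "\<lambda>A z q y. A * ?o (z + q * y)" and ?d = "\<lambda>A z q y. \<i> * of_real (k * q) * (A * ?o (z + q * y))"
  let ?\<rho>L = "complex_of_real \<rho>L" and ?\<rho>R = "complex_of_real \<rho>R"
  define \<Delta> where "\<Delta> = \<delta> \<sigma>R (of_real k)"
  have \<Delta>0: "\<Delta> \<noteq> 0" unfolding \<Delta>_def using pos by (intro \<delta>_nonzero) auto
  define Q where "Q = ?o (4 * a * ?qM)"
  have \<Delta>: "\<Delta> = 1 - ?\<rho>L * ?\<rho>R * Q" by (simp add: \<Delta>_def \<delta>_def Q_def)
  \<comment> \<open>\<open>TL\<close> is the amplitude in the left layer; in the middle layer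
    \<open>c1\<close> belongs to the wave arriving from the right interface and \<open>c2\<close> to
    its reflection at the left one.\<close>
  define TL where "TL = (1 - ?\<rho>R) * (1 + ?\<rho>L) / \<Delta>"
  define c1 where "c1 = (1 - ?\<rho>R) / \<Delta>"
  define c2 where "c2 = c1 * ?\<rho>L"
  \<comment> \<open>The direct reflection \<open>- \<rho>R\<close> and all paths through the middle
    layer, \<open>(1 - \<rho>R) * (1 + \<rho>R) * \<rho>L * Q / \<Delta>\<close>, over a common
    denominator.\<close>
  define r where "r = (?\<rho>L * Q - ?\<rho>R) / \<Delta>"
  define \<phi>L where "\<phi>L y = ?w TL ((x - a) + 2 * a * ?qM - ?qL * a) (- ?qL) y" for y
  define \<phi>L' where "\<phi>L' y = ?d TL ((x - a) + 2 * a * ?qM - ?qL * a) (- ?qL) y" for y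
  define \<phi>M where "\<phi>M y = ?w c1 ((x - a) + ?qM * a) (- ?qM) y + ?w c2 ((x - a) + 3 * a * ?qM) ?qM y" for y
  define \<phi>M' where "\<phi>M' y = ?d c1 ((x - a) + ?qM * a) (- ?qM) y
     + ?d c2 ((x - a) + 3 * a * ?qM) ?qM y" for y
  define \<phi>1 where "\<phi>1 y = ?w 1 x (- 1) y + ?w r (x - 2 * a) 1 y" for y
  define \<phi>1' where "\<phi>1' y = ?d 1 x (- 1) y + ?d r (x - 2 * a) 1 y" for y
  define \<phi>2 where "\<phi>2 y = ?w 1 (- x) 1 y + ?w r (x - 2 * a) 1 y" for y
  define \<phi>2' where "\<phi>2' y = ?d 1 (- x) 1 y + ?d r (x - 2 * a) 1 y" for y
  have bw: "bounded_wave ((k * ?qL)\<^sup>2) \<phi>L \<phi>L'" "bounded_wave ((k * ?qM)\<^sup>2) \<phi>M \<phi>M'" "bounded_wave (k\<^sup>2) \<phi>1 \<phi>1'" "bounded_wave (k\<^sup>2) \<phi>2 \<phi>2'"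
    unfolding \<phi>L_def[abs_def] \<phi>L'_def[abs_def] \<phi>M_def[abs_def] \<phi>M'_def[abs_def] \<phi>1_def[abs_def] \<phi>1'_def[abs_def] \<phi>2_def[abs_def] \<phi>2'_def[abs_def]
    by (intro bounded_wave_osc bounded_wave_add; simp)+
  obtain BL B2 where BB: "\<And>y. norm (\<phi>L y) \<le> BL" "\<And>y. norm (\<phi>L' y) \<le> BL" "\<And>y. norm (\<phi>2 y) \<le> B2" "\<And>y. norm (\<phi>2' y) \<le> B2"
    using bw(1,4) unfolding bounded_wave_def by blast
  have B: "norm (\<phi>L y) \<le> max BL B2" "norm (\<phi>L' y) \<le> max BL B2" "norm (\<phi>2 y) \<le> max BL B2" "norm (\<phi>2' y) \<le> max BL B2" for y
    using BB[of y] by auto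
  have ws: "wave_solution ((k * ?qL)\<^sup>2) \<phi>L \<phi>L'" "wave_solution ((k * ?qM)\<^sup>2) \<phi>M \<phi>M'" "wave_solution (k\<^sup>2) \<phi>1 \<phi>1'" "wave_solution (k\<^sup>2) \<phi>2 \<phi>2'"
    using bw by (simp_all add: bounded_wave_def)
  have \<omega>: "\<sigma>R\<^sup>2 * k\<^sup>2 = \<sigma>L\<^sup>2 * (k * ?qL)\<^sup>2" "\<sigma>R\<^sup>2 * k\<^sup>2 = \<sigma>M\<^sup>2 * (k * ?qM)\<^sup>2"
    using pos by (simp_all add: power_mult_distrib power_divide)
  \<comment> \<open>In a layer \<sigma>' the wave number is k \<sigma>R / \<sigma>' up to sign, so
    \<sigma>'^2 times it is \<sigma>' \<sigma>R k. This produces the weights of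
    \<open>\<rho>_flux\<close>.\<close>
  have sq: "of_real (\<sigma>L\<^sup>2) * complex_of_real (k * (- ?qL)) = - of_real \<sigma>L * (of_real \<sigma>R * of_real k)"
    "of_real (\<sigma>M\<^sup>2) * complex_of_real (k * (- ?qM)) = - of_real \<sigma>M * (of_real \<sigma>R * of_real k)"
    "of_real (\<sigma>M\<^sup>2) * complex_of_real (k * ?qM) = of_real \<sigma>M * (of_real \<sigma>R * of_real k)"
    using pos by (simp_all add: power2_eq_square)
  define P where "P = ?o (x - a)"
  \<comment> \<open>At the left interface all waves share this phase, so matching there concerns
    amplitudes only.\<close>
  define P2 where "P2 = ?o (x - a + 2 * a * ?qM)"
  have "(x - a) + 2 * a * ?qM - ?qL * a + (- ?qL) * (- a) = x - a + 2 * a * ?qM"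
      "(x - a) + ?qM * a + (- ?qM) * (- a) = x - a + 2 * a * ?qM"
      "(x - a) + 3 * a * ?qM + ?qM * (- a) = x - a + 2 * a * ?qM" by (simp_all add: field_simps)
  then have atL: "\<phi>L (- a) = TL * P2" "\<phi>L' (- a) = \<i> * of_real (k * (- ?qL)) * (TL * P2)"
    "\<phi>M (- a) = c1 * P2 + c2 * P2" "\<phi>M' (- a) = \<i> * of_real (k * (- ?qM)) * (c1 * P2) + \<i> * of_real (k * ?qM) * (c2 * P2)"
    unfolding \<phi>L_def \<phi>L'_def \<phi>M_def \<phi>M'_def P2_def by (simp_all only:)
  have "(x - a) + ?qM * a + (- ?qM) * a = x - a" "(x - a) + 3 * a * ?qM + ?qM * a = (x - a) + 4 * a * ?qM"
      "x + (- 1) * a = x - a" "(x - 2 * a) + 1 * a = x - a" by (simp_all add: field_simps)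
  then have atR: "\<phi>M a = c1 * P + c2 * (P * Q)" "\<phi>M' a = \<i> * of_real (k * (- ?qM)) * (c1 * P) + \<i> * of_real (k * ?qM) * (c2 * (P * Q))"
    "\<phi>1 a = P + r * P" "\<phi>1' a = - (\<i> * of_real k * P) + \<i> * of_real k * (r * P)"
    unfolding \<phi>M_def \<phi>M'_def \<phi>1_def \<phi>1'_def P_def Q_def osc_add[of _ "x - a", symmetric] by (simp_all only: mult_1 mult_1_right) simp_all
  have TL: "TL = c1 + c2" by (simp add: TL_def c1_def c2_def distrib_left add_divide_distrib)
  have fluxL: "of_real \<sigma>L * TL = of_real \<sigma>M * (c1 - c2)"
  proof -
    have "of_real \<sigma>L * TL = c1 * (of_real \<sigma>L * (1 + ?\<rho>L))" by (simp add: TL c2_def algebra_simps)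
    also have "\<dots> = of_real \<sigma>M * (c1 - c2)" unfolding \<rho>_flux by (simp add: c2_def algebra_simps)
    finally show ?thesis .
  qed
  have \<Delta>c1: "\<Delta> * c1 = 1 - ?\<rho>R" and \<Delta>r: "\<Delta> * r = ?\<rho>L * Q - ?\<rho>R"
    using \<Delta>0 by (simp_all add: c1_def r_def)
  \<comment> \<open>Multiplied by \<Delta>, the matching conditions at the right interface become
    polynomial identities in the reflection coefficients and \<open>Q\<close>.\<close>
  have "\<Delta> * (c1 + c2 * Q) = (\<Delta> * c1) * (1 + ?\<rho>L * Q)" by (simp add: c2_def algebra_simps)
  also have "\<dots> = \<Delta> + \<Delta> * r" unfolding \<Delta>c1 \<Delta>r by (simp add: \<Delta> algebra_simps)
  also have "\<dots> = \<Delta> * (1 + r)" by (simp add: distrib_left)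
  finally have contR: "c1 + c2 * Q = 1 + r" using \<Delta>0 by simp
  have "\<Delta> * (of_real \<sigma>M * (c1 - c2 * Q)) = of_real \<sigma>M * (\<Delta> * c1) * (1 - ?\<rho>L * Q)"
    by (simp add: c2_def algebra_simps)
  also have "\<dots> = of_real \<sigma>R * (1 + ?\<rho>R) * (1 - ?\<rho>L * Q)" unfolding \<Delta>c1 by (simp only: \<rho>_flux)
  also have "\<dots> = of_real \<sigma>R * (\<Delta> - \<Delta> * r)" unfolding \<Delta>r by (simp add: \<Delta> algebra_simps)
  also have "\<dots> = \<Delta> * (of_real \<sigma>R * (1 - r))" by (simp add: algebra_simps)
  finally have fluxR: "of_real \<sigma>M * (c1 - c2 * Q) = of_real \<sigma>R * (1 - r)" using \<Delta>0 by simp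
  \<comment> \<open>The term with \<open>r\<close> is smooth at x; the incident wave has slope - i k
    to the left of x and i k to the right.\<close>
  have jump: "\<phi>2' x - \<phi>1' x = 2 * \<i> * of_real k" by (simp add: \<phi>2'_def \<phi>1'_def osc_def)
  show ?thesis
    unfolding jump[symmetric]
  proof (rule green_identity_right[OF s x ws \<omega> refl B(1,2,3,4)])
    show "\<phi>L (- a) = \<phi>M (- a)" unfolding atL TL by (simp add: algebra_simps)
    show "of_real (\<sigma>L\<^sup>2) * \<phi>L' (- a) = of_real (\<sigma>M\<^sup>2) * \<phi>M' (- a)"
    proof -
      have "of_real (\<sigma>L\<^sup>2) * \<phi>L' (- a) = of_real (\<sigma>L\<^sup>2) * of_real (k * (- ?qL)) * (\<i> * (TL * P2))"
        unfolding atL by (simp only: mult_ac)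
      also have "\<dots> = - (\<i> * of_real \<sigma>R * of_real k * P2) * (of_real \<sigma>L * TL)" unfolding sq by (simp add: mult_ac)
      also have "\<dots> = - of_real \<sigma>M * (of_real \<sigma>R * of_real k) * (\<i> * (c1 * P2)) + of_real \<sigma>M * (of_real \<sigma>R * of_real k) * (\<i> * (c2 * P2))"
        unfolding fluxL by (simp add: algebra_simps)
      also have "\<dots> = of_real (\<sigma>M\<^sup>2) * \<phi>M' (- a)"
        unfolding atL sq[symmetric] by (simp only: distrib_left mult_ac)
      finally show ?thesis .
    qed
    show "\<phi>M a = \<phi>1 a"
    proof -
      have "\<phi>M a = (c1 + c2 * Q) * P" unfolding atR by (simp add: algebra_simps)
      then show ?thesis unfolding contR atR by (simp add: algebra_simps)
    qed
    show "of_real (\<sigma>M\<^sup>2) * \<phi>M' a = of_real (\<sigma>R\<^sup>2) * \<phi>1' a"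
    proof -
      have "of_real (\<sigma>M\<^sup>2) * \<phi>M' a = of_real (\<sigma>M\<^sup>2) * of_real (k * (- ?qM)) * (\<i> * (c1 * P)) + of_real (\<sigma>M\<^sup>2) * of_real (k * ?qM) * (\<i> * (c2 * (P * Q)))"
        unfolding atR by (simp only: distrib_left mult_ac)
      also have "\<dots> = - (\<i> * of_real \<sigma>R * of_real k * P) * (of_real \<sigma>M * (c1 - c2 * Q))"
        unfolding sq by (simp add: algebra_simps)
      also have "\<dots> = of_real (\<sigma>R\<^sup>2) * \<phi>1' a"
        unfolding fluxR atR by (simp add: algebra_simps power2_eq_square)
      finally show ?thesis .
    qed
    show "\<phi>1 x = \<phi>2 x" by (simp add: \<phi>1_def \<phi>2_def)
    show "greenR x (of_real k) y = \<phi>L y" if "y < - a" for y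
    proof -
      have eq: "(x - a) + 2 * a * ?qM - ?qL * (y + a) = (x - a) + 2 * a * ?qM - ?qL * a + (- ?qL) * y" by (simp add: algebra_simps add_divide_distrib)
      show ?thesis using that unfolding greenR_def \<phi>L_def eq[symmetric] TL_def \<Delta>_def by simp
    qed
    show "greenR x (of_real k) y = \<phi>M y" if "- a < y" "y < a" for y
    proof -
      have eq: "(x - a) + ?qM * (a - y) = (x - a) + ?qM * a + (- ?qM) * y" "(x - a) + ?qM * (3 * a + y) = (x - a) + 3 * a * ?qM + ?qM * y"
        by (simp_all add: algebra_simps add_divide_distrib diff_divide_distrib)
      show ?thesis using that unfolding greenR_def \<phi>M_def eq[symmetric] c2_def c1_def \<Delta>_def by (simp add: distrib_left)
    qed
    show "greenR x (of_real k) y = \<phi>1 y" if "a < y" "y < x" for y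
      using that pos unfolding greenR_def \<phi>1_def r_def \<Delta>_def Q_def by (simp add: algebra_simps)
    show "greenR x (of_real k) y = \<phi>2 y" if "x < y" for y
      using that pos x unfolding greenR_def \<phi>2_def r_def \<Delta>_def Q_def by (simp add: algebra_simps)
    show "greenR x (of_real k) \<in> borel_measurable borel"
      using measurable_compose[OF measurable_Pair1' borel_measurable_greenR[of x], of k] by simp
  qed
qed

lemma green_identity_greenM:
  fixes k s1 s2 x :: real
  assumes s: "0 < s1" "s1 \<le> s2" and x: "-a < x" "x < a"
  shows "heat_increment (\<sigma>M\<^sup>2 * k\<^sup>2) s1 s2 (\<lambda>s. LINT y|lebesgue. U y s * greenM x (of_real k) y)
     = of_real (\<sigma>M\<^sup>2) * (2 * \<i> * of_real k) * integral {s1..s2} (\<lambda>s. exp (of_real (\<sigma>M\<^sup>2 * k\<^sup>2 * s)) * uM x s)"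
proof -
  let ?o = "osc (of_real k)" and ?qL = "\<sigma>M / \<sigma>L" and ?qR = "\<sigma>M / \<sigma>R"
  let ?w = "\<lambda>A z q y. A * ?o (z + q * y)" and ?d = "\<lambda>A z q y. \<i> * of_real (k * q) * (A * ?o (z + q * y))"
  let ?\<rho>L = "complex_of_real \<rho>L" and ?\<rho>R = "complex_of_real \<rho>R"
  define \<Delta> where "\<Delta> = \<delta> \<sigma>M (of_real k)"
  have \<Delta>0: "\<Delta> \<noteq> 0" unfolding \<Delta>_def using pos by (intro \<delta>_nonzero) auto
  \<comment> \<open>Here \<open>Q\<close> is the phase of a single crossing of the middle layer, so
    a round trip is \<open>Q * Q\<close>; \<open>P\<close> and \<open>N\<close> are the phases from
    x to the left and to the right interface.\<close>
  define Q where "Q = ?o (2 * a)"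
  define P where "P = ?o (x + a)"
  define N where "N = ?o (a - x)"
  have Q2: "?o (4 * a) = Q * Q" unfolding Q_def osc_add[symmetric] by simp
  have \<Delta>: "\<Delta> = 1 - ?\<rho>L * ?\<rho>R * (Q * Q)" using pos by (simp add: \<Delta>_def \<delta>_def Q2[symmetric])
  define \<phi>L where "\<phi>L y = ?w ((1 + ?\<rho>L) / \<Delta>) ((x + a) - ?qL * a) (- ?qL) y + ?w ((1 + ?\<rho>L) / \<Delta> * ?\<rho>R) ((3 * a - x) - ?qL * a) (- ?qL) y" for y
  define \<phi>L' where "\<phi>L' y = ?d ((1 + ?\<rho>L) / \<Delta>) ((x + a) - ?qL * a) (- ?qL) y
     + ?d ((1 + ?\<rho>L) / \<Delta> * ?\<rho>R) ((3 * a - x) - ?qL * a) (- ?qL) y" for y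
  define \<phi>R where "\<phi>R y = ?w ((1 + ?\<rho>R) / \<Delta>) ((a - x) - ?qR * a) ?qR y + ?w ((1 + ?\<rho>R) / \<Delta> * ?\<rho>L) ((3 * a + x) - ?qR * a) ?qR y" for y
  define \<phi>R' where "\<phi>R' y = ?d ((1 + ?\<rho>R) / \<Delta>) ((a - x) - ?qR * a) ?qR y
     + ?d ((1 + ?\<rho>R) / \<Delta> * ?\<rho>L) ((3 * a + x) - ?qR * a) ?qR y" for y
  \<comment> \<open>The reflected field is the same expression on both sides of x, so the derivative
    jump comes from the incident wave alone.\<close>
  define \<psi> where "\<psi> y = (?w (?\<rho>L / \<Delta>) (x + 2 * a) 1 y + ?w (?\<rho>R / \<Delta>) (2 * a - x) (- 1) y)
     + (?w (?\<rho>L * ?\<rho>R / \<Delta>) (4 * a - x) 1 y + ?w (?\<rho>L * ?\<rho>R / \<Delta>) (4 * a + x) (- 1) y)" for y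
  define \<psi>' where "\<psi>' y = (?d (?\<rho>L / \<Delta>) (x + 2 * a) 1 y + ?d (?\<rho>R / \<Delta>) (2 * a - x) (- 1) y)
     + (?d (?\<rho>L * ?\<rho>R / \<Delta>) (4 * a - x) 1 y + ?d (?\<rho>L * ?\<rho>R / \<Delta>) (4 * a + x) (- 1) y)" for y
  define \<phi>1 where "\<phi>1 y = ?w 1 x (- 1) y + \<psi> y" for y
  define \<phi>1' where "\<phi>1' y = ?d 1 x (- 1) y + \<psi>' y" for y
  define \<phi>2 where "\<phi>2 y = ?w 1 (- x) 1 y + \<psi> y" for y
  define \<phi>2' where "\<phi>2' y = ?d 1 (- x) 1 y + \<psi>' y" for y
  have "bounded_wave (k\<^sup>2) \<psi> \<psi>'"
    unfolding \<psi>_def[abs_def] \<psi>'_def[abs_def] by (intro bounded_wave_add bounded_wave_osc; simp)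
  then have bw: "bounded_wave ((k * ?qL)\<^sup>2) \<phi>L \<phi>L'" "bounded_wave (k\<^sup>2) \<phi>1 \<phi>1'" "bounded_wave (k\<^sup>2) \<phi>2 \<phi>2'" "bounded_wave ((k * ?qR)\<^sup>2) \<phi>R \<phi>R'"
    unfolding \<phi>L_def[abs_def] \<phi>L'_def[abs_def] \<phi>R_def[abs_def] \<phi>R'_def[abs_def] \<phi>1_def[abs_def] \<phi>1'_def[abs_def] \<phi>2_def[abs_def] \<phi>2'_def[abs_def]
    by (intro bounded_wave_osc bounded_wave_add; simp)+
  obtain BL B2 where BB: "\<And>y. norm (\<phi>L y) \<le> BL" "\<And>y. norm (\<phi>L' y) \<le> BL" "\<And>y. norm (\<phi>R y) \<le> B2" "\<And>y. norm (\<phi>R' y) \<le> B2"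
    using bw(1,4) unfolding bounded_wave_def by blast
  have B: "norm (\<phi>L y) \<le> max BL B2" "norm (\<phi>L' y) \<le> max BL B2" "norm (\<phi>R y) \<le> max BL B2" "norm (\<phi>R' y) \<le> max BL B2" for y
    using BB[of y] by auto
  have ws: "wave_solution ((k * ?qL)\<^sup>2) \<phi>L \<phi>L'" "wave_solution (k\<^sup>2) \<phi>1 \<phi>1'" "wave_solution (k\<^sup>2) \<phi>2 \<phi>2'" "wave_solution ((k * ?qR)\<^sup>2) \<phi>R \<phi>R'"
    using bw by (simp_all add: bounded_wave_def)
  have \<omega>: "\<sigma>M\<^sup>2 * k\<^sup>2 = \<sigma>L\<^sup>2 * (k * ?qL)\<^sup>2" "\<sigma>M\<^sup>2 * k\<^sup>2 = \<sigma>R\<^sup>2 * (k * ?qR)\<^sup>2"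
    using pos by (simp_all add: power_mult_distrib power_divide)
  have sq: "of_real (\<sigma>L\<^sup>2) * complex_of_real (k * (- ?qL)) = - of_real \<sigma>L * (of_real \<sigma>M * of_real k)"
    "of_real (\<sigma>R\<^sup>2) * complex_of_real (k * ?qR) = of_real \<sigma>R * (of_real \<sigma>M * of_real k)"
    using pos by (simp_all add: power2_eq_square)
  have oo: "?o (3 * a - x) = N * Q" "?o (5 * a + x) = P * (Q * Q)" "?o (3 * a + x) = P * Q" "?o (5 * a - x) = N * (Q * Q)"
    unfolding N_def Q_def P_def osc_add[symmetric] by (simp_all add: algebra_simps)
  have "(x + a) - ?qL * a + (- ?qL) * (- a) = x + a" "(3 * a - x) - ?qL * a + (- ?qL) * (- a) = 3 * a - x" by simp_all
  then have atL: "\<phi>L (- a) = (1 + ?\<rho>L) / \<Delta> * (P + ?\<rho>R * (N * Q))"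
    "\<phi>L' (- a) = \<i> * of_real (k * (- ?qL)) * ((1 + ?\<rho>L) / \<Delta> * (P + ?\<rho>R * (N * Q)))"
    unfolding \<phi>L_def \<phi>L'_def P_def oo(1)[symmetric] by (simp_all only: distrib_left mult.assoc)
  have "(a - x) - ?qR * a + ?qR * a = a - x" "(3 * a + x) - ?qR * a + ?qR * a = 3 * a + x" by simp_all
  then have atR: "\<phi>R a = (1 + ?\<rho>R) / \<Delta> * (N + ?\<rho>L * (P * Q))"
    "\<phi>R' a = \<i> * of_real (k * ?qR) * ((1 + ?\<rho>R) / \<Delta> * (N + ?\<rho>L * (P * Q)))"
    unfolding \<phi>R_def \<phi>R'_def N_def oo(3)[symmetric] by (simp_all only: distrib_left mult.assoc)
  have "x + (- 1) * (- a) = x + a" "(x + 2 * a) + 1 * (- a) = x + a" "(2 * a - x) + (- 1) * (- a) = 3 * a - x"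
      "(4 * a - x) + 1 * (- a) = 3 * a - x" "(4 * a + x) + (- 1) * (- a) = 5 * a + x" by simp_all
  then have at1: "\<phi>1 (- a) = P + (?\<rho>L * P + ?\<rho>R * (N * Q) + ?\<rho>L * ?\<rho>R * (N * Q + P * (Q * Q))) / \<Delta>"
    "\<phi>1' (- a) = \<i> * of_real k * (- P + (?\<rho>L * P - ?\<rho>R * (N * Q) + ?\<rho>L * ?\<rho>R * (N * Q - P * (Q * Q))) / \<Delta>)"
    unfolding \<phi>1_def \<phi>1'_def \<psi>_def \<psi>'_def P_def oo(1,2)[unfolded P_def, symmetric]
      by (simp_all only:) (simp_all add: add_divide_distrib diff_divide_distrib algebra_simps)
  have "- x + 1 * a = a - x" "(x + 2 * a) + 1 * a = 3 * a + x" "(2 * a - x) + (- 1) * a = a - x"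
      "(4 * a - x) + 1 * a = 5 * a - x" "(4 * a + x) + (- 1) * a = 3 * a + x" by simp_all
  then have at2: "\<phi>2 a = N + (?\<rho>L * (P * Q) + ?\<rho>R * N + ?\<rho>L * ?\<rho>R * (N * (Q * Q) + P * Q)) / \<Delta>"
    "\<phi>2' a = \<i> * of_real k * (N + (?\<rho>L * (P * Q) - ?\<rho>R * N + ?\<rho>L * ?\<rho>R * (N * (Q * Q) - P * Q)) / \<Delta>)"
    unfolding \<phi>2_def \<phi>2'_def \<psi>_def \<psi>'_def N_def oo(3,4)[unfolded N_def, symmetric]
      by (simp_all only:) (simp_all add: add_divide_distrib diff_divide_distrib algebra_simps)
  have add_frac: "X + Z / \<Delta> = (\<Delta> * X + Z) / \<Delta>" for X Z
    using \<Delta>0 by (simp add: add_divide_distrib)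
  \<comment> \<open>The field at the left interface factors: \<open>P + \<rho>R * (N * Q)\<close>
    collects the arrivals from x, directly and by way of the right interface, and
    \<open>1 + \<rho>L\<close> transmits them. The next three identities are its analogues for the
    derivative and for the right interface.\<close>
  have "\<Delta> * P + (?\<rho>L * P + ?\<rho>R * (N * Q) + ?\<rho>L * ?\<rho>R * (N * Q + P * (Q * Q))) = (1 + ?\<rho>L) * (P + ?\<rho>R * (N * Q))"
    unfolding \<Delta> by (simp add: algebra_simps)
  then have c1: "\<phi>1 (- a) = (1 + ?\<rho>L) / \<Delta> * (P + ?\<rho>R * (N * Q))"
    unfolding at1 add_frac by (simp only: times_divide_eq_left)
  have "\<Delta> * - P + (?\<rho>L * P - ?\<rho>R * (N * Q) + ?\<rho>L * ?\<rho>R * (N * Q - P * (Q * Q))) = - ((1 - ?\<rho>L) * (P + ?\<rho>R * (N * Q)))"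
    unfolding \<Delta> by (simp add: algebra_simps)
  then have c1': "\<phi>1' (- a) = - (\<i> * of_real k) * ((1 - ?\<rho>L) / \<Delta> * (P + ?\<rho>R * (N * Q)))"
    unfolding at1 add_frac by (simp only: times_divide_eq_left) simp
  have "\<Delta> * N + (?\<rho>L * (P * Q) + ?\<rho>R * N + ?\<rho>L * ?\<rho>R * (N * (Q * Q) + P * Q)) = (1 + ?\<rho>R) * (N + ?\<rho>L * (P * Q))"
    unfolding \<Delta> by (simp add: algebra_simps)
  then have c2: "\<phi>2 a = (1 + ?\<rho>R) / \<Delta> * (N + ?\<rho>L * (P * Q))"
    unfolding at2 add_frac by (simp only: times_divide_eq_left)
  have "\<Delta> * N + (?\<rho>L * (P * Q) - ?\<rho>R * N + ?\<rho>L * ?\<rho>R * (N * (Q * Q) - P * Q)) = (1 - ?\<rho>R) * (N + ?\<rho>L * (P * Q))"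
    unfolding \<Delta> by (simp add: algebra_simps)
  then have c2': "\<phi>2' a = \<i> * of_real k * ((1 - ?\<rho>R) / \<Delta> * (N + ?\<rho>L * (P * Q)))"
    unfolding at2 add_frac by (simp only: times_divide_eq_left)
  have jump: "\<phi>2' x - \<phi>1' x = 2 * \<i> * of_real k" by (simp add: \<phi>2'_def \<phi>1'_def osc_def)
  show ?thesis
    unfolding jump[symmetric]
  proof (rule green_identity_middle[OF s x ws \<omega>(1) refl \<omega>(2) B(1,2,3,4)])
    show "\<phi>L (- a) = \<phi>1 (- a)" unfolding atL c1 ..
    show "of_real (\<sigma>L\<^sup>2) * \<phi>L' (- a) = of_real (\<sigma>M\<^sup>2) * \<phi>1' (- a)"
    proof -
      have "of_real (\<sigma>L\<^sup>2) * \<phi>L' (- a) = of_real (\<sigma>L\<^sup>2) * of_real (k * (- ?qL)) * (\<i> * ((1 + ?\<rho>L) / \<Delta> * (P + ?\<rho>R * (N * Q))))"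
        unfolding atL by (simp only: mult_ac)
      also have "\<dots> = - (of_real \<sigma>M * of_real k * \<i> * (P + ?\<rho>R * (N * Q)) / \<Delta>) * (of_real \<sigma>L * (1 + ?\<rho>L))"
        unfolding sq by simp
      also have "\<dots> = of_real (\<sigma>M\<^sup>2) * \<phi>1' (- a)"
        unfolding \<rho>_flux c1' by (simp add: power2_eq_square mult_ac)
      finally show ?thesis .
    qed
    show "\<phi>2 a = \<phi>R a" unfolding atR c2 ..
    show "of_real (\<sigma>M\<^sup>2) * \<phi>2' a = of_real (\<sigma>R\<^sup>2) * \<phi>R' a"
    proof -
      have "of_real (\<sigma>R\<^sup>2) * \<phi>R' a = of_real (\<sigma>R\<^sup>2) * of_real (k * ?qR) * (\<i> * ((1 + ?\<rho>R) / \<Delta> * (N + ?\<rho>L * (P * Q))))"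
        unfolding atR by (simp only: mult_ac)
      also have "\<dots> = (of_real \<sigma>M * of_real k * \<i> * (N + ?\<rho>L * (P * Q)) / \<Delta>) * (of_real \<sigma>R * (1 + ?\<rho>R))"
        unfolding sq by simp
      also have "\<dots> = of_real (\<sigma>M\<^sup>2) * \<phi>2' a"
        unfolding \<rho>_flux c2' by (simp add: power2_eq_square mult_ac)
      finally show ?thesis by (rule sym)
    qed
    show "\<phi>1 x = \<phi>2 x" by (simp add: \<phi>1_def \<phi>2_def)
    show "greenM x (of_real k) y = \<phi>L y" if "y < - a" for y
    proof -
      have eq: "(x + a) - ?qL * (y + a) = (x + a) - ?qL * a + (- ?qL) * y" "(3 * a - x) - ?qL * (y + a) = (3 * a - x) - ?qL * a + (- ?qL) * y"
        by (simp_all add: algebra_simps add_divide_distrib diff_divide_distrib)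
      show ?thesis using that unfolding greenM_def \<phi>L_def eq[symmetric] \<Delta>_def by (simp add: distrib_left)
    qed
    have \<psi>: "\<psi> y = 1 / \<Delta> * (?\<rho>L * ?o (y + x + 2 * a) + ?\<rho>R * ?o (2 * a - y - x)
        + of_real (\<rho>L * \<rho>R) * (?o (4 * a + y - x) + ?o (4 * a + x - y)))" for y
    proof -
      have "(x + 2 * a) + 1 * y = y + x + 2 * a" "(2 * a - x) + (- 1) * y = 2 * a - y - x" "(4 * a - x) + 1 * y = 4 * a + y - x"
        "(4 * a + x) + (- 1) * y = 4 * a + x - y" by simp_all
      then show ?thesis unfolding \<psi>_def by (simp_all only:) (simp add: add_divide_distrib distrib_left)
    qed
    show "greenM x (of_real k) y = \<phi>1 y" if "- a < y" "y < x" for y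
      using that x unfolding greenM_def \<phi>1_def \<psi> \<Delta>_def by simp
    show "greenM x (of_real k) y = \<phi>2 y" if "x < y" "y < a" for y
      using that x unfolding greenM_def \<phi>2_def \<psi> \<Delta>_def by simp
    show "greenM x (of_real k) y = \<phi>R y" if "a < y" for y
    proof -
      have eq: "(a - x) + ?qR * (y - a) = (a - x) - ?qR * a + ?qR * y" "(3 * a + x) + ?qR * (y - a) = (3 * a + x) - ?qR * a + ?qR * y"
        by (simp_all add: algebra_simps add_divide_distrib diff_divide_distrib)
      show ?thesis using that pos unfolding greenM_def \<phi>R_def eq[symmetric] \<Delta>_def by (simp add: distrib_left)
    qed
    show "greenM x (of_real k) \<in> borel_measurable borel"
      using measurable_compose[OF measurable_Pair1' borel_measurable_greenM[of x], of k] by simp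
  qed
qed

section \<open>The solution as an integral of the initial data over real k\<close>

lemma representation_right:
  assumes x: "x > a" and t: "t > 0"
  shows "(LINT k|lborel. gauss (\<sigma>R\<^sup>2 * t) (of_real k) * (LINT y|lebesgue. U y 0 * greenR x (of_real k) y))
    = 2 * of_real pi * uR x t"
proof -
  interpret H: heat_inversion U "greenR x" x t \<sigma>R "4 * K + 1" "x - a"
  proof
    show "isCont (\<lambda>(y, s). U y s) (x, t)"
      using pos x t by (intro isCont_classical_heat_solution[OF solR]) (auto simp: U_def)
    show "uhp_decay (\<lambda>k. greenR x k y - exp (\<i> * k * of_real \<bar>y - x\<bar>)) (4 * K + 1) (x - a)" for y
      by (rule uhp_decay_greenR[OF x])
  qed (use pos x t in \<open>auto intro: integrable_U borel_measurable_U U_L1 borel_measurable_greenR\<close>)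
  have "(LINT k|lborel. gauss (\<sigma>R\<^sup>2 * t) (of_real k) * H.W k 0) = 2 * of_real pi * U x t"
  proof (rule H.inversion)
    fix k s1 s2 :: real assume s: "0 < s1" "s1 < s2"
    show "heat_increment (\<sigma>R\<^sup>2 * k\<^sup>2) s1 s2 (H.W (- k))
        = - (heat_increment (\<sigma>R\<^sup>2 * k\<^sup>2) s1 s2 (H.W k))"
      unfolding H.W_def green_identity_greenR[OF s(1) less_imp_le[OF s(2)] x]
        green_identity_greenR[OF s(1) less_imp_le[OF s(2)] x, of "- k", unfolded power2_minus]
      by simp
  qed
  then show ?thesis using pos x unfolding H.W_def by (simp add: U_def)
qed

lemma representation_middle:
  assumes x: "-a < x" "x < a" and t: "t > 0"
  shows "(LINT k|lborel. gauss (\<sigma>M\<^sup>2 * t) (of_real k) * (LINT y|lebesgue. U y 0 * greenM x (of_real k) y))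
    = 2 * of_real pi * uM x t"
proof -
  interpret H: heat_inversion U "greenM x" x t \<sigma>M "4 * K + 1" "a - \<bar>x\<bar>"
  proof
    show "isCont (\<lambda>(y, s). U y s) (x, t)"
      using pos x t by (intro isCont_classical_heat_solution[OF solM]) (auto simp: U_def)
    show "uhp_decay (\<lambda>k. greenM x k y - exp (\<i> * k * of_real \<bar>y - x\<bar>)) (4 * K + 1) (a - \<bar>x\<bar>)" for y
      by (rule uhp_decay_greenM[OF x])
  qed (use pos x t in \<open>auto intro: integrable_U borel_measurable_U U_L1 borel_measurable_greenM\<close>)
  have "(LINT k|lborel. gauss (\<sigma>M\<^sup>2 * t) (of_real k) * H.W k 0) = 2 * of_real pi * U x t"
  proof (rule H.inversion)
    fix k s1 s2 :: real assume s: "0 < s1" "s1 < s2"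
    show "heat_increment (\<sigma>M\<^sup>2 * k\<^sup>2) s1 s2 (H.W (- k))
        = - (heat_increment (\<sigma>M\<^sup>2 * k\<^sup>2) s1 s2 (H.W k))"
      unfolding H.W_def green_identity_greenM[OF s(1) less_imp_le[OF s(2)] x]
        green_identity_greenM[OF s(1) less_imp_le[OF s(2)] x, of "- k", unfolded power2_minus]
      by simp
  qed
  then show ?thesis using pos x unfolding H.W_def by (simp add: U_def)
qed

end

section \<open>The solution formulas\<close>

lemma has_improper_contour_integral_cmult:
  assumes "has_improper_contour_integral f I \<gamma>"
  shows "has_improper_contour_integral (\<lambda>k. c * f k) (c * I) \<gamma>"
proof -
  have i: "\<forall>\<^sub>F R in at_top. f contour_integrable_on \<gamma> R"
    and l: "((\<lambda>R. contour_integral (\<gamma> R) f) \<longlongrightarrow> I) at_top"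
    using assms by (auto simp: has_improper_contour_integral_def)
  have "\<forall>\<^sub>F R in at_top. (\<lambda>k. c * f k) contour_integrable_on \<gamma> R"
    using i by eventually_elim (rule contour_integrable_lmul)
  moreover have "\<forall>\<^sub>F R in at_top. c * contour_integral (\<gamma> R) f = contour_integral (\<gamma> R) (\<lambda>k. c * f k)"
    using i by eventually_elim (simp add: contour_integral_lmul)
  ultimately show ?thesis
    unfolding has_improper_contour_integral_def
    by (intro conjI Lim_transform_eventually[OF tendsto_mult_left[OF l, of c]])
qed

lemma has_improper_contour_integral_add:
  assumes "has_improper_contour_integral f I \<gamma>" "has_improper_contour_integral g J \<gamma>"
  shows "has_improper_contour_integral (\<lambda>k. f k + g k) (I + J) \<gamma>"
proof -
  have i: "\<forall>\<^sub>F R in at_top. f contour_integrable_on \<gamma> R \<and> g contour_integrable_on \<gamma> R"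
    using assms by (auto simp: has_improper_contour_integral_def intro: eventually_conj)
  have l: "((\<lambda>R. contour_integral (\<gamma> R) f + contour_integral (\<gamma> R) g) \<longlongrightarrow> I + J) at_top"
    using assms by (auto simp: has_improper_contour_integral_def intro: tendsto_add)
  have "\<forall>\<^sub>F R in at_top. (\<lambda>k. f k + g k) contour_integrable_on \<gamma> R"
    using i by eventually_elim (simp add: contour_integrable_add)
  moreover have "\<forall>\<^sub>F R in at_top. contour_integral (\<gamma> R) f + contour_integral (\<gamma> R) g = contour_integral (\<gamma> R) (\<lambda>k. f k + g k)"
    using i by eventually_elim (simp add: contour_integral_add)
  ultimately show ?thesis
    unfolding has_improper_contour_integral_def
    by (intro conjI Lim_transform_eventually[OF l])
qed

lemma integrable_gaussian_uhp:
  assumes f: "uhp_decay f C d" and \<beta>: "\<beta> > 0"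
  shows "integrable lborel (\<lambda>k. gauss \<beta> (of_real k) * f (of_real k))"
proof (rule integrable_gaussian_mult[OF \<beta>])
  have "continuous_on UNIV (\<lambda>k. f (complex_of_real k))"
    by (intro continuous_on_compose2[OF uhp_decayD(1)[OF f]] continuous_intros) auto
  then show "(\<lambda>k. f (complex_of_real k)) \<in> borel_measurable borel" by (rule borel_measurable_continuous_onI)
  show "norm (f (complex_of_real k)) \<le> C" for k using uhp_decayD(3)[OF f, of "of_real k"] by simp
qed

text \<open>A phase linear in y lets the data enter only through their transform, at the wave number
  \<open>k * q\<close> rescaled to the left layer.\<close>

lemma half_line_ft_osc:
  "(LINT y:{..<-a}|lebesgue. u y * (T * osc k (z - q * y))) = T * osc k z * half_line_ft a u (k * of_real q)"
proof -
  have "indicat_real {..<-a} y *\<^sub>R (u y * (T * osc k (z - q * y)))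
     = T * osc k z * (indicat_real {..<-a} y *\<^sub>R (exp (- \<i> * (k * of_real q) * of_real y) * u y))" for y
    by (simp add: osc_def scaleR_conv_of_real algebra_simps exp_diff exp_minus field_simps)
  then show ?thesis
    unfolding set_lebesgue_integral_def half_line_ft_def by (simp only: integral_mult_right_zero)
qed

lemma two_pi_cancel: "2 * complex_of_real pi * z = 2 * of_real pi * w \<Longrightarrow> z = w"
  by simp

lemma osc_uminus: "osc (- k) z = osc k (- z)"
  by (simp add: osc_def)

section \<open>Initial data and comparison with the determinants\<close>

locale three_layer_initial = three_layer +
  fixes u0 :: "real \<Rightarrow> complex"
  assumes u0: "u0 absolutely_integrable_on {..<-a}"
    and initL: "\<And>x. x < -a \<Longrightarrow> uL x 0 = u0 x"
    and initM: "\<And>x. -a < x \<Longrightarrow> x < a \<Longrightarrow> uM x 0 = 0"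
    and initR: "\<And>x. x > a \<Longrightarrow> uR x 0 = 0"
begin

lemma integral_U_initial:
  "(LINT y|lebesgue. U y 0 * f y) = (LINT y:{..<-a}|lebesgue. u0 y * f y)"
proof -
  have "U y 0 * f y = indicat_real {..<-a} y *\<^sub>R (u0 y * f y)" for y
    by (auto simp: U_def initL initM initR)
  then show ?thesis by (simp add: set_lebesgue_integral_def)
qed

abbreviation "\<Gamma> \<equiv> (\<sigma>L + \<sigma>M) * (\<sigma>M + \<sigma>R)"

lemma \<Gamma>_pos: "\<Gamma> > 0" using pos by simp

lemma \<rho>_\<Gamma>: "(\<sigma>L - \<sigma>M) * (\<sigma>M - \<sigma>R) = - (\<Gamma> * (\<rho>L * \<rho>R))" "(\<sigma>L + \<sigma>M) * (\<sigma>M - \<sigma>R) = \<Gamma> * \<rho>R"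
   "(\<sigma>L - \<sigma>M) * (\<sigma>M + \<sigma>R) = - (\<Gamma> * \<rho>L)"
proof -
  have "(\<sigma>M + \<sigma>L) * \<rho>L = \<sigma>M - \<sigma>L" "(\<sigma>M + \<sigma>R) * \<rho>R = \<sigma>M - \<sigma>R"
    using pos by (simp_all add: \<rho>L_def \<rho>R_def)
  then show "(\<sigma>L - \<sigma>M) * (\<sigma>M - \<sigma>R) = - (\<Gamma> * (\<rho>L * \<rho>R))" "(\<sigma>L + \<sigma>M) * (\<sigma>M - \<sigma>R) = \<Gamma> * \<rho>R"
     "(\<sigma>L - \<sigma>M) * (\<sigma>M + \<sigma>R) = - (\<Gamma> * \<rho>L)" by algebra+
qed

lemma Delta_R_eq: "Delta_R a \<sigma>L \<sigma>M \<sigma>R (k * of_real (\<sigma> / \<sigma>R)) = of_real (pi * \<Gamma>) * \<delta> \<sigma> k"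
proof -
  have "4 * \<i> * of_real a * (k * of_real (\<sigma> / \<sigma>R)) * of_real (\<sigma>R / \<sigma>M) = \<i> * k * of_real (4 * a * (\<sigma> / \<sigma>M))"
    using pos by simp
  then show ?thesis
    unfolding Delta_R_def \<delta>_def osc_def \<rho>_\<Gamma>(1) by (simp only:) (simp add: algebra_simps)
qed

text \<open>After k -> - k, \<open>Delta_L\<close> is \<delta> times a constant and the inverse
  phase of one round trip. This nonvanishing exponential accounts for the shifted phases in the
  integrals over the lower contour.\<close>

lemma Delta_L_eq: "Delta_L a \<sigma>L \<sigma>M \<sigma>R (- k * of_real (\<sigma> / \<sigma>L)) = of_real (pi * \<Gamma>) * (osc k (- (4 * a * (\<sigma> / \<sigma>M))) * \<delta> \<sigma> k)"
proof -
  have "4 * \<i> * of_real a * (- k * of_real (\<sigma> / \<sigma>L)) * of_real (\<sigma>L / \<sigma>M) = \<i> * k * of_real (- (4 * a * (\<sigma> / \<sigma>M)))"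
    using pos by simp
  moreover have "osc k (- (4 * a * (\<sigma> / \<sigma>M))) * osc k (4 * a * (\<sigma> / \<sigma>M)) = 1"
    unfolding osc_add[symmetric] by (simp add: osc_def)
  then have "osc k (- (4 * a * (\<sigma> / \<sigma>M))) * \<delta> \<sigma> k = osc k (- (4 * a * (\<sigma> / \<sigma>M))) - of_real (\<rho>L * \<rho>R)"
    unfolding \<delta>_def by (simp add: algebra_simps)
  ultimately show ?thesis
    unfolding Delta_L_def \<rho>_\<Gamma>(1) by (simp only: osc_def) (simp add: algebra_simps)
qed

text \<open>Contribution of one family of paths; \<open>z\<close> is the part of the phase
  independent of y and may be negative. The decay is governed by \<open>z + a * q\<close>, the
  optical length of the shortest of these paths to the left interface.\<close>

definition mode :: "real \<Rightarrow> real \<Rightarrow> real \<Rightarrow> complex \<Rightarrow> complex" where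
  "mode \<sigma> z q k = 1 / \<delta> \<sigma> k * osc k z * half_line_ft a u0 (k * of_real q)"

definition mode_integral :: "real \<Rightarrow> real \<Rightarrow> real \<Rightarrow> real \<Rightarrow> complex" where
  "mode_integral \<sigma> t z q = (LINT k|lborel. gauss (\<sigma>\<^sup>2 * t) (of_real k) * mode \<sigma> z q (of_real k))"

lemma uhp_decay_mode:
  assumes "\<sigma> > 0" "q > 0"
  shows "uhp_decay (mode \<sigma> z q) (K * 1 * (LINT x:{..<-a}|lebesgue. norm (u0 x))) (0 + z + a * q)"
  unfolding mode_def[abs_def]
  by (intro uhp_decay_mult uhp_decay_\<delta> uhp_decay_osc uhp_decay_scale half_line_ft_uhp_decay assms pos u0)

lemma integrable_mode:
  assumes "\<sigma> > 0" "q > 0" "t > 0"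
  shows "integrable lborel (\<lambda>k. gauss (\<sigma>\<^sup>2 * t) (of_real k) * mode \<sigma> z q (of_real k))"
  using assms by (intro integrable_gaussian_uhp[OF uhp_decay_mode]) auto

lemma has_improper_contour_integral_mode:
  assumes "\<sigma> > 0" "q > 0" "t > 0" "z + a * q > 0" "r > 0"
  shows "has_improper_contour_integral (\<lambda>k. gauss (\<sigma>\<^sup>2 * t) k * mode \<sigma> z q k) (mode_integral \<sigma> t z q) (bdry_D0_plus r)"
  unfolding mode_integral_def
  using assms by (intro has_improper_contour_integral_D0_plus[OF uhp_decay_mode]) auto

lemma exp_split: "exp (\<i> * k * of_real z - (of_real \<sigma> * k)\<^sup>2 * of_real t) = gauss (\<sigma>\<^sup>2 * t) k * osc k z"
  unfolding osc_def by (simp add: power_mult_distrib mult_ac flip: exp_add)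

lemma solution_right:
  assumes x: "x > a" and t: "t > 0" and r: "r > 0"
  shows "\<exists>I1. has_improper_contour_integral
           (\<lambda>k. exp (\<i> * k * of_real (x - a - a * \<sigma>R / \<sigma>L + 2 * a * \<sigma>R / \<sigma>M)
                  - (of_real \<sigma>R * k)\<^sup>2 * of_real t)
              / Delta_R a \<sigma>L \<sigma>M \<sigma>R k
              * half_line_ft a u0 (k * of_real (\<sigma>R / \<sigma>L))) I1 (bdry_D0_plus r) \<and>
         uR x t = 2 * of_real (\<sigma>M * \<sigma>R) * I1"
proof -
  \<comment> \<open>The optical length from x to y < - a is
    \<open>z - \<sigma>R / \<sigma>L * y\<close>.\<close>
  define z where "z = x - a - a * \<sigma>R / \<sigma>L + 2 * a * \<sigma>R / \<sigma>M"
  define G where "G = mode_integral \<sigma>R t z (\<sigma>R / \<sigma>L)"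
  have q: "\<sigma>R / \<sigma>L > 0" using pos by simp
  have "2 * a * \<sigma>R / \<sigma>M > 0" using pos by simp
  then have z: "z + a * (\<sigma>R / \<sigma>L) > 0"
    using x unfolding z_def times_divide_eq_right by linarith
  let ?f = "\<lambda>k. exp (\<i> * k * of_real z - (of_real \<sigma>R * k)\<^sup>2 * of_real t) / Delta_R a \<sigma>L \<sigma>M \<sigma>R k
    * half_line_ft a u0 (k * of_real (\<sigma>R / \<sigma>L))"
  have "?f = (\<lambda>k. of_real (1 / (pi * \<Gamma>)) * (gauss (\<sigma>R\<^sup>2 * t) k * mode \<sigma>R z (\<sigma>R / \<sigma>L) k))"
    using Delta_R_eq[of _ \<sigma>R] pos unfolding exp_split mode_def by (simp add: mult.assoc)
  then have I1: "has_improper_contour_integral ?f (of_real (1 / (pi * \<Gamma>)) * G) (bdry_D0_plus r)"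
    using has_improper_contour_integral_cmult[OF has_improper_contour_integral_mode[OF pos(4) q t z r]] by (simp only: G_def)
  have "(LINT y|lebesgue. U y 0 * greenR x (of_real k) y) = of_real ((1 - \<rho>R) * (1 + \<rho>L)) * mode \<sigma>R z (\<sigma>R / \<sigma>L) (of_real k)" for k :: real
  proof -
    have "(LINT y|lebesgue. U y 0 * greenR x (of_real k) y) =
       (LINT y:{..<-a}|lebesgue. u0 y * (of_real ((1 - \<rho>R) * (1 + \<rho>L)) / \<delta> \<sigma>R (of_real k) * osc (of_real k) (z - \<sigma>R / \<sigma>L * y)))"
      unfolding integral_U_initial
    proof (intro set_lebesgue_integral_cong allI impI)
      fix y assume y: "y \<in> {..<-a}"
      have "(x - a) + 2 * a * (\<sigma>R / \<sigma>M) - \<sigma>R / \<sigma>L * (y + a) = z - \<sigma>R / \<sigma>L * y"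
        by (simp add: z_def algebra_simps add_divide_distrib)
      then show "u0 y * greenR x (of_real k) y = u0 y * (of_real ((1 - \<rho>R) * (1 + \<rho>L)) / \<delta> \<sigma>R (of_real k) * osc (of_real k) (z - \<sigma>R / \<sigma>L * y))"
        using y unfolding greenR_def by (simp only: lessThan_iff if_True)
    qed simp
    then show ?thesis unfolding half_line_ft_osc mode_def by simp
  qed
  then have "2 * of_real pi * uR x t = (LINT k|lborel. of_real ((1 - \<rho>R) * (1 + \<rho>L)) *
      (gauss (\<sigma>R\<^sup>2 * t) (of_real k) * mode \<sigma>R z (\<sigma>R / \<sigma>L) (of_real k)))"
    using representation_right[OF x t] by (simp only: mult.left_commute)
  also have "\<dots> = of_real ((1 - \<rho>R) * (1 + \<rho>L)) * G"
    unfolding G_def mode_integral_def by (rule integral_mult_right_zero)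
  finally have u: "2 * of_real pi * uR x t = of_real ((1 - \<rho>R) * (1 + \<rho>L)) * G" .
  \<comment> \<open>Rewrites the transmission coefficients in the stated form: 2 \<pi> is the factor
    from the inversion, and \<pi> \<Gamma> is the constant hidden in \<open>Delta_R\<close>.\<close>
  have "1 - \<rho>R = 2 * \<sigma>R / (\<sigma>M + \<sigma>R)" "1 + \<rho>L = 2 * \<sigma>M / (\<sigma>L + \<sigma>M)"
    using pos by (simp_all add: \<rho>L_def \<rho>R_def field_simps)
  then have "(1 - \<rho>R) * (1 + \<rho>L) = 2 * pi * (2 * (\<sigma>M * \<sigma>R) * (1 / (pi * \<Gamma>)))"
    using pos by (simp add: mult.commute)
  then have "2 * of_real pi * uR x t = 2 * of_real pi * (2 * of_real (\<sigma>M * \<sigma>R) * (of_real (1 / (pi * \<Gamma>)) * G))"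
    unfolding u by (simp only: of_real_mult of_real_numeral mult.assoc)
  then have "uR x t = 2 * of_real (\<sigma>M * \<sigma>R) * (of_real (1 / (pi * \<Gamma>)) * G)" by (rule two_pi_cancel)
  with I1 show ?thesis unfolding z_def by blast
qed

lemma solution_middle:
  assumes x: "-a < x" "x < a" and t: "t > 0" and r: "r > 0"
  shows "\<exists>I1 I2.
         has_improper_contour_integral
           (\<lambda>k. exp (\<i> * k * of_real (x + a + a * \<sigma>M / \<sigma>L) - (of_real \<sigma>M * k)\<^sup>2 * of_real t)
              / Delta_L a \<sigma>L \<sigma>M \<sigma>R (k * of_real (\<sigma>M / \<sigma>L))
              * half_line_ft a u0 (- k * of_real (\<sigma>M / \<sigma>L))) I1 (bdry_D0_minus r) \<and>
         has_improper_contour_integral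
           (\<lambda>k. exp (\<i> * k * of_real (x + a - a * \<sigma>M / \<sigma>L) - (of_real \<sigma>M * k)\<^sup>2 * of_real t)
              / Delta_R a \<sigma>L \<sigma>M \<sigma>R (k * of_real (\<sigma>M / \<sigma>R))
              * half_line_ft a u0 (k * of_real (\<sigma>M / \<sigma>L))) I2 (bdry_D0_plus r) \<and>
         uM x t = - of_real (\<sigma>M * (\<sigma>M - \<sigma>R)) * I1 + of_real (\<sigma>M * (\<sigma>M + \<sigma>R)) * I2"
proof -
  let ?q = "\<sigma>M / \<sigma>L"
  \<comment> \<open>\<open>z1\<close> belongs to the path that reaches the left interface directly,
    \<open>z2\<close> to the one by way of the right interface, weighted by \<rho>R. The first gives
    the integral over the upper contour, the second, after k -> - k, the one over the lower
    contour.\<close>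
  define z1 where "z1 = x + a - a * \<sigma>M / \<sigma>L"
  define z2 where "z2 = 3 * a - x - a * \<sigma>M / \<sigma>L"
  define G1 where "G1 = mode_integral \<sigma>M t z1 ?q"
  define G2 where "G2 = mode_integral \<sigma>M t z2 ?q"
  have q: "?q > 0" using pos by simp
  have z: "z1 + a * ?q > 0" "z2 + a * ?q > 0" using pos x by (simp_all add: z1_def z2_def)
  let ?g = "\<lambda>k. exp (\<i> * k * of_real z1 - (of_real \<sigma>M * k)\<^sup>2 * of_real t) / Delta_R a \<sigma>L \<sigma>M \<sigma>R (k * of_real (\<sigma>M / \<sigma>R))
    * half_line_ft a u0 (k * of_real ?q)"
  have "?g = (\<lambda>k. of_real (1 / (pi * \<Gamma>)) * (gauss (\<sigma>M\<^sup>2 * t) k * mode \<sigma>M z1 ?q k))"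
    unfolding exp_split mode_def Delta_R_eq by (simp add: mult.assoc)
  then have I2: "has_improper_contour_integral ?g (of_real (1 / (pi * \<Gamma>)) * G1) (bdry_D0_plus r)"
    using has_improper_contour_integral_cmult[OF has_improper_contour_integral_mode[OF pos(3) q t z(1) r]] by (simp only: G1_def)
  let ?f = "\<lambda>k. exp (\<i> * k * of_real (x + a + a * \<sigma>M / \<sigma>L) - (of_real \<sigma>M * k)\<^sup>2 * of_real t)
              / Delta_L a \<sigma>L \<sigma>M \<sigma>R (k * of_real ?q) * half_line_ft a u0 (- k * of_real ?q)"
  have "?f (- k) = of_real (1 / (pi * \<Gamma>)) * (gauss (\<sigma>M\<^sup>2 * t) k * mode \<sigma>M z2 ?q k)" for k
  proof -
    \<comment> \<open>The stated phase, reflected, is \<open>z2\<close> minus the round trip 4 a;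
      the same exponential stands in \<open>Delta_L_eq\<close> and cancels.\<close>
    have o: "osc (- k) (x + a + a * \<sigma>M / \<sigma>L) = osc k (- (4 * a * (\<sigma>M / \<sigma>M))) * osc k z2"
    proof -
      have "osc (- k) (x + a + a * \<sigma>M / \<sigma>L) = osc k (- (x + a + a * \<sigma>M / \<sigma>L))" by (rule osc_uminus)
      also have "- (x + a + a * \<sigma>M / \<sigma>L) = - (4 * a * (\<sigma>M / \<sigma>M)) + z2" using pos by (simp add: z2_def)
      finally show ?thesis by (simp only: osc_add)
    qed
    have nz: "osc k (- (4 * a * (\<sigma>M / \<sigma>M))) \<noteq> 0" by (simp add: osc_def)
    show ?thesis
      unfolding exp_split mode_def Delta_L_eq o using nz by (simp only: power2_minus minus_minus) (simp add: mult.assoc)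
  qed
  then have I1: "has_improper_contour_integral ?f (- (of_real (1 / (pi * \<Gamma>)) * G2)) (bdry_D0_minus r)"
    using has_improper_contour_integral_cmult[OF has_improper_contour_integral_mode[OF pos(3) q t z(2) r]] r
    by (intro has_improper_contour_integral_D0_minus) (simp_all only: G2_def)
  have "(LINT y|lebesgue. U y 0 * greenM x (of_real k) y)
     = of_real (1 + \<rho>L) * mode \<sigma>M z1 ?q (of_real k) + of_real ((1 + \<rho>L) * \<rho>R) * mode \<sigma>M z2 ?q (of_real k)" for k :: real
  proof -
    define c where "c = of_real (1 + \<rho>L) / \<delta> \<sigma>M (of_real k)"
    have i: "set_integrable lebesgue {..<-a} (\<lambda>y. u0 y * (T * osc (of_real k) (z - ?q * y)))" for T z
    proof (rule absolutely_integrable_mult_bounded[OF u0])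
      show "continuous_on UNIV (\<lambda>y. T * osc (of_real k) (z - ?q * y))" unfolding osc_def by (intro continuous_intros)
      show "norm (T * osc (of_real k) (z - ?q * y)) \<le> norm T" for y by (simp add: norm_mult)
    qed
    have "(LINT y|lebesgue. U y 0 * greenM x (of_real k) y) =
       (LINT y:{..<-a}|lebesgue. u0 y * (c * osc (of_real k) (z1 - ?q * y)) + u0 y * (c * of_real \<rho>R * osc (of_real k) (z2 - ?q * y)))"
      unfolding integral_U_initial
    proof (intro set_lebesgue_integral_cong allI impI)
      fix y assume y: "y \<in> {..<-a}"
      have "(x + a) - ?q * (y + a) = z1 - ?q * y" "(3 * a - x) - ?q * (y + a) = z2 - ?q * y"
        by (simp_all add: z1_def z2_def algebra_simps add_divide_distrib)
      then show "u0 y * greenM x (of_real k) y = u0 y * (c * osc (of_real k) (z1 - ?q * y)) + u0 y * (c * of_real \<rho>R * osc (of_real k) (z2 - ?q * y))"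
        using y unfolding greenM_def c_def[symmetric] by (simp only: lessThan_iff if_True distrib_left mult.assoc)
    qed simp
    also have "\<dots> = c * osc (of_real k) z1 * half_line_ft a u0 (of_real k * of_real ?q)
        + c * of_real \<rho>R * osc (of_real k) z2 * half_line_ft a u0 (of_real k * of_real ?q)"
      using set_integral_add(2)[OF i i] unfolding half_line_ft_osc .
    finally show ?thesis unfolding c_def mode_def by (simp add: mult_ac)
  qed
  then have "2 * of_real pi * uM x t = (LINT k|lborel.
      of_real (1 + \<rho>L) * (gauss (\<sigma>M\<^sup>2 * t) (of_real k) * mode \<sigma>M z1 ?q (of_real k))
      + of_real ((1 + \<rho>L) * \<rho>R) * (gauss (\<sigma>M\<^sup>2 * t) (of_real k) * mode \<sigma>M z2 ?q (of_real k)))"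
    using representation_middle[OF x t] by (simp only: mult.left_commute distrib_left)
  also have "\<dots> = of_real (1 + \<rho>L) * G1 + of_real ((1 + \<rho>L) * \<rho>R) * G2"
    unfolding G1_def G2_def mode_integral_def integral_mult_right_zero[symmetric]
    by (intro Bochner_Integration.integral_add integrable_mult_right integrable_mode pos q t)
  finally have u: "2 * of_real pi * uM x t = of_real (1 + \<rho>L) * G1 + of_real ((1 + \<rho>L) * \<rho>R) * G2" .
  have "1 + \<rho>L = 2 * \<sigma>M / (\<sigma>L + \<sigma>M)"
    using pos by (simp add: \<rho>L_def field_simps)
  then have c: "1 + \<rho>L = 2 * pi * (\<sigma>M * (\<sigma>M + \<sigma>R) * (1 / (pi * \<Gamma>)))" "(1 + \<rho>L) * \<rho>R = 2 * pi * (\<sigma>M * (\<sigma>M - \<sigma>R) * (1 / (pi * \<Gamma>)))"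
    using pos by (simp_all add: \<rho>R_def)
  have "2 * of_real pi * uM x t = 2 * of_real pi * (of_real (\<sigma>M * (\<sigma>M - \<sigma>R)) * (of_real (1 / (pi * \<Gamma>)) * G2) + of_real (\<sigma>M * (\<sigma>M + \<sigma>R)) * (of_real (1 / (pi * \<Gamma>)) * G1))"
    unfolding u c(2) unfolding c(1) by (simp only: of_real_mult of_real_numeral mult.assoc distrib_left add.commute)
  then have "uM x t = of_real (\<sigma>M * (\<sigma>M - \<sigma>R)) * (of_real (1 / (pi * \<Gamma>)) * G2) + of_real (\<sigma>M * (\<sigma>M + \<sigma>R)) * (of_real (1 / (pi * \<Gamma>)) * G1)"
    by (rule two_pi_cancel)
  \<comment> \<open>The inner minus sign belongs to the integral over the lower contour and stems
    from dk under k -> - k.\<close>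
  then have "uM x t = - of_real (\<sigma>M * (\<sigma>M - \<sigma>R)) * - (of_real (1 / (pi * \<Gamma>)) * G2) + of_real (\<sigma>M * (\<sigma>M + \<sigma>R)) * (of_real (1 / (pi * \<Gamma>)) * G1)"
    by (simp only: minus_mult_minus)
  with I1 I2 show ?thesis unfolding z1_def by blast
qed

text \<open>The incident part of the Green function is \<open>exp (\<i> k |y - x|)\<close>; replacing it by \<open>exp (\<i> k (x - y))\<close> changes its
  transform by an odd function of \<open>k\<close>, to which the Gaussian integral is blind.\<close>

lemma incident_part:
  fixes x :: real
  defines "v \<equiv> \<lambda>y. if x < y then u0 y else 0"
  shows "(LINT y:{..<-a}|lebesgue. u0 y * osc (of_real k) \<bar>y - x\<bar>)
      = osc (of_real k) x * half_line_ft a u0 (of_real k)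
        + (osc (of_real k) (- x) * half_line_ft a v (- of_real k) - osc (of_real k) x * half_line_ft a v (of_real k))"
    and "v absolutely_integrable_on {..<-a}"
proof -
  show v: "v absolutely_integrable_on {..<-a}"
  proof -
    have "u0 absolutely_integrable_on ({..<-a} \<inter> {x<..})"
      by (rule set_integrable_subset[OF u0]) auto
    also have "u0 absolutely_integrable_on ({..<-a} \<inter> {x<..}) \<longleftrightarrow> v absolutely_integrable_on {..<-a}"
      unfolding set_integrable_def v_def by (intro Bochner_Integration.integrable_cong) (auto simp: indicator_def)
    finally show ?thesis .
  qed
  have i: "set_integrable lebesgue {..<-a} (\<lambda>y. w y * (1 * osc (of_real k) (z - q * y)))" if "w absolutely_integrable_on {..<-a}" for w z q
  proof (rule absolutely_integrable_mult_bounded[OF that])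
    show "continuous_on UNIV (\<lambda>y. 1 * osc (of_real k) (z - q * y))" unfolding osc_def by (intro continuous_intros)
    show "norm (1 * osc (of_real k) (z - q * y)) \<le> 1" for y by simp
  qed
  \<comment> \<open>For y > x the incident wave is exp(i k (y - x)), not exp(i k (x - y)). The
    function \<open>v\<close> carries this correction, and the slope \<open>- 1\<close> yields its
    transform at \<open>- k\<close>.\<close>
  have "u0 y * osc (of_real k) \<bar>y - x\<bar> = u0 y * (1 * osc (of_real k) (x - 1 * y))
     + (v y * (1 * osc (of_real k) (- x - (- 1) * y)) - v y * (1 * osc (of_real k) (x - 1 * y)))" for y
    by (simp add: v_def abs_if)
  then have "(LINT y:{..<-a}|lebesgue. u0 y * osc (of_real k) \<bar>y - x\<bar>)
    = (LINT y:{..<-a}|lebesgue. u0 y * (1 * osc (of_real k) (x - 1 * y))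
     + (v y * (1 * osc (of_real k) (- x - (- 1) * y)) - v y * (1 * osc (of_real k) (x - 1 * y))))"
    by (simp only:)
  also have "\<dots> = 1 * osc (of_real k) x * half_line_ft a u0 (of_real k * of_real 1)
     + (1 * osc (of_real k) (- x) * half_line_ft a v (of_real k * of_real (- 1)) - 1 * osc (of_real k) x * half_line_ft a v (of_real k * of_real 1))"
    unfolding half_line_ft_osc[symmetric]
    by (subst set_integral_add(2)[OF i[OF u0] set_integral_diff(1)[OF i[OF v] i[OF v]]], subst set_integral_diff(2)[OF i[OF v] i[OF v]]) (rule refl)
  finally show "(LINT y:{..<-a}|lebesgue. u0 y * osc (of_real k) \<bar>y - x\<bar>)
      = osc (of_real k) x * half_line_ft a u0 (of_real k)
        + (osc (of_real k) (- x) * half_line_ft a v (- of_real k) - osc (of_real k) x * half_line_ft a v (of_real k))"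
    by simp
qed

lemma integrable_gaussian_half_line_ft:
  assumes "w absolutely_integrable_on {..<-a}" "\<beta> > 0"
  shows "integrable lborel (\<lambda>k. gauss \<beta> (of_real k) * (osc (of_real k) z * half_line_ft a w (of_real k)))"
    and "integrable lborel (\<lambda>k. gauss \<beta> (of_real k) * (osc (of_real k) z * half_line_ft a w (- of_real k)))"
proof -
  show 1: "integrable lborel (\<lambda>k. gauss \<beta> (of_real k) * (osc (of_real k) z * half_line_ft a w (of_real k)))" for z
    using assms pos by (intro integrable_gaussian_uhp[OF uhp_decay_mult[OF uhp_decay_osc half_line_ft_uhp_decay]]) auto
  have "osc (of_real (- k)) (- z) = osc (of_real k) z" for k by (simp add: osc_def)
  then show "integrable lborel (\<lambda>k. gauss \<beta> (of_real k) * (osc (of_real k) z * half_line_ft a w (- of_real k)))"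
    using lborel_integrable_real_affine[OF 1[of "- z"], of "- 1" 0] by simp
qed

text \<open>The incident term has the rate x + a < 0, so the contour deformation does not apply to
  it and its integral stays on the real line. The reflected terms have positive rates and move to
  the contour.\<close>

lemma solution_left:
  assumes x: "x < -a" and t: "t > 0" and r: "r > 0"
  shows "\<exists>I0 I1.
         has_bochner_integral lborel
           (\<lambda>k::real. exp (\<i> * of_real k * of_real x - (of_real \<sigma>L * of_real k)\<^sup>2 * of_real t)
              * half_line_ft a u0 (of_real k)) I0 \<and>
         has_improper_contour_integral
           (\<lambda>k. exp (\<i> * k * of_real (x + 2 * a) - (of_real \<sigma>L * k)\<^sup>2 * of_real t)
              / Delta_L a \<sigma>L \<sigma>M \<sigma>R k
              * (of_real ((\<sigma>L + \<sigma>M) * (\<sigma>M - \<sigma>R))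
                 + exp (4 * \<i> * k * of_real a * of_real (\<sigma>L / \<sigma>M))
                   * of_real ((\<sigma>L - \<sigma>M) * (\<sigma>M + \<sigma>R)))
              * half_line_ft a u0 (- k)) I1 (bdry_D0_minus r) \<and>
         uL x t = 1 / (2 * of_real pi) * I0 - 1 / 2 * I1"
proof -
  interpret M: three_layer a \<sigma>R \<sigma>M \<sigma>L "\<lambda>x. uR (- x)" "\<lambda>x. uM (- x)" "\<lambda>x. uL (- x)"
    "\<lambda>x t. - uRx (- x) t" "\<lambda>x t. - uMx (- x) t" "\<lambda>x t. - uLx (- x) t" by (rule mirror)
  \<comment> \<open>Mirroring exchanges the two reflection coefficients; \<delta> depends only on
    their product.\<close>
  have M: "M.U y s = U (- y) s" "M.\<rho>L = \<rho>R" "M.\<rho>R = \<rho>L" "M.\<delta> = \<delta>" for y s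
    using pos by (auto simp: M.U_def U_def M.\<rho>L_def M.\<rho>R_def \<rho>L_def \<rho>R_def M.\<delta>_def[abs_def] \<delta>_def[abs_def] mult.commute)
  \<comment> \<open>\<open>z2 - y\<close> is the length (- a - x) + (- a - y) of the path reflected
    directly at the left interface; \<open>z1\<close> adds a round trip through the middle
    layer.\<close>
  define z2 where "z2 = - x - 2 * a"
  define z1 where "z1 = z2 + 4 * a * (\<sigma>L / \<sigma>M)"
  define G1 where "G1 = mode_integral \<sigma>L t z1 1"
  define G2 where "G2 = mode_integral \<sigma>L t z2 1"
  define \<beta> where "\<beta> = \<sigma>L\<^sup>2 * t"
  have \<beta>: "\<beta> > 0" using pos t by (simp add: \<beta>_def)
  have "4 * a * (\<sigma>L / \<sigma>M) > 0" using pos by simp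
  then have z: "z1 + a * 1 > 0" "z2 + a * 1 > 0" using x unfolding z1_def z2_def by linarith+
  define I0 where "I0 = (LINT k|lborel. gauss \<beta> (of_real k) * (osc (of_real k) x * half_line_ft a u0 (of_real k)))"
  have I0: "has_bochner_integral lborel
           (\<lambda>k::real. exp (\<i> * of_real k * of_real x - (of_real \<sigma>L * of_real k)\<^sup>2 * of_real t) * half_line_ft a u0 (of_real k)) I0"
  proof -
    have "(\<lambda>k::real. exp (\<i> * of_real k * of_real x - (of_real \<sigma>L * of_real k)\<^sup>2 * of_real t) * half_line_ft a u0 (of_real k))
       = (\<lambda>k. gauss \<beta> (of_real k) * (osc (of_real k) x * half_line_ft a u0 (of_real k)))"
      unfolding exp_split \<beta>_def by (simp add: mult.assoc)
    then show ?thesis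
      unfolding I0_def using integrable_gaussian_half_line_ft(1)[OF u0 \<beta>, of x]
      by (simp only: has_bochner_integral_integrable)
  qed
  let ?f = "\<lambda>k. exp (\<i> * k * of_real (x + 2 * a) - (of_real \<sigma>L * k)\<^sup>2 * of_real t)
              / Delta_L a \<sigma>L \<sigma>M \<sigma>R k
              * (of_real ((\<sigma>L + \<sigma>M) * (\<sigma>M - \<sigma>R))
                 + exp (4 * \<i> * k * of_real a * of_real (\<sigma>L / \<sigma>M))
                   * of_real ((\<sigma>L - \<sigma>M) * (\<sigma>M + \<sigma>R)))
              * half_line_ft a u0 (- k)"
  have "?f (- k) = of_real (1 / pi) * (of_real \<rho>R * (gauss (\<sigma>L\<^sup>2 * t) k * mode \<sigma>L z1 1 k)
     + of_real (- \<rho>L) * (gauss (\<sigma>L\<^sup>2 * t) k * mode \<sigma>L z2 1 k))" for k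
  proof -
    define e where "e = osc k (- (4 * a * (\<sigma>L / \<sigma>M)))"
    define e' where "e' = osc k (4 * a * (\<sigma>L / \<sigma>M))"
    have ee: "e * e' = 1" unfolding e_def e'_def osc_add[symmetric] by (simp add: osc_def)
    then have e0: "e \<noteq> 0" by auto
    have 1: "exp (4 * \<i> * (- k) * of_real a * of_real (\<sigma>L / \<sigma>M)) = e" by (simp add: e_def osc_def mult_ac)
    have 2: "osc (- k) (x + 2 * a) = osc k z2" by (simp add: osc_def z2_def algebra_simps)
    have 3: "Delta_L a \<sigma>L \<sigma>M \<sigma>R (- k) = of_real (pi * \<Gamma>) * (e * \<delta> \<sigma>L k)"
      using Delta_L_eq[of k \<sigma>L] pos by (simp add: e_def)
    have 4: "osc k z1 = osc k z2 * e'" unfolding z1_def e'_def osc_add ..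
    define g where "g = complex_of_real \<Gamma>"
    have g0: "g \<noteq> 0" unfolding g_def using \<Gamma>_pos by (simp only: of_real_eq_0_iff)
    define E where "E = gauss (\<sigma>L\<^sup>2 * t) k * osc k z2 * half_line_ft a u0 k / \<delta> \<sigma>L k"
    have "?f (- k) = gauss (\<sigma>L\<^sup>2 * t) k * osc k z2 / (of_real pi * g * (e * \<delta> \<sigma>L k))
       * (g * of_real \<rho>R + e * - (g * of_real \<rho>L)) * half_line_ft a u0 k"
      unfolding exp_split 1 2 3 \<rho>_\<Gamma> g_def by (simp only: power2_minus minus_minus of_real_mult of_real_minus)
    also have "\<dots> = (g * (of_real \<rho>R - e * of_real \<rho>L)) / (g * e) * (E / of_real pi)"
      by (simp add: E_def algebra_simps)
    also have "\<dots> = (of_real \<rho>R - e * of_real \<rho>L) / e * (E / of_real pi)"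
      using g0 by simp
    \<comment> \<open>Dividing by the exponential from \<open>Delta_L_eq\<close> turns the bracket
      of the stated integrand into the numerator of the reflected term in the mirrored Green
      function.\<close>
    also have "(of_real \<rho>R - e * of_real \<rho>L) / e = of_real \<rho>R * e' - of_real \<rho>L"
      using ee e0 by (simp add: field_simps)
    finally show ?thesis unfolding mode_def 4 E_def by (simp add: algebra_simps diff_divide_distrib)
  qed
  then have I1: "has_improper_contour_integral ?f (- (of_real (1 / pi) * (of_real \<rho>R * G1 + of_real (- \<rho>L) * G2))) (bdry_D0_minus r)"
    using has_improper_contour_integral_cmult[OF has_improper_contour_integral_add[OF
      has_improper_contour_integral_cmult[OF has_improper_contour_integral_mode[OF pos(2) zero_less_one t z(1) r]]
      has_improper_contour_integral_cmult[OF has_improper_contour_integral_mode[OF pos(2) zero_less_one t z(2) r]]]] r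
    by (intro has_improper_contour_integral_D0_minus) (simp_all only: G1_def G2_def)
  define v where "v = (\<lambda>y. if x < y then u0 y else 0)"
  have v: "v absolutely_integrable_on {..<-a}" unfolding v_def by (rule incident_part(2))
  define h where "h k = osc (of_real k) (- x) * half_line_ft a v (- of_real k) - osc (of_real k) x * half_line_ft a v (of_real k)" for k
  have W: "(LINT y|lebesgue. M.U y 0 * M.greenR (- x) (of_real k) y)
     = osc (of_real k) x * half_line_ft a u0 (of_real k) + h k
       + (of_real \<rho>R * mode \<sigma>L z1 1 (of_real k) + of_real (- \<rho>L) * mode \<sigma>L z2 1 (of_real k))" for k :: real
  proof -
    define c where "c = (of_real \<rho>R * osc (of_real k) (4 * a * (\<sigma>L / \<sigma>M)) - of_real \<rho>L) / \<delta> \<sigma>L (of_real k)"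
    have "(LINT y|lebesgue. M.U y 0 * M.greenR (- x) (of_real k) y) = (LINT y|lebesgue. U y 0 * M.greenR (- x) (of_real k) (- y))"
      using integral_lebesgue_reflect[of "\<lambda>y. U y 0 * M.greenR (- x) (of_real k) (- y)"] by (simp add: M(1))
    also have "\<dots> = (LINT y:{..<-a}|lebesgue. u0 y * osc (of_real k) \<bar>y - x\<bar> + u0 y * (c * osc (of_real k) (z2 - 1 * y)))"
      unfolding integral_U_initial
    proof (intro set_lebesgue_integral_cong allI impI)
      fix y assume y: "y \<in> {..<-a}"
      have "\<bar>- y - - x\<bar> = \<bar>y - x\<bar>" "- x + - y - 2 * a = z2 - 1 * y" by (simp_all add: z2_def)
      moreover have "\<not> - y < - a" "\<not> - y < a" using y pos by auto
      ultimately show "u0 y * M.greenR (- x) (of_real k) (- y) = u0 y * osc (of_real k) \<bar>y - x\<bar> + u0 y * (c * osc (of_real k) (z2 - 1 * y))"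
        unfolding M.greenR_def M c_def by (simp only: if_False distrib_left)
    qed simp
    also have "\<dots> = (LINT y:{..<-a}|lebesgue. u0 y * osc (of_real k) \<bar>y - x\<bar>) + (LINT y:{..<-a}|lebesgue. u0 y * (c * osc (of_real k) (z2 - 1 * y)))"
    proof (intro set_integral_add(2) absolutely_integrable_mult_bounded[OF u0])
      show "continuous_on UNIV (\<lambda>y. osc (of_real k) \<bar>y - x\<bar>)" "continuous_on UNIV (\<lambda>y. c * osc (of_real k) (z2 - 1 * y))"
        unfolding osc_def by (intro continuous_intros)+
      show "norm (osc (of_real k) \<bar>y - x\<bar>) \<le> 1" "norm (c * osc (of_real k) (z2 - 1 * y)) \<le> norm c" for y
        by (simp_all add: norm_mult)
    qed
    also have "\<dots> = osc (of_real k) x * half_line_ft a u0 (of_real k) + h k + c * osc (of_real k) z2 * half_line_ft a u0 (of_real k)"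
      unfolding half_line_ft_osc incident_part(1) h_def v_def by simp
    also have "c * osc (of_real k) z2 * half_line_ft a u0 (of_real k)
        = of_real \<rho>R * mode \<sigma>L z1 1 (of_real k) + of_real (- \<rho>L) * mode \<sigma>L z2 1 (of_real k)"
      unfolding c_def mode_def z1_def osc_add by (simp add: algebra_simps diff_divide_distrib)
    finally show ?thesis .
  qed
  let ?e = "\<lambda>k::real. gauss \<beta> (of_real k) :: complex"
  have iO: "integrable lborel (\<lambda>k. ?e k * h k)"
    unfolding h_def right_diff_distrib
    by (intro Bochner_Integration.integrable_diff integrable_gaussian_half_line_ft v \<beta>)
  have "(LINT k|lborel. ?e k * h k) = 0"
  proof (rule integral_odd_eq_0)
    fix k :: real
    have "osc (of_real (- k)) w = osc (of_real k) (- w)" for w by (simp add: osc_def)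
    then show "?e (- k) * h (- k) = - (?e k * h k)" by (simp add: h_def algebra_simps)
  qed
  moreover have "2 * of_real pi * uL x t = (LINT k|lborel. (?e k * (osc (of_real k) x * half_line_ft a u0 (of_real k)) + ?e k * h k)
      + (of_real \<rho>R * (?e k * mode \<sigma>L z1 1 (of_real k)) + of_real (- \<rho>L) * (?e k * mode \<sigma>L z2 1 (of_real k))))"
    using M.representation_right[of "- x" t] x t unfolding W \<beta>_def[symmetric] by (simp only: distrib_left mult.left_commute) simp
  moreover have "\<dots> = (I0 + (LINT k|lborel. ?e k * h k)) + (of_real \<rho>R * G1 + of_real (- \<rho>L) * G2)"
  proof -
    note i = integrable_gaussian_half_line_ft(1)[OF u0 \<beta>, of x] iO
      integrable_mult_right[OF integrable_mode[OF pos(2) zero_less_one t, of z1], of "of_real \<rho>R", folded \<beta>_def]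
      integrable_mult_right[OF integrable_mode[OF pos(2) zero_less_one t, of z2], of "of_real (- \<rho>L)", folded \<beta>_def]
    show ?thesis
      unfolding I0_def G1_def G2_def mode_integral_def \<beta>_def[symmetric] integral_mult_right_zero[symmetric]
      using i by (simp only: Bochner_Integration.integral_add Bochner_Integration.integrable_add)
  qed
  ultimately have "2 * of_real pi * uL x t = I0 + (of_real \<rho>R * G1 + of_real (- \<rho>L) * G2)" by simp
  then have "uL x t = 1 / (2 * of_real pi) * I0 - 1 / 2 * - (of_real (1 / pi) * (of_real \<rho>R * G1 + of_real (- \<rho>L) * G2))"
    by (simp add: field_simps)
  with I0 I1 show ?thesis by blast
qed

end

theorem proposition3:
  fixes a \<sigma>L \<sigma>M \<sigma>R r :: real
    and u0 :: "real \<Rightarrow> complex"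
    and uL uM uR uLx uMx uRx :: "real \<Rightarrow> real \<Rightarrow> complex"
  assumes pos: "a > 0" "\<sigma>L > 0" "\<sigma>M > 0" "\<sigma>R > 0"
    and r: "r > 0"
    and u0: "u0 absolutely_integrable_on {..<-a}"
    and solL: "classical_heat_solution \<sigma>L {..<-a} uL uLx"
    and solM: "classical_heat_solution \<sigma>M {-a<..<a} uM uMx"
    and solR: "classical_heat_solution \<sigma>R {a<..} uR uRx"
    and initL: "\<And>x. x < -a \<Longrightarrow> uL x 0 = u0 x"
    and initM: "\<And>x. -a < x \<Longrightarrow> x < a \<Longrightarrow> uM x 0 = 0"
    and initR: "\<And>x. x > a \<Longrightarrow> uR x 0 = 0"
    and asymL: "\<And>t. t > 0 \<Longrightarrow> ((\<lambda>x. uL x t) \<longlongrightarrow> 0) at_bot"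
    and asymR: "\<And>t. t > 0 \<Longrightarrow> ((\<lambda>x. uR x t) \<longlongrightarrow> 0) at_top"
    and contLM: "\<And>t. t > 0 \<Longrightarrow> uL (-a) t = uM (-a) t"
    and contMR: "\<And>t. t > 0 \<Longrightarrow> uM a t = uR a t"
    and fluxLM: "\<And>t. t > 0 \<Longrightarrow> of_real (\<sigma>L\<^sup>2) * uLx (-a) t = of_real (\<sigma>M\<^sup>2) * uMx (-a) t"
    and fluxMR: "\<And>t. t > 0 \<Longrightarrow> of_real (\<sigma>M\<^sup>2) * uMx a t = of_real (\<sigma>R\<^sup>2) * uRx a t"
  shows
    "\<forall>t>0.
      (\<forall>x. x < -a \<longrightarrow> (\<exists>I0 I1.
         has_bochner_integral lborel
           (\<lambda>k::real. exp (\<i> * of_real k * of_real x - (of_real \<sigma>L * of_real k)\<^sup>2 * of_real t)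
              * half_line_ft a u0 (of_real k)) I0 \<and>
         has_improper_contour_integral
           (\<lambda>k. exp (\<i> * k * of_real (x + 2 * a) - (of_real \<sigma>L * k)\<^sup>2 * of_real t)
              / Delta_L a \<sigma>L \<sigma>M \<sigma>R k
              * (of_real ((\<sigma>L + \<sigma>M) * (\<sigma>M - \<sigma>R))
                 + exp (4 * \<i> * k * of_real a * of_real (\<sigma>L / \<sigma>M))
                   * of_real ((\<sigma>L - \<sigma>M) * (\<sigma>M + \<sigma>R)))
              * half_line_ft a u0 (- k)) I1 (bdry_D0_minus r) \<and>
         uL x t = 1 / (2 * of_real pi) * I0 - 1 / 2 * I1)) \<and>
      (\<forall>x. -a < x \<and> x < a \<longrightarrow> (\<exists>I1 I2.
         has_improper_contour_integral
           (\<lambda>k. exp (\<i> * k * of_real (x + a + a * \<sigma>M / \<sigma>L) - (of_real \<sigma>M * k)\<^sup>2 * of_real t)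
              / Delta_L a \<sigma>L \<sigma>M \<sigma>R (k * of_real (\<sigma>M / \<sigma>L))
              * half_line_ft a u0 (- k * of_real (\<sigma>M / \<sigma>L))) I1 (bdry_D0_minus r) \<and>
         has_improper_contour_integral
           (\<lambda>k. exp (\<i> * k * of_real (x + a - a * \<sigma>M / \<sigma>L) - (of_real \<sigma>M * k)\<^sup>2 * of_real t)
              / Delta_R a \<sigma>L \<sigma>M \<sigma>R (k * of_real (\<sigma>M / \<sigma>R))
              * half_line_ft a u0 (k * of_real (\<sigma>M / \<sigma>L))) I2 (bdry_D0_plus r) \<and>
         uM x t = - of_real (\<sigma>M * (\<sigma>M - \<sigma>R)) * I1 + of_real (\<sigma>M * (\<sigma>M + \<sigma>R)) * I2)) \<and>
      (\<forall>x. x > a \<longrightarrow> (\<exists>I1.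
         has_improper_contour_integral
           (\<lambda>k. exp (\<i> * k * of_real (x - a - a * \<sigma>R / \<sigma>L + 2 * a * \<sigma>R / \<sigma>M)
                  - (of_real \<sigma>R * k)\<^sup>2 * of_real t)
              / Delta_R a \<sigma>L \<sigma>M \<sigma>R k
              * half_line_ft a u0 (k * of_real (\<sigma>R / \<sigma>L))) I1 (bdry_D0_plus r) \<and>
         uR x t = 2 * of_real (\<sigma>M * \<sigma>R) * I1))"
proof -
  interpret three_layer_initial a \<sigma>L \<sigma>M \<sigma>R uL uM uR uLx uMx uRx u0
    by unfold_locales (fact assms)+
  show ?thesis
    using solution_left[OF _ _ r] solution_middle[OF _ _ _ r] solution_right[OF _ _ r] by (intro allI impI conjI) blast+
qed

end
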